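(* Let $D\subset\mathbb{R}^d$ be a nonempty open bounded $C^{1,1}$ set. Then $\hat p_D$ and $p_D$ are comparable if and only if $D$ is convex. Here comparability means that there is a constant $c\in(0,\infty)$ such that $c^{-1}p_D(t,x,y)\le \hat p_D(t,x,y)\le c\,p_D(t,x,y)$ for all $t>0$ and $x,y\in D$.
   Context: $d\ge 1$, $0<\alpha<2$. $X=(X_t)_{t\ge 0}$ is the standard isotropic $\alpha$-stable Lévy process in $\mathbb{R}^d$ with càdlàg paths; $\mathbb{P}_x,\mathbb{E}_x$ are its law and expectation when started from $x$, so $\mathbb{E}_0e^{i\xi\cdot X_t}=e^{-t|\xi|^\alpha}$. Its transition density is $p(t,x,y)=p_t(y-x)$, where $p_t(x)=(2\pi)^{-d}\int_{\mathbb{R}^d}e^{-ix\cdot\xi}e^{-t|\xi|^\alpha}\,d\xi$. $[v,w]$ is the line segment between $v$ and $w$, $X_{0-}=X_0$. First exit time: $\tau_D=\inf\{t>0:X_t\in D^c\}$; shot-down time: $\sigma_D=\inf\{t>0:[X_{t^-},X_t]\cap D^c\ne\emptyset\}$. With $\mathbb{E}[A;F]=\int_AF\,d\mathbb{P}$, the heat kernels of the killed and of the shot-down process are $$p_D(t,x,y)=p(t,x,y)-\mathbb{E}_x[\tau_D<t;\ p(t-\tau_D,X_{\tau_D},y)],\qquad \hat p_D(t,x,y)=p(t,x,y)-\mathbb{E}_x[\sigma_D<t;\ p(t-\sigma_D,X_{\sigma_D},y)].$$ An open set $D$ is $C^{1,1}$ (at scale $r>0$) if for every $Q\in\partial D$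 there are balls $B(x',r)\subset D$ and $B(x'',r)\subset D^c$ tangent at $Q$; a $C^{1,1}$ set is one that is $C^{1,1}$ at some scale $r>0$. *)

theory Defs
  imports "HOL-Probability.Probability"
begin

section \<open>Cadlag paths, exit time and shot-down time\<close>

text \<open>
  Paths are functions on \<^typ>\<open>real\<close>; only their values at times \<open>t \<ge> 0\<close> matter.
\<close>

definition cadlag :: "(real \<Rightarrow> 'a::topological_space) \<Rightarrow> bool" where
  "cadlag w \<longleftrightarrow>
     (\<forall>t\<ge>0. (w \<longlongrightarrow> w t) (at_right t)) \<and>
     (\<forall>t>0. \<exists>l. (w \<longlongrightarrow> l) (at_left t))"

definition left_lim :: "(real \<Rightarrow> 'a::t2_space) \<Rightarrow> real \<Rightarrow> 'a" where
  "left_lim w t = (if t = 0 then w 0 else Lim (at_left t) w)"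

text \<open>Both times are extended reals, equal to \<open>\<infinity>\<close> if the event never happens.\<close>

definition exit_time :: "'a set \<Rightarrow> (real \<Rightarrow> 'a) \<Rightarrow> ereal" where
  "exit_time D w = Inf (ereal ` {t. t > 0 \<and> w t \<in> - D})"

definition shot_down_time :: "'a::euclidean_space set \<Rightarrow> (real \<Rightarrow> 'a) \<Rightarrow> ereal" where
  "shot_down_time D w =
     Inf (ereal ` {t. t > 0 \<and> closed_segment (left_lim w t) (w t) \<inter> - D \<noteq> {}})"

section \<open>The isotropic stable process\<close>

definition levy_process :: "'w measure \<Rightarrow> (real \<Rightarrow> 'w \<Rightarrow> 'a::euclidean_space) \<Rightarrow> bool" where
  "levy_process M X \<longleftrightarrow>
     prob_space M \<and>
     (\<forall>t\<ge>0. X t \<in> borel_measurable M) \<and>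
     (AE \<omega> in M. X 0 \<omega> = 0) \<and>
     (\<forall>(s::nat \<Rightarrow> real) n. 0 \<le> s 0 \<and> (\<forall>i<n. s i < s (Suc i)) \<longrightarrow>
        prob_space.indep_vars M (\<lambda>_. borel) (\<lambda>i \<omega>. X (s (Suc i)) \<omega> - X (s i) \<omega>) {..<n}) \<and>
     (\<forall>s\<ge>0. \<forall>t\<ge>0. distr M borel (\<lambda>\<omega>. X (s + t) \<omega> - X s \<omega>) = distr M borel (X t)) \<and>
     (\<forall>\<omega>\<in>space M. cadlag (\<lambda>t. X t \<omega>))"

text \<open>
  The process is started from \<open>0\<close>; its law when started from \<open>x\<close> is that of \<open>x + X\<close>.
\<close>

definition isotropic_stable_process ::
    "real \<Rightarrow> 'w measure \<Rightarrow> (real \<Rightarrow> 'w \<Rightarrow> 'a::euclidean_space) \<Rightarrow> bool" where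
  "isotropic_stable_process \<alpha> M X \<longleftrightarrow>
     levy_process M X \<and>
     (\<forall>t\<ge>0. \<forall>\<xi>. (\<integral>\<omega>. exp (\<i> * complex_of_real (\<xi> \<bullet> X t \<omega>)) \<partial>M)
        = complex_of_real (exp (- t * norm \<xi> powr \<alpha>)))"

section \<open>Heat kernels\<close>

text \<open>The integral is real; \<^const>\<open>Re\<close> only changes the type.\<close>

definition stable_density :: "real \<Rightarrow> real \<Rightarrow> 'a::euclidean_space \<Rightarrow> real" where
  "stable_density \<alpha> t x =
     1 / (2 * pi) ^ DIM('a) *
     Re (\<integral>\<xi>. exp (- \<i> * complex_of_real (x \<bullet> \<xi>))
              * complex_of_real (exp (- t * norm \<xi> powr \<alpha>)) \<partial>lborel)"

definition transition_density :: "real \<Rightarrow> real \<Rightarrow> 'a::euclidean_space \<Rightarrow> 'a \<Rightarrow> real" where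
  "transition_density \<alpha> t x y = stable_density \<alpha> t (y - x)"

text \<open>
  Given a random time \<open>T\<close> of the path, this is
  \<open>p(t,x,y) - E\<^sub>x[T < t; p(t - T, X\<^sub>T, y)]\<close>. Expectations are taken on the completed space,
  because the hitting time of a closed set by a cadlag process need only be measurable
  with respect to the completion (and a nonmeasurable function would have integral \<open>0\<close>).
\<close>

definition stopped_kernel ::
    "((real \<Rightarrow> 'a) \<Rightarrow> ereal) \<Rightarrow> real \<Rightarrow> 'w measure \<Rightarrow> (real \<Rightarrow> 'w \<Rightarrow> 'a::euclidean_space) \<Rightarrow>
     real \<Rightarrow> 'a \<Rightarrow> 'a \<Rightarrow> real" where
  "stopped_kernel T \<alpha> M X t x y =
     (let path = (\<lambda>\<omega> s. x + X s \<omega>);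
          \<tau> = (\<lambda>\<omega>. real_of_ereal (T (path \<omega>)))
      in transition_density \<alpha> t x y
         - (LINT \<omega>:{\<omega>\<in>space M. T (path \<omega>) < ereal t}|completion M.
              transition_density \<alpha> (t - \<tau> \<omega>) (path \<omega> (\<tau> \<omega>)) y))"

definition killed_heat_kernel ::
    "'a::euclidean_space set \<Rightarrow> real \<Rightarrow> 'w measure \<Rightarrow> (real \<Rightarrow> 'w \<Rightarrow> 'a) \<Rightarrow>
     real \<Rightarrow> 'a \<Rightarrow> 'a \<Rightarrow> real" where
  "killed_heat_kernel D = stopped_kernel (exit_time D)"

definition shot_down_heat_kernel ::
    "'a::euclidean_space set \<Rightarrow> real \<Rightarrow> 'w measure \<Rightarrow> (real \<Rightarrow> 'w \<Rightarrow> 'a) \<Rightarrow>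
     real \<Rightarrow> 'a \<Rightarrow> 'a \<Rightarrow> real" where
  "shot_down_heat_kernel D = stopped_kernel (shot_down_time D)"

definition comparable_kernels ::
    "'a set \<Rightarrow> (real \<Rightarrow> 'a \<Rightarrow> 'a \<Rightarrow> real) \<Rightarrow> (real \<Rightarrow> 'a \<Rightarrow> 'a \<Rightarrow> real) \<Rightarrow> bool" where
  "comparable_kernels D q p \<longleftrightarrow>
     (\<exists>c>0. \<forall>t>0. \<forall>x\<in>D. \<forall>y\<in>D. inverse c * p t x y \<le> q t x y \<and> q t x y \<le> c * p t x y)"

section \<open>Open sets of class \<open>C\<^sup>1\<^sup>,\<^sup>1\<close>\<close>

text \<open>Tangency at \<open>Q\<close> of the two balls: their closures meet exactly at \<open>Q\<close>.\<close>

definition C11_at_scale :: "real \<Rightarrow> 'a::euclidean_space set \<Rightarrow> bool" where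
  "C11_at_scale r D \<longleftrightarrow> open D \<and>
     (\<forall>Q\<in>frontier D. \<exists>x' x''. ball x' r \<subseteq> D \<and> ball x'' r \<subseteq> - D \<and>
        cball x' r \<inter> cball x'' r = {Q})"

definition C11_set :: "'a::euclidean_space set \<Rightarrow> bool" where
  "C11_set D \<longleftrightarrow> (\<exists>r>0. C11_at_scale r D)"

end

theory Submission
  imports Defs
begin

text \<open>
  Integrated in \<open>y\<close> over a Borel set \<open>B\<close>, a kernel stopped at an optional time \<open>T\<close> gives
  the probability that the process started at \<open>x\<close> is in \<open>B\<close> at time \<open>t\<close> while \<open>T \<ge> t\<close>;
  this is the strong Markov property (\<open>integral_stopped_kernel\<close>). The comparison of the
  two heat kernels is thereby a comparison of two probabilities, with \<open>T\<close> the exit time or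
  the shot-down time.

  If \<open>D\<close> is convex, a jump between two points of \<open>D\<close> has its segment in \<open>D\<close>, so the two
  times can differ only if the path reaches the complement of \<open>D\<close> by a left limit and
  jumps back into \<open>D\<close> at the same instant. The entrance times into shrinking
  neighbourhoods of the complement announce such an instant, and a Levy process does not
  jump at an announced time (\<open>quasi_left_continuity\<close>). Hence the times agree almost surely
  (\<open>AE_exit_time_eq\<close>), and the two kernels are equal, not merely comparable.

  If \<open>D\<close> is not convex, the exterior balls of the \<open>C\<^sup>1\<^sup>,\<^sup>1\<close> condition allow a segment with
  end points in \<open>D\<close> to be moved so that it passes through the interior of the complement.
  There are then small balls around points \<open>x\<close> and \<open>y\<close> of \<open>D\<close> such that every segment from
  one to the other leaves \<open>D\<close> (\<open>nonconvex_separated_balls\<close>). Start at \<open>x\<close> and let \<open>t\<close> tend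
  to \<open>0\<close>. The killed process is in the ball around \<open>y\<close> at time \<open>t\<close> with probability at
  least a constant times \<open>t\<close>, because a single jump can take it there
  (\<open>prob_ball_lower_bound\<close>, \<open>prob_return_after_exit_le\<close>). The shot-down process does not
  survive such a jump: it must first leave the ball around \<open>x\<close> to somewhere else, which
  has probability \<open>o(1)\<close>, and then be displaced once more by a fixed amount, which has
  conditional probability \<open>O(t)\<close>. Its probability is therefore \<open>o(t)\<close>
  (\<open>prob_shot_down_le\<close>), and no constant bounds the ratio.

  Everything probabilistic is derived from the characteristic function
  \<open>exp (- t * norm \<xi> powr \<alpha>)\<close>. The strong Markov property is used for the characters
  \<open>iexp (\<xi> \<bullet> z)\<close>, where it involves only this explicit function of \<open>t\<close>; integrating over
  \<open>\<xi>\<close> against a Gaussian turns statements about characters into estimates of displacements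
  (\<open>gauss_average_iexp\<close>). The density of the process is identified by Fourier inversion
  with Gaussian mollification (\<open>fourier_inversion\<close>). The lower bound for a ball tests the
  law with a Gaussian bump that vanishes at the origin and uses that \<open>norm \<xi> powr \<alpha>\<close> is a
  positive mixture of the functions \<open>1 - exp (- u * (norm \<xi>)\<^sup>2 / 2)\<close>.
\<close>

section \<open>Gaussian densities\<close>

text \<open>
  The density of the centred normal distribution whose coordinates are independent with
  standard deviation \<open>s\<close>.
\<close>

definition gauss :: "real \<Rightarrow> 'a::euclidean_space \<Rightarrow> real" where
  "gauss s x = exp (- (norm x)\<^sup>2 / (2 * s\<^sup>2)) / (s * sqrt (2 * pi)) ^ DIM('a)"

text \<open>
  Lebesgue measure is the image of a product measure, so integrals of products of
  functions of the single coordinates factorise.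
\<close>

lemma lborel_prod_Basis:
  fixes f :: "'a::euclidean_space \<Rightarrow> real \<Rightarrow> complex"
  assumes "\<And>b. b \<in> Basis \<Longrightarrow> integrable lborel (f b)"
  shows "integrable lborel (\<lambda>x::'a. \<Prod>b\<in>Basis. f b (x \<bullet> b))"
    and "integral\<^sup>L lborel (\<lambda>x::'a. \<Prod>b\<in>Basis. f b (x \<bullet> b)) = (\<Prod>b\<in>Basis. (\<integral>u. f b u \<partial>lborel))"
proof -
  interpret product_sigma_finite "\<lambda>b::'a. lborel :: real measure"
    by standard
  have [measurable]: "\<And>b. b \<in> Basis \<Longrightarrow> f b \<in> borel_measurable borel"
    using assms[THEN borel_measurable_integrable] by simp
  have coord: "(\<Prod>b\<in>Basis. f b ((\<Sum>c\<in>Basis. x c *\<^sub>R c) \<bullet> b)) = (\<Prod>b\<in>Basis. f b (x b))"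
    for x :: "'a \<Rightarrow> real"
    by (intro prod.cong refl) simp
  have meas: "(\<lambda>x::'a. \<Prod>b\<in>Basis. f b (x \<bullet> b)) \<in> borel_measurable borel"
    by measurable
  have sm: "(\<lambda>f. \<Sum>b\<in>Basis. f b *\<^sub>R b) \<in> (\<Pi>\<^sub>M b\<in>(Basis::'a set). lborel) \<rightarrow>\<^sub>M borel"
    by measurable
  show "integrable lborel (\<lambda>x::'a. \<Prod>b\<in>Basis. f b (x \<bullet> b))"
    apply (subst lborel_eq)
    apply (subst integrable_distr_eq[OF sm meas])
    unfolding coord using assms by (intro product_integrable_prod) auto
  show "integral\<^sup>L lborel (\<lambda>x::'a. \<Prod>b\<in>Basis. f b (x \<bullet> b)) = (\<Prod>b\<in>Basis. (\<integral>u. f b u \<partial>lborel))"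
    apply (subst lborel_eq)
    apply (subst integral_distr[OF sm meas])
    unfolding coord using assms by (intro product_integral_prod) auto
qed

lemma norm_square_eq_sum: "(norm x)\<^sup>2 = (\<Sum>b\<in>Basis. (x \<bullet> b)\<^sup>2)"
  unfolding power2_norm_eq_inner by (subst euclidean_inner) (simp add: power2_eq_square)

lemma gauss_eq_prod:
  fixes x :: "'a::euclidean_space"
  assumes "s > 0"
  shows "gauss s x = (\<Prod>b\<in>Basis. normal_density 0 s (x \<bullet> b))"
proof -
  have "(norm x)\<^sup>2 = (\<Sum>b\<in>Basis. (x \<bullet> b)\<^sup>2)"
    by (rule norm_square_eq_sum)
  moreover have "sqrt (2 * pi * s\<^sup>2) = s * sqrt (2 * pi)"
    using assms by (simp add: real_sqrt_mult)
  ultimately show ?thesis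
    unfolding gauss_def normal_density_def
    by (simp add: prod_dividef exp_sum[symmetric] sum_negf sum_divide_distrib[symmetric])
qed

lemma gauss_nonneg [simp]: "s > 0 \<Longrightarrow> 0 \<le> gauss s x"
  by (simp add: gauss_def)

lemma gauss_pos: "s > 0 \<Longrightarrow> 0 < gauss s x"
  by (simp add: gauss_def)

lemma gauss_commute: "gauss s (x - y) = gauss s (y - x)"
  by (simp add: gauss_def norm_minus_commute)

lemma gauss_measurable [measurable]: "gauss s \<in> borel_measurable borel"
  unfolding gauss_def by measurable

lemma gauss_bound:
  fixes x :: "'a::euclidean_space"
  assumes "s > 0" shows "gauss s x \<le> gauss s (0::'a)"
  using assms by (auto simp: gauss_def intro!: divide_right_mono)

text \<open>
  The Gaussian factorises over the coordinates, so its Fourier transform is a product of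
  one-dimensional ones.
\<close>

lemma fourier_gauss:
  fixes \<xi> :: "'a::euclidean_space"
  assumes s: "s > 0"
  shows "integrable lborel (\<lambda>x::'a. gauss s x)"
    and "(\<integral>x. iexp (\<xi> \<bullet> x) * complex_of_real (gauss s x) \<partial>lborel)
           = complex_of_real (exp (- s\<^sup>2 * (norm \<xi>)\<^sup>2 / 2))"
proof -
  let ?f = "\<lambda>b u. iexp ((\<xi> \<bullet> b) * u) * complex_of_real (normal_density 0 s u)"
  have eq: "iexp (\<xi> \<bullet> x) * complex_of_real (gauss s x) = (\<Prod>b\<in>Basis. ?f b (x \<bullet> b))" for x
  proof -
    have "iexp (\<xi> \<bullet> x) = (\<Prod>b\<in>Basis. iexp ((\<xi> \<bullet> b) * (x \<bullet> b)))"
      by (subst euclidean_inner) (simp add: exp_sum sum_distrib_left)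
    then show ?thesis
      by (simp add: gauss_eq_prod[OF s] prod.distrib)
  qed
  have int: "integrable lborel (?f b)" for b
    by (rule Bochner_Integration.integrable_bound[OF integrable_normal_density[OF s, of 0]])
       (auto simp: norm_mult)
  have one: "(\<integral>u. ?f b u \<partial>lborel) = complex_of_real (exp (- s\<^sup>2 * (\<xi> \<bullet> b)\<^sup>2 / 2))" for b
  proof -
    have "(\<integral>u. ?f b u \<partial>lborel) = s *\<^sub>R (\<integral>u. ?f b (0 + s * u) \<partial>lborel)"
      using s by (subst lborel_integral_real_affine[where c=s and t=0]) auto
    also have "\<dots> = (\<integral>u. s *\<^sub>R ?f b (s * u) \<partial>lborel)"
      by simp
    also have "\<dots> = (\<integral>u. std_normal_density u *\<^sub>R iexp ((\<xi> \<bullet> b) * s * u) \<partial>lborel)"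
    proof (intro Bochner_Integration.integral_cong refl)
      fix u :: real
      have "s * normal_density 0 s (s * u) = std_normal_density u"
        using s by (simp add: normal_density_def real_sqrt_mult power_mult_distrib field_simps)
      then show "s *\<^sub>R ?f b (s * u) = std_normal_density u *\<^sub>R iexp ((\<xi> \<bullet> b) * s * u)"
        by (simp add: scaleR_conv_of_real mult_ac flip: of_real_mult)
    qed
    also have "\<dots> = char std_normal_distribution ((\<xi> \<bullet> b) * s)"
      unfolding char_def by (subst integral_density) auto
    finally show ?thesis
      by (simp add: char_std_normal_distribution power_mult_distrib mult_ac)
  qed
  have nsum: "(norm \<xi>)\<^sup>2 = (\<Sum>b\<in>Basis. (\<xi> \<bullet> b)\<^sup>2)"
    by (rule norm_square_eq_sum)
  show "(\<integral>x. iexp (\<xi> \<bullet> x) * complex_of_real (gauss s x) \<partial>lborel)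
           = complex_of_real (exp (- s\<^sup>2 * (norm \<xi>)\<^sup>2 / 2))"
    unfolding eq
    apply (subst lborel_prod_Basis(2))
    subgoal by (rule int)
    unfolding one nsum
    by (simp add: exp_sum[symmetric] sum_distrib_left sum_negf sum_divide_distrib flip: of_real_prod)
  have "integrable lborel (\<lambda>x. iexp (\<xi> \<bullet> x) * complex_of_real (gauss s x))"
    unfolding eq by (rule lborel_prod_Basis(1)) (rule int)
  then have "integrable lborel (\<lambda>x. norm (iexp (\<xi> \<bullet> x) * complex_of_real (gauss s x)))"
    by (rule integrable_norm)
  then show "integrable lborel (\<lambda>x::'a. gauss s x)"
    using s by (simp add: norm_mult)
qed

lemma integral_gauss:
  assumes "s > 0"
  shows "integral\<^sup>L lborel (gauss s :: 'a::euclidean_space \<Rightarrow> real) = 1"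
proof -
  have "complex_of_real (integral\<^sup>L lborel (gauss s :: 'a \<Rightarrow> real)) = 1"
    using fourier_gauss(2)[OF assms, of "0::'a"] by (simp flip: integral_of_real)
  then show ?thesis by simp
qed

text \<open>
  Up to a factor, the Fourier transform of a Gaussian is again a Gaussian; the inversion
  formula for Gaussians follows by transforming twice.
\<close>

lemma exp_eq_gauss:
  fixes \<xi> :: "'a::euclidean_space"
  assumes s: "s > 0"
  shows "exp (- s\<^sup>2 * (norm \<xi>)\<^sup>2 / 2) = (sqrt (2 * pi) / s) ^ DIM('a) * gauss (1 / s) \<xi>"
  using s by (simp add: gauss_def power_divide)

lemma integrable_exp_norm_square:
  assumes "s > 0"
  shows "integrable lborel (\<lambda>\<xi>::'a::euclidean_space. exp (- s\<^sup>2 * (norm \<xi>)\<^sup>2 / 2))"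
  unfolding exp_eq_gauss[OF assms] using assms by (intro integrable_mult_right fourier_gauss(1)) simp

lemma inverse_fourier_gauss:
  fixes y :: "'a::euclidean_space"
  assumes s: "s > 0"
  shows "(\<integral>\<xi>. iexp (- (y \<bullet> \<xi>)) * complex_of_real (exp (- s\<^sup>2 * (norm \<xi>)\<^sup>2 / 2)) \<partial>lborel)
           = complex_of_real ((2 * pi) ^ DIM('a) * gauss s y)"
proof -
  let ?c = "complex_of_real ((sqrt (2 * pi) / s) ^ DIM('a))"
  have "(\<integral>\<xi>. iexp (- (y \<bullet> \<xi>)) * complex_of_real (exp (- s\<^sup>2 * (norm \<xi>)\<^sup>2 / 2)) \<partial>lborel)
      = (\<integral>\<xi>. ?c * (iexp ((- y) \<bullet> \<xi>) * complex_of_real (gauss (1 / s) \<xi>)) \<partial>lborel)"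
    unfolding exp_eq_gauss[OF s] by (simp add: mult_ac)
  also have "\<dots> = ?c * complex_of_real (exp (- (1 / s)\<^sup>2 * (norm (- y))\<^sup>2 / 2))"
    by (subst integral_mult_right_zero, subst fourier_gauss(2)) (use s in auto)
  also have "\<dots> = complex_of_real ((2 * pi) ^ DIM('a) * gauss s y)"
  proof -
    have "sqrt (2 * pi) / s = (2 * pi) / (s * sqrt (2 * pi))"
      using s by (simp add: field_simps)
    then have "(sqrt (2 * pi) / s) ^ DIM('a) = (2 * pi) ^ DIM('a) / (s * sqrt (2 * pi)) ^ DIM('a)"
      by (simp only: power_divide)
    then show ?thesis by (simp add: gauss_def power_divide mult_ac)
  qed
  finally show ?thesis .
qed

section \<open>Finite measures and their Fourier transforms\<close>

text \<open>The characteristic function of a finite measure.\<close>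

definition fourier :: "'a::euclidean_space measure \<Rightarrow> 'a \<Rightarrow> complex" where
  "fourier N \<xi> = (\<integral>z. iexp (\<xi> \<bullet> z) \<partial>N)"

lemma measurable_fourier [measurable]:
  fixes N :: "'a::euclidean_space measure"
  assumes "finite_measure N" and [measurable_cong]: "sets N = sets borel"
  shows "fourier N \<in> borel_measurable borel"
proof -
  interpret finite_measure N by fact
  show ?thesis unfolding fourier_def by measurable
qed

lemma norm_fourier_le:
  assumes "finite_measure N"
  shows "norm (fourier N \<xi>) \<le> measure N (space N)"
proof -
  interpret finite_measure N by fact
  have "norm (fourier N \<xi>) \<le> (\<integral>z. norm (iexp (\<xi> \<bullet> z)) \<partial>N)"
    unfolding fourier_def by (rule integral_norm_bound)
  also have "\<dots> = measure N (space N)" by simp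
  finally show ?thesis .
qed

text \<open>
  Inverting the Fourier transform of \<open>N\<close> with a Gaussian convergence factor gives the
  density of the convolution of \<open>N\<close> with a narrow Gaussian. The factor makes Fubini
  applicable.
\<close>

lemma integral_fourier_gauss_eq:
  fixes N :: "'a::euclidean_space measure"
  assumes N: "finite_measure N" and [measurable_cong]: "sets N = sets borel" and s: "s > 0"
  shows "(\<integral>\<xi>. iexp (- (y \<bullet> \<xi>)) * fourier N \<xi> * complex_of_real (exp (- s\<^sup>2 * (norm \<xi>)\<^sup>2 / 2)) \<partial>lborel)
      = complex_of_real ((2 * pi) ^ DIM('a) * (\<integral>z. gauss s (y - z) \<partial>N))"
proof -
  interpret N: finite_measure N by fact
  interpret pair_sigma_finite N "lborel :: 'a measure" by standard
  let ?E = "\<lambda>\<xi>::'a. exp (- s\<^sup>2 * (norm \<xi>)\<^sup>2 / 2)"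
  let ?f = "\<lambda>z \<xi>. iexp ((z - y) \<bullet> \<xi>) * complex_of_real (?E \<xi>)"
  have "integrable (N \<Otimes>\<^sub>M lborel) (\<lambda>(z, \<xi>). ?f z \<xi>)"
  proof (rule Fubini_integrable)
    show "(\<lambda>(z, \<xi>). ?f z \<xi>) \<in> borel_measurable (N \<Otimes>\<^sub>M lborel)" by measurable
    show "integrable N (\<lambda>x. LBINT y. norm (case (x, y) of (z, \<xi>) \<Rightarrow> ?f z \<xi>))"
      by (simp add: norm_mult)
    show "AE x in N. integrable lborel (\<lambda>y. case (x, y) of (z, \<xi>) \<Rightarrow> ?f z \<xi>)"
      by (rule AE_I2, rule Bochner_Integration.integrable_bound[OF integrable_exp_norm_square[OF s]])
         (auto simp: norm_mult)
  qed
  then have "(\<integral>\<xi>. (\<integral>z. ?f z \<xi> \<partial>N) \<partial>lborel) = (\<integral>z. (\<integral>\<xi>. ?f z \<xi> \<partial>lborel) \<partial>N)"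
    by (rule Fubini_integral)
  moreover have "(\<integral>z. ?f z \<xi> \<partial>N) = iexp (- (y \<bullet> \<xi>)) * fourier N \<xi> * complex_of_real (?E \<xi>)" for \<xi>
  proof -
    have "?f z \<xi> = (iexp (- (y \<bullet> \<xi>)) * complex_of_real (?E \<xi>)) * iexp (\<xi> \<bullet> z)" for z
      by (simp add: inner_diff_left inner_commute[of z \<xi>] ring_distribs exp_diff exp_minus field_simps)
    then show ?thesis
      unfolding fourier_def by (simp add: mult_ac)
  qed
  moreover have "(\<integral>\<xi>. ?f z \<xi> \<partial>lborel) = complex_of_real ((2 * pi) ^ DIM('a) * gauss s (y - z))" for z
    using inverse_fourier_gauss[OF s, of "y - z"] by (simp add: inner_diff_left)
  ultimately show ?thesis
    by simp
qed

text \<open>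
  Boxes generate the Borel sets, and the indicator of a box is an increasing limit of
  continuous functions that vanish outside it.
\<close>

lemma finite_measure_eqI_continuous:
  fixes N N' :: "'a::euclidean_space measure"
  assumes N: "finite_measure N" "sets N = sets borel" "sets N' = sets borel"
    and eq: "\<And>h::'a \<Rightarrow> real. continuous_on UNIV h \<Longrightarrow> (\<And>x. 0 \<le> h x \<and> h x \<le> 1)
              \<Longrightarrow> bounded {x. h x \<noteq> 0} \<Longrightarrow> (\<integral>\<^sup>+x. ennreal (h x) \<partial>N) = (\<integral>\<^sup>+x. ennreal (h x) \<partial>N')"
  shows "N = N'"
proof (rule measure_eqI_generator_eq)
  let ?E = "range (\<lambda>(a, b). box a b::'a set)"
  show "Int_stable ?E"
    by (auto simp: Int_stable_def box_Int_box)
  show "?E \<subseteq> Pow UNIV" "sets N = sigma_sets UNIV ?E" "sets N' = sigma_sets UNIV ?E"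
    by (simp_all add: borel_eq_box N)
  let ?A = "\<lambda>n::nat. box (- (real n *\<^sub>R One)) (real n *\<^sub>R One) :: 'a set"
  show "range ?A \<subseteq> ?E" "(\<Union>i. ?A i) = UNIV"
    unfolding UN_box_eq_UNIV by auto
  show "emeasure N (?A i) \<noteq> \<infinity>" for i
    using finite_measure.emeasure_finite[OF N(1)] by auto
  show "emeasure N U = emeasure N' U" if "U \<in> ?E" for U
  proof -
    have U: "open U" "bounded U"
      using that bounded_box open_box by auto
    have ne: "- U \<noteq> {}"
      using U(2) not_bounded_UNIV by (metis Compl_UNIV_eq double_complement)
    \<comment> \<open>The indicator of \<open>U\<close> is the increasing limit of these functions.\<close>
    define h where "h n x = min 1 (real n * infdist x (- U))" for n :: nat and x
    have h_cont: "continuous_on UNIV (h n)" for n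
      unfolding h_def by (intro continuous_intros)
    have h_0: "h n x = 0" if "x \<notin> U" for n x
      using that by (simp add: h_def)
    have h_01: "0 \<le> h n x \<and> h n x \<le> 1" for n x
      by (simp add: h_def infdist_nonneg)
    have h_inc: "incseq (\<lambda>n x. ennreal (h n x))"
      unfolding h_def incseq_def le_fun_def by (auto intro!: ennreal_leI mult_right_mono min.mono infdist_nonneg)
    have h_sup: "(SUP n. ennreal (h n x)) = indicator U x" for x
    proof (cases "x \<in> U")
      case True
      have "infdist x (- U) > 0"
        using True U ne in_closed_iff_infdist_zero[of "- U" x] infdist_nonneg[of x "- U"]
        by (auto simp: less_le closed_Compl)
      then obtain n :: nat where "real n * infdist x (- U) \<ge> 1"
        by (metis ex_less_of_nat_mult less_imp_le)
      then have "h n x = 1" by (simp add: h_def)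
      then have "1 \<le> (SUP n. ennreal (h n x))"
        by (metis SUP_upper UNIV_I ennreal_1)
      moreover have "(SUP n. ennreal (h n x)) \<le> 1"
        by (rule SUP_least) (simp add: h_01)
      ultimately have "(SUP n. ennreal (h n x)) = 1"
        by (rule antisym[rotated])
      then show ?thesis using True by simp
    next
      case False
      then show ?thesis by (simp add: h_0)
    qed
    have sup: "emeasure L U = (SUP n. \<integral>\<^sup>+x. ennreal (h n x) \<partial>L)" if L: "sets L = sets borel" for L
    proof -
      note [measurable_cong] = L
      have [measurable]: "h n \<in> borel_measurable borel" for n
        using h_cont by (rule borel_measurable_continuous_onI)
      have "emeasure L U = (\<integral>\<^sup>+x. indicator U x \<partial>L)"
        using U L by simp
      also have "\<dots> = (\<integral>\<^sup>+x. (SUP n. ennreal (h n x)) \<partial>L)"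
        by (simp add: h_sup)
      also have "\<dots> = (SUP n. \<integral>\<^sup>+x. ennreal (h n x) \<partial>L)"
        by (rule nn_integral_monotone_convergence_SUP[OF h_inc]) measurable
      finally show ?thesis .
    qed
    have "bounded {x. h n x \<noteq> 0}" for n
      by (rule bounded_subset[OF U(2)]) (use h_0 in auto)
    then show ?thesis
      unfolding sup[OF N(2)] sup[OF N(3)] using eq[OF h_cont h_01] by simp
  qed
qed

lemma integral_gauss_translate:
  fixes h :: "'a::euclidean_space \<Rightarrow> real"
  assumes [measurable]: "h \<in> borel_measurable borel" and s: "s > 0"
  shows "(\<integral>y. h y * gauss s (y - z) \<partial>lborel) = (\<integral>w. h (z + s *\<^sub>R w) * gauss 1 w \<partial>lborel)"
proof -
  have g: "s ^ DIM('a) * gauss s (s *\<^sub>R w) = gauss 1 w" for w :: 'a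
    using s by (simp add: gauss_def power_mult_distrib)
  have "(\<integral>y. h y * gauss s (y - z) \<partial>lborel)
      = (\<integral>y. h y * gauss s (y - z) \<partial>density (distr lborel borel (\<lambda>x. z + s *\<^sub>R x)) (\<lambda>_. ennreal (s ^ DIM('a))))"
    using s by (subst lborel_affine[of s z]) auto
  also have "\<dots> = (\<integral>w. s ^ DIM('a) * (h (z + s *\<^sub>R w) * gauss s (s *\<^sub>R w)) \<partial>lborel)"
    using s by (subst integral_density) (simp_all add: integral_distr)
  also have "\<dots> = (\<integral>w. h (z + s *\<^sub>R w) * gauss 1 w \<partial>lborel)"
    by (intro Bochner_Integration.integral_cong refl) (simp flip: g)
  finally show ?thesis .
qed

lemma integrable_gauss_translate:
  assumes "s > 0"
  shows "integrable lborel (\<lambda>y. gauss s (y - z))"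
proof -
  have "(\<integral>y. gauss s (y - z) \<partial>lborel) = 1"
    using integral_gauss_translate[of "\<lambda>_. 1" s z] assms by (simp add: integral_gauss)
  then show ?thesis
    using not_integrable_integral_eq by fastforce
qed

lemma gauss_mollify_swap:
  fixes h :: "'a::euclidean_space \<Rightarrow> real"
  assumes N: "finite_measure N" and [measurable_cong]: "sets N = sets borel"
    and [measurable]: "h \<in> borel_measurable borel" and K: "\<And>x. \<bar>h x\<bar> \<le> K" and s: "s > 0"
  shows "(\<integral>y. h y * (\<integral>z. gauss s (y - z) \<partial>N) \<partial>lborel) = (\<integral>z. (\<integral>w. h (z + s *\<^sub>R w) * gauss 1 w \<partial>lborel) \<partial>N)"
proof -
  interpret N: finite_measure N by fact
  interpret pair_sigma_finite N "lborel :: 'a measure" by standard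
  let ?f = "\<lambda>z y. h y * gauss s (y - z)"
  have K0: "K \<ge> 0" using K[of 0] by linarith
  have b: "\<bar>?f z y\<bar> \<le> K * gauss s (y - z)" for z y
    using K[of y] s by (simp add: abs_mult mult_right_mono)
  have int: "integrable lborel (\<lambda>y. ?f z y)" for z
    by (rule Bochner_Integration.integrable_bound[where f="\<lambda>y. K * gauss s (y - z)"])
       (use b K0 s in \<open>auto intro!: integrable_gauss_translate\<close>)
  have intb: "norm (LBINT y. \<bar>?f z y\<bar>) \<le> K" for z
  proof -
    have "(LBINT y. \<bar>?f z y\<bar>) \<le> (LBINT y. K * gauss s (y - z))"
      by (intro integral_mono) (use int b s in \<open>auto intro!: integrable_gauss_translate integrable_abs\<close>)
    also have "\<dots> = K"
      using integral_gauss_translate[of "\<lambda>_. 1" s z] s by (simp add: integral_gauss)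
    finally show ?thesis by (simp add: integral_nonneg_AE)
  qed
  have "integrable (N \<Otimes>\<^sub>M lborel) (\<lambda>(z, y). ?f z y)"
  proof (rule Fubini_integrable)
    show "(\<lambda>(z, y). ?f z y) \<in> borel_measurable (N \<Otimes>\<^sub>M lborel)" by measurable
    show "integrable N (\<lambda>x. LBINT y. norm (case (x, y) of (z, y) \<Rightarrow> ?f z y))"
      by (rule N.integrable_const_bound[where B=K]) (use intb in auto)
    show "AE x in N. integrable lborel (\<lambda>y. case (x, y) of (z, y) \<Rightarrow> ?f z y)"
      using int by simp
  qed
  then have "(\<integral>y. (\<integral>z. ?f z y \<partial>N) \<partial>lborel) = (\<integral>z. (\<integral>y. ?f z y \<partial>lborel) \<partial>N)"
    by (rule Fubini_integral)
  then show ?thesis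
    using s by (simp add: integral_gauss_translate)
qed

text \<open>
  Mollification by Gaussians of standard deviation \<open>1 / Suc n\<close> does no harm in the limit:
  after moving it to the test function, dominated convergence applies twice.
\<close>

lemma tendsto_gauss_mollify:
  fixes h :: "'a::euclidean_space \<Rightarrow> real"
  assumes N: "finite_measure N" and [measurable_cong]: "sets N = sets borel"
    and h: "continuous_on UNIV h" and K: "\<And>x. \<bar>h x\<bar> \<le> K"
  shows "(\<lambda>n. \<integral>y. h y * (\<integral>z. gauss (1 / Suc n) (y - z) \<partial>N) \<partial>lborel) \<longlonglongrightarrow> (\<integral>z. h z \<partial>N)"
proof -
  interpret N: finite_measure N by fact
  have [measurable]: "h \<in> borel_measurable borel"
    using h by (rule borel_measurable_continuous_onI)
  let ?I = "\<lambda>n z. \<integral>w. h (z + (1 / Suc n) *\<^sub>R w) * gauss 1 w \<partial>lborel"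
  have K0: "K \<ge> 0" using K[of 0] by linarith
  have b: "\<bar>h x * gauss 1 w\<bar> \<le> K * gauss 1 w" for x and w :: 'a
    using K[of x] by (simp add: abs_mult mult_right_mono)
  have lim: "(\<lambda>n. ?I n z) \<longlonglongrightarrow> (\<integral>w. h z * gauss 1 (w::'a) \<partial>lborel)" for z
  proof (rule integral_dominated_convergence[where w="\<lambda>w::'a. K * gauss 1 w"])
    show "AE w in lborel. (\<lambda>n. h (z + (1 / Suc n) *\<^sub>R w) * gauss 1 w) \<longlonglongrightarrow> h z * gauss 1 w"
    proof (rule AE_I2)
      fix w :: 'a
      have "(\<lambda>n. 1 / real (Suc n)) \<longlonglongrightarrow> 0"
        using LIMSEQ_inverse_real_of_nat by (simp add: inverse_eq_divide)
      then have "(\<lambda>n. z + (1 / real (Suc n)) *\<^sub>R w) \<longlonglongrightarrow> z + 0 *\<^sub>R w"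
        by (intro tendsto_intros)
      then have "(\<lambda>n. h (z + (1 / real (Suc n)) *\<^sub>R w)) \<longlonglongrightarrow> h z"
        using continuous_on_tendsto_compose[OF h, of _ z] by simp
      then show "(\<lambda>n. h (z + (1 / Suc n) *\<^sub>R w) * gauss 1 w) \<longlonglongrightarrow> h z * gauss 1 w"
        by (intro tendsto_intros)
    qed
  qed (use b in \<open>auto intro!: fourier_gauss(1)\<close>)
  have bI: "\<bar>?I n z\<bar> \<le> K" for n z
  proof -
    have "\<bar>?I n z\<bar> \<le> (\<integral>w. \<bar>h (z + (1 / Suc n) *\<^sub>R w) * gauss 1 w\<bar> \<partial>lborel)"
      using integral_norm_bound[of lborel "\<lambda>w. h (z + (1 / Suc n) *\<^sub>R w) * gauss 1 w"] by simp
    also have "\<dots> \<le> (\<integral>w. K * gauss 1 (w::'a) \<partial>lborel)"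
      by (rule integral_mono')
         (use b K0 in \<open>auto intro!: integrable_mult_right fourier_gauss(1)\<close>)
    also have "\<dots> = K" by (simp add: integral_gauss)
    finally show ?thesis .
  qed
  have "(\<lambda>n. \<integral>z. ?I n z \<partial>N) \<longlonglongrightarrow> (\<integral>z. (\<integral>w. h z * gauss 1 (w::'a) \<partial>lborel) \<partial>N)"
    by (rule integral_dominated_convergence[where w="\<lambda>_. K"]) (use lim bI in auto)
  then show ?thesis
    by (simp add: gauss_mollify_swap[OF assms(1,2) _ K] integral_gauss)
qed

text \<open>
  The mollified measures are determined by the Fourier transform, and they converge to
  the measure.
\<close>

theorem fourier_inj:
  fixes N N' :: "'a::euclidean_space measure"
  assumes N: "finite_measure N" "sets N = sets borel" and N': "finite_measure N'" "sets N' = sets borel"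
    and eq: "\<And>\<xi>. fourier N \<xi> = fourier N' \<xi>"
  shows "N = N'"
proof (rule finite_measure_eqI_continuous[OF N N'(2)])
  fix h :: "'a \<Rightarrow> real"
  assume h: "continuous_on UNIV h" "\<And>x. 0 \<le> h x \<and> h x \<le> 1"
  have K: "\<bar>h x\<bar> \<le> 1" for x using h(2)[of x] by auto
  have "(\<integral>z. gauss (1 / Suc n) (y - z) \<partial>N) = (\<integral>z. gauss (1 / Suc n) (y - z) \<partial>N')" for n and y :: 'a
    using integral_fourier_gauss_eq[OF N, of "1 / Suc n" y] integral_fourier_gauss_eq[OF N', of "1 / Suc n" y]
    by (simp add: eq del: of_nat_Suc)
  then have "(\<integral>z. h z \<partial>N) = (\<integral>z. h z \<partial>N')"
    using tendsto_gauss_mollify[OF N h(1) K] tendsto_gauss_mollify[OF N' h(1) K] LIMSEQ_unique by auto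
  moreover have "(\<integral>\<^sup>+x. ennreal (h x) \<partial>L) = ennreal (\<integral>z. h z \<partial>L)"
    if "finite_measure L" and [measurable_cong]: "sets L = sets borel" for L
  proof (rule nn_integral_eq_integral)
    have [measurable]: "h \<in> borel_measurable borel"
      using h(1) by (rule borel_measurable_continuous_onI)
    show "integrable L h"
      using that(1) K by (intro finite_measure.integrable_const_bound[where B=1]) auto
  qed (use h(2) in auto)
  ultimately show "(\<integral>\<^sup>+x. ennreal (h x) \<partial>N) = (\<integral>\<^sup>+x. ennreal (h x) \<partial>N')"
    using N N' by simp
qed

text \<open>
  The mollified densities are bounded uniformly in \<open>n\<close>, since the Fourier transform is
  integrable, and converge pointwise to \<open>p\<close>, which is therefore nonnegative. Their limits
  as measures are \<open>N\<close>.
\<close>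

theorem fourier_inversion:
  fixes N :: "'a::euclidean_space measure"
  assumes N: "finite_measure N" "sets N = sets borel" and int: "integrable lborel (fourier N)"
  defines "p \<equiv> \<lambda>y. Re (\<integral>\<xi>. iexp (- (y \<bullet> \<xi>)) * fourier N \<xi> \<partial>lborel) / (2 * pi) ^ DIM('a)"
  shows "p y \<ge> 0" and "N = density lborel (\<lambda>y. ennreal (p y))"
proof -
  note [measurable_cong] = N(2)
  have fm[measurable]: "fourier N \<in> borel_measurable borel"
    by (rule measurable_fourier[OF N])
  have pm[measurable]: "p \<in> borel_measurable borel"
    unfolding p_def by measurable
  define G where "G n y = (\<integral>z. gauss (1 / Suc n) (y - z) \<partial>N)" for n :: nat and y :: 'a
  define C where "C = (\<integral>\<xi>. norm (fourier N \<xi>) \<partial>lborel) / (2 * pi) ^ DIM('a)"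
  let ?F = "\<lambda>n y \<xi>. iexp (- (y \<bullet> \<xi>)) * fourier N \<xi> * complex_of_real (exp (- (1 / Suc n)\<^sup>2 * (norm \<xi>)\<^sup>2 / 2))"
  have G: "G n y = Re (\<integral>\<xi>. ?F n y \<xi> \<partial>lborel) / (2 * pi) ^ DIM('a)" for n y
    unfolding G_def by (subst integral_fourier_gauss_eq[OF N]) auto
  have normF: "norm (?F n y \<xi>) \<le> norm (fourier N \<xi>)" for n y \<xi>
    by (simp add: norm_mult mult_left_le)
  have "(\<lambda>n. \<integral>\<xi>. ?F n y \<xi> \<partial>lborel) \<longlonglongrightarrow> (\<integral>\<xi>. iexp (- (y \<bullet> \<xi>)) * fourier N \<xi> \<partial>lborel)" for y
  proof (rule integral_dominated_convergence[where w="\<lambda>\<xi>. norm (fourier N \<xi>)"])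
    show "AE \<xi> in lborel. (\<lambda>n. ?F n y \<xi>) \<longlonglongrightarrow> iexp (- (y \<bullet> \<xi>)) * fourier N \<xi>"
    proof (rule AE_I2)
      fix \<xi> :: 'a
      have "(\<lambda>n. 1 / real (Suc n)) \<longlonglongrightarrow> 0"
        using LIMSEQ_inverse_real_of_nat by (simp add: inverse_eq_divide)
      then have "(\<lambda>n. ?F n y \<xi>) \<longlonglongrightarrow> iexp (- (y \<bullet> \<xi>)) * fourier N \<xi> * complex_of_real (exp (- 0\<^sup>2 * (norm \<xi>)\<^sup>2 / 2))"
        by (intro tendsto_intros) simp_all
      then show "(\<lambda>n. ?F n y \<xi>) \<longlonglongrightarrow> iexp (- (y \<bullet> \<xi>)) * fourier N \<xi>" by simp
    qed
  qed (use int normF in auto)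
  then have lim: "(\<lambda>n. G n y) \<longlonglongrightarrow> p y" for y
    unfolding G p_def by (intro tendsto_intros) auto
  have G0: "0 \<le> G n y" for n y
    unfolding G_def by (rule integral_nonneg_AE) simp
  show p0: "p y \<ge> 0" for y
    using lim by (rule LIMSEQ_le_const) (use G0 in auto)
  have GC: "G n y \<le> C" for n y
  proof -
    have "Re (\<integral>\<xi>. ?F n y \<xi> \<partial>lborel) \<le> norm (\<integral>\<xi>. ?F n y \<xi> \<partial>lborel)"
      by (rule complex_Re_le_cmod)
    also have "\<dots> \<le> (\<integral>\<xi>. norm (?F n y \<xi>) \<partial>lborel)"
      by (rule integral_norm_bound)
    also have "\<dots> \<le> (\<integral>\<xi>. norm (fourier N \<xi>) \<partial>lborel)"
      by (rule integral_mono') (use int normF in auto)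
    finally show ?thesis
      unfolding G C_def by (simp add: divide_right_mono)
  qed
  have C0: "C \<ge> 0"
    unfolding C_def by (auto intro!: divide_nonneg_nonneg integral_nonneg_AE)
  show "N = density lborel (\<lambda>y. ennreal (p y))"
  proof (rule finite_measure_eqI_continuous[OF N])
    show "sets (density lborel (\<lambda>y. ennreal (p y))) = sets borel" by simp
    fix h :: "'a \<Rightarrow> real"
    assume h: "continuous_on UNIV h" "\<And>x. 0 \<le> h x \<and> h x \<le> 1" and bdd: "bounded {x. h x \<noteq> 0}"
    have [measurable]: "h \<in> borel_measurable borel"
      using h(1) by (rule borel_measurable_continuous_onI)
    have K: "\<bar>h x\<bar> \<le> 1" for x using h(2)[of x] by auto
    obtain R where R: "\<And>x. h x \<noteq> 0 \<Longrightarrow> norm x \<le> R"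
      using bdd unfolding bounded_iff by auto
    let ?w = "\<lambda>y::'a. C * indicator (cball 0 R) y :: real"
    have Gm[measurable]: "G n \<in> borel_measurable borel" for n
      unfolding G by measurable
    have dom: "\<bar>h y * g\<bar> \<le> ?w y" if "0 \<le> g" "g \<le> C" for y g
    proof (cases "h y = 0")
      case False
      have "h y * g \<le> 1 * C"
        using h(2)[of y] that by (intro mult_mono) auto
      then show ?thesis using False R[of y] h(2)[of y] that by (simp add: abs_mult)
    qed (use C0 in auto)
    have w: "integrable lborel ?w"
      by (intro integrable_mult_right integrable_real_indicator emeasure_bounded_finite) auto
    have pC: "p y \<le> C" for y
      using lim by (rule LIMSEQ_le_const2) (use GC in auto)
    have "(\<lambda>n. \<integral>y. h y * G n y \<partial>lborel) \<longlonglongrightarrow> (\<integral>y. h y * p y \<partial>lborel)"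
    proof (rule integral_dominated_convergence[where w="?w"])
      show "AE y in lborel. (\<lambda>n. h y * G n y) \<longlonglongrightarrow> h y * p y"
        using lim by (auto intro!: tendsto_intros)
    qed (use w dom G0 GC in auto)
    then have "(\<integral>y. h y * p y \<partial>lborel) = (\<integral>z. h z \<partial>N)"
      using tendsto_gauss_mollify[OF N h(1) K] unfolding G_def by (rule LIMSEQ_unique)
    moreover have "(\<integral>\<^sup>+x. ennreal (h x) \<partial>N) = ennreal (\<integral>z. h z \<partial>N)"
    proof (rule nn_integral_eq_integral)
      show "integrable N h"
        using N(1) K by (intro finite_measure.integrable_const_bound[where B=1]) auto
    qed (use h(2) in auto)
    moreover have "(\<integral>\<^sup>+x. ennreal (h x) \<partial>density lborel (\<lambda>y. ennreal (p y))) = ennreal (\<integral>y. h y * p y \<partial>lborel)"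
    proof -
      have "(\<integral>\<^sup>+x. ennreal (h x) \<partial>density lborel (\<lambda>y. ennreal (p y))) = (\<integral>\<^sup>+y. ennreal (h y * p y) \<partial>lborel)"
        using h(2) p0 by (subst nn_integral_density) (auto simp: ennreal_mult' mult_ac intro!: nn_integral_cong)
      also have "\<dots> = ennreal (\<integral>y. h y * p y \<partial>lborel)"
      proof (rule nn_integral_eq_integral)
        show "integrable lborel (\<lambda>y. h y * p y)"
          by (rule Bochner_Integration.integrable_bound[OF w]) (use dom p0 pC in \<open>auto intro!: order_trans[OF _ abs_ge_self]\<close>)
      qed (use h(2) p0 in auto)
      finally show ?thesis .
    qed
    ultimately show "(\<integral>\<^sup>+x. ennreal (h x) \<partial>N) = (\<integral>\<^sup>+x. ennreal (h x) \<partial>density lborel (\<lambda>y. ennreal (p y)))"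
      by simp
  qed
qed

section \<open>Stable motions and the Markov property\<close>

lemma set_integral_sums_disjoint:
  fixes f :: "'w \<Rightarrow> complex"
  assumes "finite_measure M" and [measurable]: "\<And>i::nat. A i \<in> sets M" "f \<in> borel_measurable M"
    and disj: "disjoint_family A" and B: "\<And>x. norm (f x) \<le> B"
  shows "(\<lambda>i. LINT x:A i|M. f x) sums (LINT x:(\<Union>i. A i)|M. f x)"
proof -
  interpret finite_measure M by fact
  have ind: "(\<lambda>i. indicat_real (A i) x) sums indicat_real (\<Union>i. A i) x" for x
    using disj by (intro indicator_sums) (auto simp: disjoint_family_on_def)
  have le1: "\<bar>\<Sum>i<n. indicat_real (A i) x\<bar> \<le> 1" for n x
  proof -
    have "(\<Sum>i<n. indicat_real (A i) x) \<le> (\<Sum>i. indicat_real (A i) x)"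
      using ind[of x] by (intro sum_le_suminf) (auto simp: sums_iff)
    also have "\<dots> \<le> 1"
      using ind[of x] by (simp add: sums_iff indicator_le_1)
    finally show ?thesis by (simp add: sum_nonneg)
  qed
  have intf: "integrable M f"
    by (rule integrable_const_bound[where B=B]) (use B in auto)
  have int: "integrable M (\<lambda>x. indicat_real (A i) x *\<^sub>R f x)" for i
    using intf by (intro integrable_mult_indicator) auto
  have B0: "B \<ge> 0" using B[of undefined] norm_ge_zero order_trans by blast
  have "(\<lambda>n. \<integral>x. (\<Sum>i<n. indicat_real (A i) x) *\<^sub>R f x \<partial>M) \<longlonglongrightarrow> (\<integral>x. indicat_real (\<Union>i. A i) x *\<^sub>R f x \<partial>M)"
  proof (rule integral_dominated_convergence[where w="\<lambda>_. B"])
    show "AE x in M. (\<lambda>n. (\<Sum>i<n. indicat_real (A i) x) *\<^sub>R f x) \<longlonglongrightarrow> indicat_real (\<Union>i. A i) x *\<^sub>R f x"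
      using ind by (auto simp: sums_def intro!: tendsto_intros)
    show "AE x in M. norm ((\<Sum>i<n. indicat_real (A i) x) *\<^sub>R f x) \<le> B" for n
    proof (rule AE_I2)
      fix x
      have "norm ((\<Sum>i<n. indicat_real (A i) x) *\<^sub>R f x) \<le> 1 * B"
        unfolding norm_scaleR using le1 B B0 by (intro mult_mono) auto
      then show "norm ((\<Sum>i<n. indicat_real (A i) x) *\<^sub>R f x) \<le> B" by simp
    qed
  qed auto
  moreover have "(\<integral>x. (\<Sum>i<n. indicat_real (A i) x) *\<^sub>R f x \<partial>M) = (\<Sum>i<n. \<integral>x. indicat_real (A i) x *\<^sub>R f x \<partial>M)" for n
    unfolding scaleR_sum_left by (rule Bochner_Integration.integral_sum) (rule int)
  ultimately show ?thesis
    unfolding sums_def set_lebesgue_integral_def by simp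
qed

text \<open>
  The properties of an isotropic stable process that are used, normalised to start at \<open>0\<close>
  on all of the probability space. Replacing \<open>X t\<close> by \<open>X t - X 0\<close> achieves this and
  changes a Levy process only on a null set.
\<close>

locale stable_motion = prob_space M for M :: "'w measure" +
  fixes \<alpha> :: real and Y :: "real \<Rightarrow> 'w \<Rightarrow> 'a::euclidean_space"
  assumes alpha: "0 < \<alpha>" "\<alpha> < 2"
    and Y_measurable [measurable]: "\<And>t. 0 \<le> t \<Longrightarrow> Y t \<in> borel_measurable M"
    and Y_zero: "\<And>\<omega>. \<omega> \<in> space M \<Longrightarrow> Y 0 \<omega> = 0"
    and Y_cadlag: "\<And>\<omega>. \<omega> \<in> space M \<Longrightarrow> cadlag (\<lambda>t. Y t \<omega>)"
    and Y_indep: "\<And>(s::nat \<Rightarrow> real) n. 0 \<le> s 0 \<Longrightarrow> (\<And>i. i < n \<Longrightarrow> s i < s (Suc i)) \<Longrightarrow>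
          indep_vars (\<lambda>_. borel) (\<lambda>i \<omega>. Y (s (Suc i)) \<omega> - Y (s i) \<omega>) {..<n}"
    and Y_char: "\<And>s t \<xi>. 0 \<le> s \<Longrightarrow> s \<le> t \<Longrightarrow>
          (\<integral>\<omega>. iexp (\<xi> \<bullet> (Y t \<omega> - Y s \<omega>)) \<partial>M) = complex_of_real (exp (- (t - s) * norm \<xi> powr \<alpha>))"
begin

text \<open>The natural filtration.\<close>

definition hist :: "real \<Rightarrow> 'w set set" where
  "hist u = sigma_sets (space M) {Y s -` B \<inter> space M | s B. 0 \<le> s \<and> s \<le> u \<and> B \<in> sets borel}"

lemma sigma_algebra_hist: "sigma_algebra (space M) (hist u)"
  unfolding hist_def by (rule sigma_algebra_sigma_sets) auto

lemma hist_mono: "u \<le> v \<Longrightarrow> hist u \<subseteq> hist v"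
  unfolding hist_def by (rule sigma_sets_mono') force

lemma hist_events: "hist u \<subseteq> events"
  unfolding hist_def
proof (rule sets.sigma_sets_subset, safe)
  fix s :: real and B :: "'a set" assume "0 \<le> s" "B \<in> sets borel"
  then show "Y s -` B \<inter> space M \<in> events" using Y_measurable by (auto intro: measurable_sets)
qed

lemma hist_sets[measurable_dest]: "A \<in> hist u \<Longrightarrow> A \<in> events"
  using hist_events by blast

lemma hist_vimage: "0 \<le> s \<Longrightarrow> s \<le> u \<Longrightarrow> B \<in> sets borel \<Longrightarrow> Y s -` B \<inter> space M \<in> hist u"
  unfolding hist_def by (rule sigma_sets.Basic) auto

text \<open>An intersection-stable generator of the natural filtration.\<close>

definition cylinders :: "real \<Rightarrow> 'w set set" where
  "cylinders u = {{\<omega>\<in>space M. \<forall>s\<in>J. Y s \<omega> \<in> B s} | J B. finite J \<and> J \<subseteq> {0..u} \<and> range B \<subseteq> sets borel}"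

lemma cylinders_Int_stable: "Int_stable (cylinders u)"
proof (rule Int_stableI)
  fix A A' assume "A \<in> cylinders u" "A' \<in> cylinders u"
  then obtain J B J' B' where A: "A = {\<omega>\<in>space M. \<forall>s\<in>J. Y s \<omega> \<in> B s}" "finite J" "J \<subseteq> {0..u}" "range B \<subseteq> sets borel"
    and A': "A' = {\<omega>\<in>space M. \<forall>s\<in>J'. Y s \<omega> \<in> B' s}" "finite J'" "J' \<subseteq> {0..u}" "range B' \<subseteq> sets borel"
    unfolding cylinders_def by auto
  let ?C = "\<lambda>s. (if s \<in> J then B s else UNIV) \<inter> (if s \<in> J' then B' s else UNIV)"
  have "A \<inter> A' = {\<omega>\<in>space M. \<forall>s\<in>J \<union> J'. Y s \<omega> \<in> ?C s}"
    unfolding A A' by auto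
  moreover have "range ?C \<subseteq> sets borel"
    using A(4) A'(4) by auto
  ultimately show "A \<inter> A' \<in> cylinders u"
    unfolding cylinders_def using A(2,3) A'(2,3)
    by (intro CollectI exI[of _ "J \<union> J'"] exI[of _ ?C]) auto
qed

lemma cylinders_space: "cylinders u \<subseteq> Pow (space M)"
  unfolding cylinders_def by auto

lemma hist_eq_cylinders: "hist u = sigma_sets (space M) (cylinders u)"
proof
  show "hist u \<subseteq> sigma_sets (space M) (cylinders u)"
    unfolding hist_def
  proof (rule sigma_sets_mono')
    show "{Y s -` B \<inter> space M |s B. 0 \<le> s \<and> s \<le> u \<and> B \<in> sets borel} \<subseteq> cylinders u"
    proof safe
      fix s B assume "0 \<le> s" "s \<le> u" "B \<in> sets (borel :: 'a measure)"
      then show "Y s -` B \<inter> space M \<in> cylinders u"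
        unfolding cylinders_def by (intro CollectI exI[of _ "{s}"] exI[of _ "\<lambda>_. B"]) auto
    qed
  qed
  interpret H: sigma_algebra "space M" "hist u" by (rule sigma_algebra_hist)
  have "cylinders u \<subseteq> hist u"
  proof
    fix A assume "A \<in> cylinders u"
    then obtain J B where A: "A = {\<omega>\<in>space M. \<forall>s\<in>J. Y s \<omega> \<in> B s}" "finite J" "J \<subseteq> {0..u}" "range B \<subseteq> sets borel"
      unfolding cylinders_def by auto
    have "{\<omega> \<in> space M. Y s \<omega> \<in> B s} \<in> hist u" if "s \<in> J" for s
      using hist_vimage[of s u "B s"] A that by (auto simp: vimage_def Int_def conj_commute)
    then show "A \<in> hist u"
      unfolding A(1) using A(2) by (intro H.sets_Collect_finite_All) auto
  qed
  then show "sigma_sets (space M) (cylinders u) \<subseteq> hist u"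
    by (rule H.sigma_sets_subset)
qed

text \<open>
  The times of a cylinder, together with \<open>0\<close> and \<open>u\<close>, split \<open>[0, u]\<close> into consecutive
  intervals. The values of the path at these times are partial sums of the increments over
  the intervals, so the event and \<open>Y u\<close> are functions of increments that are independent
  of the one from \<open>u\<close> to \<open>v\<close>.
\<close>

lemma markov_cylinder:
  assumes A: "A \<in> cylinders u" and u: "0 \<le> u" "u < v"
  shows "(LINT \<omega>:A|M. iexp (\<eta> \<bullet> Y u \<omega>) * iexp (\<xi> \<bullet> (Y v \<omega> - Y u \<omega>)))
     = (LINT \<omega>:A|M. iexp (\<eta> \<bullet> Y u \<omega>)) * complex_of_real (exp (- (v - u) * norm \<xi> powr \<alpha>))"
proof -
  obtain J B where A: "A = {\<omega>\<in>space M. \<forall>s\<in>J. Y s \<omega> \<in> B s}" "finite J" "J \<subseteq> {0..u}" "range B \<subseteq> sets borel"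
    using A unfolding cylinders_def by auto
  define L where "L = sorted_list_of_set (insert 0 (insert u J))"
  have setL: "set L = insert 0 (insert u J)" and sL: "sorted_wrt (<) L"
    unfolding L_def using A(2) strict_sorted_list_of_set[of "insert 0 (insert u J)"]
    by (auto simp only: finite_insert set_sorted_list_of_set)
  define n where "n = length L - 1"
  have len: "length L = Suc n"
    unfolding n_def using setL by (cases L) auto
  have mono: "L ! i < L ! j" if "i < j" "j \<le> n" for i j
    using sL that len by (simp add: sorted_wrt_iff_nth_less)
  have mono': "L ! i \<le> L ! j" if "i \<le> j" "j \<le> n" for i j
    using mono[of i j] that by (cases "i = j") auto
  have ex: "\<exists>k\<le>n. L ! k = r" if "r \<in> set L" for r
    using that len by (metis in_set_conv_nth less_Suc_eq_le)
  have mem: "L ! i \<in> {0..u}" if "i \<le> n" for i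
  proof -
    have "L ! i \<in> set L" using that len by simp
    then show ?thesis using A(3) u by (auto simp: setL)
  qed
  have L0: "L ! 0 = 0"
  proof -
    obtain k where "k \<le> n" "L ! k = 0" using ex[of 0] setL by auto
    then show ?thesis using mono'[of 0 k] mem[of 0] by auto
  qed
  have Ln: "L ! n = u"
  proof -
    obtain k where "k \<le> n" "L ! k = u" using ex[of u] setL by auto
    then show ?thesis using mono'[of k n] mem[of n] by auto
  qed
  define s where "s i = (if i \<le> n then L ! i else v)" for i
  have s_mono: "s i < s (Suc i)" if "i < Suc n" for i
    unfolding s_def using mono[of i "Suc i"] that Ln u by (auto simp: less_Suc_eq)
  have sn: "s n = u" "s (Suc n) = v" "s 0 = 0"
    by (simp_all add: s_def Ln L0)
  define D where "D i \<omega> = Y (s (Suc i)) \<omega> - Y (s i) \<omega>" for i \<omega>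
  have ind: "indep_vars (\<lambda>_. borel) D {..<Suc n}"
    unfolding D_def by (rule Y_indep) (use s_mono sn in auto)
  have Dsum: "(\<Sum>i<k. D i \<omega>) = Y (s k) \<omega>" if "\<omega> \<in> space M" for k \<omega>
    using sum_lessThan_telescope[of "\<lambda>i. Y (s i) \<omega>" k] Y_zero[OF that] unfolding D_def sn by simp
  \<comment> \<open>The position of a time of the cylinder in the list.\<close>
  define idx where "idx r = (SOME k. k \<le> n \<and> L ! k = r)" for r
  have idx: "idx r \<le> n" "s (idx r) = r" if "r \<in> J" for r
  proof -
    have "\<exists>k. k \<le> n \<and> L ! k = r" using ex[of r] that setL by auto
    then have "idx r \<le> n \<and> L ! idx r = r" unfolding idx_def by (rule someI_ex)
    then show "idx r \<le> n" "s (idx r) = r" by (auto simp: s_def)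
  qed
  let ?P = "PiM {..<n} (\<lambda>_. borel :: 'a measure)"
  let ?Q = "PiM {n} (\<lambda>_. borel :: 'a measure)"
  let ?F = "\<lambda>f::nat \<Rightarrow> 'a. indicat_real {f. \<forall>r\<in>J. (\<Sum>i<idx r. f i) \<in> B r} f *\<^sub>R iexp (\<eta> \<bullet> (\<Sum>i<n. f i))"
  let ?G = "\<lambda>f::nat \<Rightarrow> 'a. iexp (\<xi> \<bullet> f n)"
  have iv: "indep_var ?P (\<lambda>\<omega>. restrict (\<lambda>i. D i \<omega>) {..<n}) ?Q (\<lambda>\<omega>. restrict (\<lambda>i. D i \<omega>) {n})"
    by (rule indep_var_restrict[OF ind]) auto
  have [measurable]: "B r \<in> sets borel" for r using A(4) by auto
  have Fm: "?F \<in> borel_measurable ?P"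
  proof -
    have m1: "(\<lambda>f. \<Sum>i<k. f i) \<in> borel_measurable ?P" if "k \<le> n" for k
      using that by (intro borel_measurable_sum measurable_component_singleton) auto
    have "{f \<in> space ?P. \<forall>r\<in>J. (\<Sum>i<idx r. f i) \<in> B r} \<in> sets ?P"
    proof (rule sets.sets_Collect_finite_All[OF _ A(2)])
      fix r assume "r \<in> J"
      from m1[OF idx(1)[OF this]] have [measurable]: "(\<lambda>f. \<Sum>i<idx r. f i) \<in> borel_measurable ?P" .
      show "{f \<in> space ?P. (\<Sum>i<idx r. f i) \<in> B r} \<in> sets ?P" by measurable
    qed
    moreover have [measurable]: "(\<lambda>f. \<Sum>i<n. f i) \<in> borel_measurable ?P"
      by (rule m1) simp
    ultimately have "(\<lambda>f. indicat_real {f \<in> space ?P. \<forall>r\<in>J. (\<Sum>i<idx r. f i) \<in> B r} f *\<^sub>R iexp (\<eta> \<bullet> (\<Sum>i<n. f i))) \<in> borel_measurable ?P"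
      by measurable
    then show ?thesis
      by (subst measurable_cong[where g="\<lambda>f. indicat_real {f \<in> space ?P. \<forall>r\<in>J. (\<Sum>i<idx r. f i) \<in> B r} f *\<^sub>R iexp (\<eta> \<bullet> (\<Sum>i<n. f i))"])
         (auto simp: indicator_def)
  qed
  have Gm: "?G \<in> borel_measurable ?Q" by measurable
  let ?X1 = "?F \<circ> (\<lambda>\<omega>. restrict (\<lambda>i. D i \<omega>) {..<n})"
  let ?X2 = "?G \<circ> (\<lambda>\<omega>. restrict (\<lambda>i. D i \<omega>) {n})"
  have iv2: "indep_var borel ?X1 borel ?X2"
    using indep_var_compose[OF iv Fm Gm] .
  have X1: "?X1 \<omega> = indicat_real A \<omega> *\<^sub>R iexp (\<eta> \<bullet> Y u \<omega>)" if "\<omega> \<in> space M" for \<omega>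
  proof -
    have restr: "(\<Sum>i<k. restrict (\<lambda>i. D i \<omega>) {..<n} i) = Y (s k) \<omega>" if "k \<le> n" for k
    proof -
      have "(\<Sum>i<k. restrict (\<lambda>i. D i \<omega>) {..<n} i) = (\<Sum>i<k. D i \<omega>)"
        using that by (intro sum.cong) auto
      then show ?thesis using Dsum[OF \<open>\<omega> \<in> space M\<close>] by simp
    qed
    have "(\<forall>r\<in>J. (\<Sum>i<idx r. restrict (\<lambda>i. D i \<omega>) {..<n} i) \<in> B r) \<longleftrightarrow> \<omega> \<in> A"
      unfolding A(1) using that by (auto simp only: mem_Collect_eq restr idx)
    then show ?thesis
      using restr[of n] sn by (simp add: indicator_def)
  qed
  have X2: "?X2 \<omega> = iexp (\<xi> \<bullet> (Y v \<omega> - Y u \<omega>))" for \<omega>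
    by (simp add: D_def sn)
  have m: "random_variable borel ?X1" "random_variable borel ?X2"
    using iv2 by (auto simp: indep_var_eq)
  have int1: "integrable M ?X1"
    using m(1) by (rule integrable_const_bound[where B=1, rotated]) (auto simp: indicator_def)
  have int2: "integrable M ?X2"
    using m(2) by (rule integrable_const_bound[where B=1, rotated]) auto
  have "(\<integral>\<omega>. ?X1 \<omega> * ?X2 \<omega> \<partial>M) = (\<integral>\<omega>. ?X1 \<omega> \<partial>M) * (\<integral>\<omega>. ?X2 \<omega> \<partial>M)"
    by (rule indep_var_lebesgue_integral[OF iv2 int1 int2])
  moreover have "(\<integral>\<omega>. ?X1 \<omega> * ?X2 \<omega> \<partial>M) = (LINT \<omega>:A|M. iexp (\<eta> \<bullet> Y u \<omega>) * iexp (\<xi> \<bullet> (Y v \<omega> - Y u \<omega>)))"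
    unfolding set_lebesgue_integral_def X2
    by (intro Bochner_Integration.integral_cong refl) (simp only: X1 mult_scaleR_left)
  moreover have "(\<integral>\<omega>. ?X1 \<omega> \<partial>M) = (LINT \<omega>:A|M. iexp (\<eta> \<bullet> Y u \<omega>))"
    unfolding set_lebesgue_integral_def
    by (intro Bochner_Integration.integral_cong refl) (simp only: X1)
  moreover have "(\<integral>\<omega>. ?X2 \<omega> \<partial>M) = complex_of_real (exp (- (v - u) * norm \<xi> powr \<alpha>))"
    unfolding X2 using u by (intro Y_char) auto
  ultimately show ?thesis by simp
qed

text \<open>The events for which the identity holds form a Dynkin system.\<close>

lemma markov_hist:
  assumes A: "A \<in> hist u" and u: "0 \<le> u" "u \<le> v"
  shows "(LINT \<omega>:A|M. iexp (\<eta> \<bullet> Y u \<omega>) * iexp (\<xi> \<bullet> (Y v \<omega> - Y u \<omega>)))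
     = (LINT \<omega>:A|M. iexp (\<eta> \<bullet> Y u \<omega>)) * complex_of_real (exp (- (v - u) * norm \<xi> powr \<alpha>))"
proof (cases "u = v")
  case False
  then have uv: "u < v" using u by simp
  let ?W = "\<lambda>\<omega>. iexp (\<eta> \<bullet> Y u \<omega>)"
  let ?V = "\<lambda>\<omega>. iexp (\<eta> \<bullet> Y u \<omega>) * iexp (\<xi> \<bullet> (Y v \<omega> - Y u \<omega>))"
  let ?c = "complex_of_real (exp (- (v - u) * norm \<xi> powr \<alpha>))"
  have [measurable]: "Y u \<in> borel_measurable M" "Y v \<in> borel_measurable M"
    using u by auto
  have int: "integrable M ?W" "integrable M ?V"
    by (rule integrable_const_bound[where B=1]; simp add: norm_mult)+
  have H: "sigma_sets (space M) (cylinders u) \<subseteq> events"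
    using hist_events by (simp add: hist_eq_cylinders)
  have space: "space M \<in> cylinders u"
    unfolding cylinders_def by (intro CollectI exI[of _ "{}"] exI[of _ "\<lambda>_. {}"]) auto
  from A show ?thesis
    unfolding hist_eq_cylinders
  proof (induction rule: sigma_sets_induct_disjoint[OF cylinders_Int_stable cylinders_space, consumes 1])
    case (1 A) then show ?case using markov_cylinder u uv by blast
  next
    case 2 then show ?case by (simp add: set_lebesgue_integral_def)
  next
    case (3 A)
    have Am[measurable]: "A \<in> events" using 3 H by blast
    have diff: "(LINT \<omega>:space M - A|M. f \<omega>) = (LINT \<omega>:space M|M. f \<omega>) - (LINT \<omega>:A|M. f \<omega>)"
      if "integrable M f" for f :: "'w \<Rightarrow> complex"
      unfolding set_lebesgue_integral_def
      by (subst Bochner_Integration.integral_diff[OF integrable_mult_indicator[OF sets.top that]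
            integrable_mult_indicator[OF Am that], symmetric])
         (auto intro!: Bochner_Integration.integral_cong simp: indicator_def)
    show ?case
      using 3(2) markov_cylinder[OF space u(1) uv, of \<eta> \<xi>] by (simp add: diff int left_diff_distrib)
  next
    case (4 A)
    then have [measurable]: "A i \<in> events" for i using H by blast
    have fm: "finite_measure M" by (rule finite_measure_axioms)
    have "(\<lambda>i. LINT \<omega>:A i|M. ?V \<omega>) sums (LINT \<omega>:(\<Union>i. A i)|M. ?V \<omega>)"
      by (rule set_integral_sums_disjoint[where B=1, OF fm]) (use 4(1) in \<open>auto simp: norm_mult\<close>)
    moreover have "(\<lambda>i. LINT \<omega>:A i|M. ?W \<omega>) sums (LINT \<omega>:(\<Union>i. A i)|M. ?W \<omega>)"
      by (rule set_integral_sums_disjoint[where B=1, OF fm]) (use 4(1) in auto)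
    then have "(\<lambda>i. (LINT \<omega>:A i|M. ?W \<omega>) * ?c) sums ((LINT \<omega>:(\<Union>i. A i)|M. ?W \<omega>) * ?c)"
      by (rule sums_mult2)
    then have "(\<lambda>i. LINT \<omega>:A i|M. ?V \<omega>) sums ((LINT \<omega>:(\<Union>i. A i)|M. ?W \<omega>) * ?c)"
      using 4(3) by simp
    ultimately show ?case by (rule sums_unique2)
  qed
qed simp


end

section \<open>Optional times and the strong Markov property\<close>

lemma cadlag_tendsto_right:
  assumes "cadlag w" "0 \<le> t" and u: "u \<longlonglongrightarrow> t" "\<And>n. t \<le> u n"
  shows "(\<lambda>n. w (u n)) \<longlonglongrightarrow> w t"
proof -
  have "(w \<longlongrightarrow> w t) (at t within {t..})"
    using assms(1,2) by (simp add: cadlag_def at_within_Ici_at_right)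
  then have "continuous (at t within {t..}) w"
    by (simp add: continuous_within)
  then show ?thesis
    using u by (intro continuous_within_tendsto_compose[of t "{t..}" w]) auto
qed

lemma cadlag_at_left:
  fixes w :: "real \<Rightarrow> 'a::t2_space"
  assumes "cadlag w" "0 < t"
  shows "(w \<longlongrightarrow> left_lim w t) (at_left t)"
proof -
  obtain l where l: "(w \<longlongrightarrow> l) (at_left t)"
    using assms by (auto simp: cadlag_def)
  then have "Lim (at_left t) w = l"
    by (intro tendsto_Lim) simp_all
  then show ?thesis using l assms(2) by (simp add: left_lim_def)
qed

lemma cadlag_tendsto_left:
  fixes w :: "real \<Rightarrow> 'a::t2_space"
  assumes "cadlag w" "0 < t" and u: "u \<longlonglongrightarrow> t" "\<And>n. u n < t"
  shows "(\<lambda>n. w (u n)) \<longlonglongrightarrow> left_lim w t"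
proof -
  have "filterlim u (at_left t) sequentially"
    using u by (auto simp: filterlim_at less_imp_neq)
  then show ?thesis
    using cadlag_at_left[OF assms(1,2)] by (rule filterlim_compose[rotated])
qed

text \<open>
  The first point strictly after \<open>s\<close> of the grid with mesh \<open>1 / Suc n\<close>. Approximating a
  random time strictly from above makes the event that the approximation equals a given
  grid point known at that point.
\<close>

definition grid_after :: "nat \<Rightarrow> real \<Rightarrow> real" where
  "grid_after n s = (real_of_int \<lfloor>real (Suc n) * s\<rfloor> + 1) / Suc n"

lemma grid_after_gt: "s < grid_after n s"
  unfolding grid_after_def by (simp add: field_simps) linarith

lemma grid_after_le: "grid_after n s \<le> s + 1 / Suc n"
proof -
  have "grid_after n s \<le> (real (Suc n) * s + 1) / real (Suc n)"
    unfolding grid_after_def by (intro divide_right_mono add_right_mono of_int_floor_le) simp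
  also have "\<dots> = s + 1 / Suc n"
    by (simp add: add_divide_distrib)
  finally show ?thesis .
qed

lemma grid_after_tendsto: "(\<lambda>n. grid_after n s) \<longlonglongrightarrow> s"
proof (rule tendsto_sandwich[of "\<lambda>_. s" _ _ "\<lambda>n. s + 1 / Suc n"])
  show "(\<lambda>n. s + 1 / real (Suc n)) \<longlonglongrightarrow> s"
    using tendsto_add[OF tendsto_const LIMSEQ_inverse_real_of_nat, of s] by (simp add: inverse_eq_divide)
  show "\<forall>\<^sub>F n in sequentially. s \<le> grid_after n s"
    by (intro always_eventually allI less_imp_le grid_after_gt)
  show "\<forall>\<^sub>F n in sequentially. grid_after n s \<le> s + 1 / real (Suc n)"
    by (intro always_eventually allI grid_after_le)
qed simp

lemma grid_after_eq_iff:
  assumes "0 \<le> s"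
  shows "grid_after n s = real (Suc k) / Suc n \<longleftrightarrow> real k / Suc n \<le> s \<and> s < real (Suc k) / Suc n"
proof -
  have "grid_after n s = real (Suc k) / Suc n \<longleftrightarrow> \<lfloor>real (Suc n) * s\<rfloor> = int k"
    unfolding grid_after_def by (simp add: divide_simps del: of_nat_Suc) (simp add: of_nat_Suc, linarith)
  also have "\<dots> \<longleftrightarrow> real k \<le> real (Suc n) * s \<and> real (Suc n) * s < real k + 1"
    by (simp add: floor_eq_iff)
  also have "\<dots> \<longleftrightarrow> real k / Suc n \<le> s \<and> s < real (Suc k) / Suc n"
    by (simp add: field_simps)
  finally show ?thesis .
qed

lemma grid_after_ex:
  assumes "0 \<le> s"
  obtains k where "grid_after n s = real (Suc k) / Suc n"
proof
  show "grid_after n s = real (Suc (nat \<lfloor>real (Suc n) * s\<rfloor>)) / Suc n"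
    using assms unfolding grid_after_def by (simp add: of_nat_nat)
qed

context stable_motion
begin

text \<open>
  To know at time \<open>u\<close> whether \<open>T < u\<close> is what the approximation of \<open>T\<close> strictly from
  above uses. The value \<open>\<infinity>\<close> is allowed.
\<close>

definition optional :: "('w \<Rightarrow> ereal) \<Rightarrow> bool" where
  "optional T \<longleftrightarrow> (\<forall>\<omega>\<in>space M. 0 \<le> T \<omega>) \<and> (\<forall>u. {\<omega>\<in>space M. T \<omega> < ereal u} \<in> hist u)"

lemma optional_nonneg: "optional T \<Longrightarrow> \<omega> \<in> space M \<Longrightarrow> 0 \<le> T \<omega>"
  and optional_less: "optional T \<Longrightarrow> {\<omega>\<in>space M. T \<omega> < ereal u} \<in> hist u"
  by (auto simp: optional_def)

lemma optional_measurable: "optional T \<Longrightarrow> T \<in> borel_measurable M"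
proof (rule borel_measurableI_less)
  fix a :: ereal assume T: "optional T"
  show "{\<omega>\<in>space M. T \<omega> < a} \<in> events"
  proof (cases a)
    case (real u) then show ?thesis using hist_events optional_less[OF T] by auto
  next
    case PInf
    have "{\<omega>\<in>space M. T \<omega> < \<infinity>} = (\<Union>n::nat. {\<omega>\<in>space M. T \<omega> < ereal n})"
      by (auto simp: less_PInf_Ex_of_nat)
    then show ?thesis using PInf hist_events optional_less[OF T] by auto
  qed simp
qed

lemma optional_const: "0 \<le> t \<Longrightarrow> optional (\<lambda>_. ereal t)"
proof -
  assume "0 \<le> t"
  interpret H: sigma_algebra "space M" "hist u" for u by (rule sigma_algebra_hist)
  have "{\<omega>\<in>space M. t < u} = (if t < u then space M else {})" for u by auto
  then show ?thesis using \<open>0 \<le> t\<close> by (simp add: optional_def)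
qed

text \<open>
  On the event that \<open>T\<close> is infinite this is the value at time \<open>0\<close>, as \<open>real_of_ereal\<close>
  sends \<open>\<infinity>\<close> to \<open>0\<close>; it is always used on an event on which \<open>T\<close> is finite.
\<close>

definition at_time :: "('w \<Rightarrow> ereal) \<Rightarrow> 'w \<Rightarrow> 'a" where
  "at_time T \<omega> = Y (real_of_ereal (T \<omega>)) \<omega>"

text \<open>
  By right-continuity the random time may be approximated by times with countably many
  values.
\<close>

lemma Y_random_time_measurable:
  assumes [measurable]: "r \<in> borel_measurable M" and r: "\<And>\<omega>. \<omega> \<in> space M \<Longrightarrow> 0 \<le> r \<omega>"
  shows "(\<lambda>\<omega>. Y (r \<omega>) \<omega>) \<in> borel_measurable M"
proof (rule borel_measurable_LIMSEQ_metric)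
  show "(\<lambda>n. Y (grid_after n (r \<omega>)) \<omega>) \<longlonglongrightarrow> Y (r \<omega>) \<omega>" if "\<omega> \<in> space M" for \<omega>
    by (rule cadlag_tendsto_right[OF Y_cadlag[OF that] r[OF that] grid_after_tendsto])
       (simp add: grid_after_gt less_imp_le)
  fix n
  have "(\<lambda>\<omega>. Y (real (Suc (nat \<lfloor>real (Suc n) * r \<omega>\<rfloor>)) / Suc n) \<omega>) \<in> borel_measurable M"
    by (rule measurable_compose_countable[where f="\<lambda>k. Y (real (Suc k) / Suc n)"]) (auto intro!: Y_measurable)
  then show "(\<lambda>\<omega>. Y (grid_after n (r \<omega>)) \<omega>) \<in> borel_measurable M"
    by (rule measurable_cong[THEN iffD1, rotated]) (use r in \<open>auto simp: grid_after_def of_nat_nat add_ac\<close>)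
qed

lemma optional_real_measurable:
  assumes T: "optional T"
  shows "(\<lambda>\<omega>. real_of_ereal (T \<omega>)) \<in> borel_measurable M" "at_time T \<in> borel_measurable M"
proof -
  note [measurable] = optional_measurable[OF T]
  show 1: "(\<lambda>\<omega>. real_of_ereal (T \<omega>)) \<in> borel_measurable M" by measurable
  show "at_time T \<in> borel_measurable M"
    unfolding at_time_def using optional_nonneg[OF T]
    by (intro Y_random_time_measurable 1) (auto simp: real_of_ereal_pos)
qed

text \<open>
  The later time \<open>\<rho> T\<close> will be a fixed time \<open>t\<close> or \<open>T\<close> plus a constant. With \<open>T\<close> replaced
  by its grid approximation the claim is a finite sum of instances of the Markov property.
  Both sides pass to the limit because the paths are right-continuous and the
  approximation decreases to \<open>T\<close>; monotonicity of \<open>\<rho>\<close> keeps the approximation of \<open>\<rho> T\<close>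
  from above, too.
\<close>

theorem strong_markov:
  assumes T: "optional T"
    and \<rho>: "\<And>s. 0 \<le> s \<Longrightarrow> s < t \<Longrightarrow> s \<le> \<rho> s" "mono \<rho>" "continuous_on UNIV \<rho>"
  shows "(\<integral>\<omega>. (if T \<omega> < ereal t then iexp (\<eta> \<bullet> at_time T \<omega>)
               * iexp (\<xi> \<bullet> (Y (\<rho> (real_of_ereal (T \<omega>))) \<omega> - at_time T \<omega>)) else 0) \<partial>M)
       = (\<integral>\<omega>. (if T \<omega> < ereal t then iexp (\<eta> \<bullet> at_time T \<omega>)
               * complex_of_real (exp (- (\<rho> (real_of_ereal (T \<omega>)) - real_of_ereal (T \<omega>)) * norm \<xi> powr \<alpha>)) else 0) \<partial>M)"
    (is "integral\<^sup>L M ?F = integral\<^sup>L M ?G")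
proof -
  note [measurable] = optional_measurable[OF T]
  define r where "r \<omega> = real_of_ereal (T \<omega>)" for \<omega>
  have [measurable]: "r \<in> borel_measurable M" unfolding r_def by measurable
  have r0: "0 \<le> r \<omega>" if "\<omega> \<in> space M" for \<omega>
    using optional_nonneg[OF T that] unfolding r_def by (rule real_of_ereal_pos)
  have Tr: "T \<omega> = ereal (r \<omega>)" if "\<omega> \<in> space M" "T \<omega> < ereal u" for \<omega> u
    using optional_nonneg[OF T that(1)] that(2) unfolding r_def by (cases "T \<omega>") auto
  have [measurable]: "\<rho> \<in> borel_measurable borel"
    using \<rho>(3) by (rule borel_measurable_continuous_onI)
  define f where "f s \<omega> = iexp (\<eta> \<bullet> Y s \<omega>) * iexp (\<xi> \<bullet> (Y (\<rho> s) \<omega> - Y s \<omega>))" for s \<omega>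
  define g where "g s \<omega> = iexp (\<eta> \<bullet> Y s \<omega>) * complex_of_real (exp (- (\<rho> s - s) * norm \<xi> powr \<alpha>))" for s \<omega>
  define F where "F n \<omega> = (if T \<omega> < ereal t \<and> grid_after n (r \<omega>) < t then f (grid_after n (r \<omega>)) \<omega> else 0)" for n \<omega>
  define G where "G n \<omega> = (if T \<omega> < ereal t \<and> grid_after n (r \<omega>) < t then g (grid_after n (r \<omega>)) \<omega> else 0)" for n \<omega>
  define K where "K n = {k::nat. real (Suc k) / Suc n < t}" for n
  define A where "A n k = {\<omega>\<in>space M. ereal (real k / Suc n) \<le> T \<omega> \<and> T \<omega> < ereal (real (Suc k) / Suc n)}" for n k :: nat
  have finK: "finite (K n)" for n
  proof -
    have "K n \<subseteq> {..nat \<lceil>real (Suc n) * t\<rceil>}"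
    proof
      fix k assume "k \<in> K n"
      then have "real k < real (Suc n) * t" by (simp add: K_def field_simps)
      then show "k \<in> {..nat \<lceil>real (Suc n) * t\<rceil>}" by simp linarith
    qed
    then show ?thesis by (rule finite_subset) simp
  qed
  have A_hist: "A n k \<in> hist (real (Suc k) / Suc n)" for n k
  proof -
    interpret H: sigma_algebra "space M" "hist (real (Suc k) / Suc n)" by (rule sigma_algebra_hist)
    have "A n k = {\<omega>\<in>space M. T \<omega> < ereal (real (Suc k) / Suc n)} - {\<omega>\<in>space M. T \<omega> < ereal (real k / Suc n)}"
      unfolding A_def by auto
    moreover have "{\<omega>\<in>space M. T \<omega> < ereal (real k / Suc n)} \<in> hist (real (Suc k) / Suc n)"
      using optional_less[OF T] by (rule subsetD[OF hist_mono, rotated]) (simp add: divide_right_mono)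
    ultimately show ?thesis
      using optional_less[OF T] by (simp only: H.Diff)
  qed
  have decomp: "(if T \<omega> < ereal t \<and> grid_after n (r \<omega>) < t then h (grid_after n (r \<omega>)) else 0)
      = (\<Sum>k\<in>K n. indicat_real (A n k) \<omega> *\<^sub>R h (real (Suc k) / Suc n))" (is "?l = ?r")
    if \<omega>: "\<omega> \<in> space M" for \<omega> n and h :: "real \<Rightarrow> complex"
  proof -
    \<comment> \<open>At most one summand does not vanish, the one of the grid point reached.\<close>
    obtain k0 where k0: "grid_after n (r \<omega>) = real (Suc k0) / Suc n"
      using grid_after_ex r0[OF \<omega>] by blast
    have memA: "\<omega> \<in> A n k \<longleftrightarrow> T \<omega> < \<infinity> \<and> k = k0" for k
    proof
      assume *: "\<omega> \<in> A n k"
      then have "T \<omega> = ereal (r \<omega>)" using \<omega> Tr unfolding A_def by blast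
      then have "grid_after n (r \<omega>) = real (Suc k) / Suc n"
        using * grid_after_eq_iff[OF r0[OF \<omega>], of n k] by (simp add: A_def)
      then show "T \<omega> < \<infinity> \<and> k = k0" using k0 \<open>T \<omega> = _\<close> by (simp add: field_simps)
    next
      assume *: "T \<omega> < \<infinity> \<and> k = k0"
      then have "T \<omega> = ereal (r \<omega>)" 
        using optional_nonneg[OF T \<omega>] unfolding r_def by (cases "T \<omega>") auto
      then show "\<omega> \<in> A n k"
        using \<omega> * k0 grid_after_eq_iff[OF r0[OF \<omega>], of n k0] by (simp add: A_def)
    qed
    show ?thesis
    proof (cases "T \<omega> < \<infinity> \<and> k0 \<in> K n")
      case True
      have Te: "T \<omega> = ereal (r \<omega>)" 
        using True optional_nonneg[OF T \<omega>] unfolding r_def by (cases "T \<omega>") auto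
      have lt: "grid_after n (r \<omega>) < t" using True k0 by (simp add: K_def)
      have "?r = (\<Sum>k\<in>{k0}. indicat_real (A n k) \<omega> *\<^sub>R h (real (Suc k) / Suc n))"
        by (rule sum.mono_neutral_right[OF finK]) (use True memA in auto)
      also have "\<dots> = h (grid_after n (r \<omega>))"
        using memA True k0 by simp
      finally show ?thesis
        using lt Te grid_after_gt[of "r \<omega>" n] by simp
    next
      case False
      have "?r = 0"
        by (rule sum.neutral) (use False memA in \<open>auto simp: indicator_def\<close>)
      moreover have "\<not> (T \<omega> < ereal t \<and> grid_after n (r \<omega>) < t)"
        using False k0 by (auto simp: K_def)
      ultimately show ?thesis by (simp only: if_False)
    qed
  qed
  have rho_ge: "s \<le> \<rho> s" "0 \<le> \<rho> s" if "0 \<le> s" "s < t" for s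
    using \<rho>(1) that by force+
  have meas_fg: "f (real (Suc k) / Suc n) \<in> borel_measurable M" "g (real (Suc k) / Suc n) \<in> borel_measurable M"
    if "k \<in> K n" for k n
  proof -
    have [measurable]: "Y (real (Suc k) / Suc n) \<in> borel_measurable M"
       "Y (\<rho> (real (Suc k) / Suc n)) \<in> borel_measurable M"
      using that by (auto simp: K_def intro!: Y_measurable rho_ge)
    show "f (real (Suc k) / Suc n) \<in> borel_measurable M" "g (real (Suc k) / Suc n) \<in> borel_measurable M"
      unfolding f_def g_def by measurable
  qed
  have norm_f: "norm (f s \<omega>) \<le> 1" for s \<omega> by (simp add: f_def norm_mult)
  have norm_g: "norm (g s \<omega>) \<le> 1" if "0 \<le> s" "s < t" for s \<omega>
    using rho_ge[OF that] by (simp add: g_def norm_mult mult_nonpos_nonneg)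
  have int_fg: "integrable M (\<lambda>\<omega>. indicat_real (A n k) \<omega> *\<^sub>R f (real (Suc k) / Suc n) \<omega>)"
      "integrable M (\<lambda>\<omega>. indicat_real (A n k) \<omega> *\<^sub>R g (real (Suc k) / Suc n) \<omega>)"
    if k: "k \<in> K n" for k n
  proof -
    have [measurable]: "A n k \<in> events" using A_hist hist_events by blast
    note [measurable] = meas_fg[OF k]
    have k': "0 \<le> real (Suc k) / Suc n" "real (Suc k) / Suc n < t" using k by (auto simp: K_def)
    show "integrable M (\<lambda>\<omega>. indicat_real (A n k) \<omega> *\<^sub>R f (real (Suc k) / Suc n) \<omega>)"
      by (rule integrable_const_bound[where B=1]; (measurable | rule AE_I2))
         (use norm_f in \<open>auto simp: indicator_def simp del: of_nat_Suc\<close>)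
    show "integrable M (\<lambda>\<omega>. indicat_real (A n k) \<omega> *\<^sub>R g (real (Suc k) / Suc n) \<omega>)"
      by (rule integrable_const_bound[where B=1]; (measurable | rule AE_I2))
         (use norm_g[OF k'] in \<open>auto simp: indicator_def simp del: of_nat_Suc\<close>)
  qed
  have F_eq: "F n \<omega> = (\<Sum>k\<in>K n. indicat_real (A n k) \<omega> *\<^sub>R f (real (Suc k) / Suc n) \<omega>)"
    and G_eq: "G n \<omega> = (\<Sum>k\<in>K n. indicat_real (A n k) \<omega> *\<^sub>R g (real (Suc k) / Suc n) \<omega>)"
    if "\<omega> \<in> space M" for n \<omega>
    unfolding F_def G_def using decomp[OF that, of n "\<lambda>s. f s \<omega>"] decomp[OF that, of n "\<lambda>s. g s \<omega>"]
    by simp_all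
  have discrete: "integral\<^sup>L M (F n) = integral\<^sup>L M (G n)" for n
  proof -
    have "integral\<^sup>L M (F n) = (\<integral>\<omega>. (\<Sum>k\<in>K n. indicat_real (A n k) \<omega> *\<^sub>R f (real (Suc k) / Suc n) \<omega>) \<partial>M)"
      by (rule Bochner_Integration.integral_cong[OF refl F_eq])
    also have "\<dots> = (\<Sum>k\<in>K n. \<integral>\<omega>. indicat_real (A n k) \<omega> *\<^sub>R f (real (Suc k) / Suc n) \<omega> \<partial>M)"
      by (rule Bochner_Integration.integral_sum) (rule int_fg)
    also have "\<dots> = (\<Sum>k\<in>K n. \<integral>\<omega>. indicat_real (A n k) \<omega> *\<^sub>R g (real (Suc k) / Suc n) \<omega> \<partial>M)"
    proof (rule sum.cong[OF refl])
      fix k assume "k \<in> K n"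
      then have k': "0 \<le> real (Suc k) / Suc n" "real (Suc k) / Suc n < t" by (auto simp: K_def)
      show "(\<integral>\<omega>. indicat_real (A n k) \<omega> *\<^sub>R f (real (Suc k) / Suc n) \<omega> \<partial>M)
          = (\<integral>\<omega>. indicat_real (A n k) \<omega> *\<^sub>R g (real (Suc k) / Suc n) \<omega> \<partial>M)"
        using markov_hist[OF A_hist k'(1) rho_ge(1)[OF k'], of \<eta> \<xi>]
        unfolding set_lebesgue_integral_def f_def g_def
        by (simp flip: mult_scaleR_left del: of_nat_Suc)
    qed
    also have "\<dots> = (\<integral>\<omega>. (\<Sum>k\<in>K n. indicat_real (A n k) \<omega> *\<^sub>R g (real (Suc k) / Suc n) \<omega>) \<partial>M)"
      by (rule Bochner_Integration.integral_sum[symmetric]) (rule int_fg)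
    also have "\<dots> = integral\<^sup>L M (G n)"
      by (rule Bochner_Integration.integral_cong[OF refl G_eq[symmetric]])
    finally show ?thesis .
  qed
  have F_meas[measurable]: "F n \<in> borel_measurable M" for n
    by (subst measurable_cong[OF F_eq]) (use int_fg in \<open>auto intro!: borel_measurable_sum\<close>)
  have G_meas[measurable]: "G n \<in> borel_measurable M" for n
    by (subst measurable_cong[OF G_eq]) (use int_fg in \<open>auto intro!: borel_measurable_sum\<close>)
  have lim: "(\<lambda>n. F n \<omega>) \<longlonglongrightarrow> ?F \<omega>" "(\<lambda>n. G n \<omega>) \<longlonglongrightarrow> ?G \<omega>" if \<omega>: "\<omega> \<in> space M" for \<omega>
  proof -
    have "(\<lambda>n. F n \<omega>) \<longlonglongrightarrow> ?F \<omega> \<and> (\<lambda>n. G n \<omega>) \<longlonglongrightarrow> ?G \<omega>"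
    proof (cases "T \<omega> < ereal t")
      case True
      have rt: "r \<omega> < t" using True Tr[OF \<omega> True] by simp
      have ev: "\<forall>\<^sub>F n in sequentially. grid_after n (r \<omega>) < t"
        using order_tendstoD(2)[OF grid_after_tendsto rt] .
      have Y1: "(\<lambda>n. Y (grid_after n (r \<omega>)) \<omega>) \<longlonglongrightarrow> Y (r \<omega>) \<omega>"
        by (rule cadlag_tendsto_right[OF Y_cadlag[OF \<omega>] r0[OF \<omega>] grid_after_tendsto])
           (simp add: grid_after_gt less_imp_le)
      have \<rho>1: "(\<lambda>n. \<rho> (grid_after n (r \<omega>))) \<longlonglongrightarrow> \<rho> (r \<omega>)"
        by (rule continuous_on_tendsto_compose[OF \<rho>(3) grid_after_tendsto]) auto
      have Y2: "(\<lambda>n. Y (\<rho> (grid_after n (r \<omega>))) \<omega>) \<longlonglongrightarrow> Y (\<rho> (r \<omega>)) \<omega>"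
        by (rule cadlag_tendsto_right[OF Y_cadlag[OF \<omega>] rho_ge(2)[OF r0[OF \<omega>] rt] \<rho>1])
           (use \<rho>(2) grid_after_gt in \<open>auto simp: mono_def less_imp_le\<close>)
      have "(\<lambda>n. f (grid_after n (r \<omega>)) \<omega>) \<longlonglongrightarrow> f (r \<omega>) \<omega>"
        unfolding f_def by (intro tendsto_intros Y1 Y2)
      moreover have "\<forall>\<^sub>F n in sequentially. f (grid_after n (r \<omega>)) \<omega> = F n \<omega>"
        using ev by eventually_elim (simp add: F_def True)
      ultimately have "(\<lambda>n. F n \<omega>) \<longlonglongrightarrow> f (r \<omega>) \<omega>" by (rule Lim_transform_eventually)
      moreover have "(\<lambda>n. g (grid_after n (r \<omega>)) \<omega>) \<longlonglongrightarrow> g (r \<omega>) \<omega>"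
        unfolding g_def by (intro tendsto_intros Y1 \<rho>1 grid_after_tendsto)
      moreover have "\<forall>\<^sub>F n in sequentially. g (grid_after n (r \<omega>)) \<omega> = G n \<omega>"
        using ev by eventually_elim (simp add: G_def True)
      ultimately show ?thesis
        using True Lim_transform_eventually by (auto simp: f_def g_def r_def at_time_def)
    qed (simp add: F_def G_def)
    then show "(\<lambda>n. F n \<omega>) \<longlonglongrightarrow> ?F \<omega>" "(\<lambda>n. G n \<omega>) \<longlonglongrightarrow> ?G \<omega>" by auto
  qed
  have nF: "norm (F n \<omega>) \<le> 1" for n \<omega>
    by (simp add: F_def norm_f)
  have nG: "norm (G n \<omega>) \<le> 1" if "\<omega> \<in> space M" for n \<omega>
    using norm_g[of "grid_after n (r \<omega>)" \<omega>] r0[OF that] grid_after_gt[of "r \<omega>" n] by (simp add: G_def)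
  have "(\<lambda>n. integral\<^sup>L M (F n)) \<longlonglongrightarrow> integral\<^sup>L M ?F"
    by (rule integral_dominated_convergence[where w="\<lambda>_. 1"])
       (use lim nF borel_measurable_LIMSEQ_metric[OF F_meas lim(1)] in auto)
  moreover have "(\<lambda>n. integral\<^sup>L M (G n)) \<longlonglongrightarrow> integral\<^sup>L M ?G"
    by (rule integral_dominated_convergence[where w="\<lambda>_. 1"])
       (use lim nG borel_measurable_LIMSEQ_metric[OF G_meas lim(2)] in auto)
  ultimately show ?thesis
    unfolding discrete by (rule LIMSEQ_unique)
qed

end

section \<open>Displacement after an optional time\<close>

text \<open>
  As \<open>\<alpha> < 2\<close>, the power is at most \<open>1 + (norm \<xi>)\<^sup>2\<close>, and half of the Gaussian absorbs the
  square.
\<close>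

lemma integrable_powr_norm_exp:
  fixes \<alpha> s :: real
  assumes "0 < \<alpha>" "\<alpha> < 2" and s: "s > 0"
  shows "integrable lborel (\<lambda>\<xi>::'a::euclidean_space. norm \<xi> powr \<alpha> * exp (- s\<^sup>2 * (norm \<xi>)\<^sup>2 / 2))"
proof (rule Bochner_Integration.integrable_bound)
  let ?s = "s / sqrt 2"
  show "integrable lborel (\<lambda>\<xi>::'a. (1 + 4 / s\<^sup>2) * exp (- ?s\<^sup>2 * (norm \<xi>)\<^sup>2 / 2))"
    using s by (intro integrable_mult_right integrable_exp_norm_square) simp
  show "AE \<xi> in lborel. norm (norm (\<xi>::'a) powr \<alpha> * exp (- s\<^sup>2 * (norm \<xi>)\<^sup>2 / 2))
      \<le> norm ((1 + 4 / s\<^sup>2) * exp (- ?s\<^sup>2 * (norm \<xi>)\<^sup>2 / 2))"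
  proof (rule AE_I2)
    fix \<xi> :: 'a
    let ?q = "s\<^sup>2 * (norm \<xi>)\<^sup>2 / 4"
    have a: "norm \<xi> powr \<alpha> \<le> 1 + (norm \<xi>)\<^sup>2"
    proof (cases "norm \<xi> \<le> 1")
      case True
      then have "norm \<xi> powr \<alpha> \<le> 1" using assms by (intro powr_le1) auto
      then show ?thesis by (smt (verit) zero_le_power2)
    next
      case False
      then have "norm \<xi> powr \<alpha> \<le> norm \<xi> powr 2" using assms by (intro powr_mono) auto
      then show ?thesis using False by (simp add: powr_numeral)
    qed
    have "?q \<le> exp ?q" using exp_ge_add_one_self[of ?q] by linarith
    then have "(norm \<xi>)\<^sup>2 \<le> 4 / s\<^sup>2 * exp ?q" using s by (simp add: field_simps)
    moreover have "1 \<le> exp ?q" by simp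
    moreover have "(1 + 4 / s\<^sup>2) * exp ?q = exp ?q + 4 / s\<^sup>2 * exp ?q"
      by (simp add: distrib_right)
    ultimately have "norm \<xi> powr \<alpha> \<le> (1 + 4 / s\<^sup>2) * exp ?q"
      using a by linarith
    then have "norm \<xi> powr \<alpha> * exp (- s\<^sup>2 * (norm \<xi>)\<^sup>2 / 2) \<le> (1 + 4 / s\<^sup>2) * exp ?q * exp (- s\<^sup>2 * (norm \<xi>)\<^sup>2 / 2)"
      by (rule mult_right_mono) simp
    also have "\<dots> = (1 + 4 / s\<^sup>2) * exp (- ?s\<^sup>2 * (norm \<xi>)\<^sup>2 / 2)"
      by (simp add: mult.assoc power_divide flip: exp_add)
    finally show "norm (norm \<xi> powr \<alpha> * exp (- s\<^sup>2 * (norm \<xi>)\<^sup>2 / 2))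
      \<le> norm ((1 + 4 / s\<^sup>2) * exp (- ?s\<^sup>2 * (norm \<xi>)\<^sup>2 / 2))"
      by simp
  qed
qed measurable

lemma integrable_powr_norm_gauss:
  assumes "0 < \<alpha>" "\<alpha> < 2"
  shows "integrable lborel (\<lambda>\<xi>::'a::euclidean_space. gauss 1 \<xi> * norm \<xi> powr \<alpha>)"
proof -
  have "gauss 1 \<xi> * norm \<xi> powr \<alpha> = (norm \<xi> powr \<alpha> * exp (- 1\<^sup>2 * (norm \<xi>)\<^sup>2 / 2)) / sqrt (2 * pi) ^ DIM('a)" for \<xi> :: 'a
    by (simp add: gauss_def mult_ac)
  then show ?thesis
    using integrable_powr_norm_exp[OF assms, of 1, where 'a='a] by simp
qed

text \<open>
  The absolute moment of order \<open>\<alpha>\<close> of the standard normal distribution. The type argument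
  fixes the space, which the real number itself does not determine.
\<close>

definition gauss_moment :: "'a::euclidean_space itself \<Rightarrow> real \<Rightarrow> real" where
  "gauss_moment _ \<alpha> = (\<integral>\<xi>. gauss 1 \<xi> * norm (\<xi>::'a) powr \<alpha> \<partial>lborel)"

lemma gauss_moment_nonneg: "0 \<le> gauss_moment TYPE('a::euclidean_space) \<alpha>"
  unfolding gauss_moment_def by (rule integral_nonneg_AE) simp

text \<open>
  Averaging \<open>1 - iexp (\<xi> \<bullet> v)\<close> over a standard normal \<open>\<xi>\<close> gives
  \<open>1 - exp (- (norm v)\<^sup>2 / 2)\<close>, which measures how far \<open>v\<close> is from the origin. Bounds on
  characteristic functions become tail bounds.
\<close>

lemma gauss_average_iexp:
  fixes V :: "'w \<Rightarrow> 'a::euclidean_space"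
  assumes "finite_measure M" and [measurable]: "V \<in> borel_measurable M" "A \<in> sets M"
  shows "complex_of_real (LINT \<omega>:A|M. 1 - exp (- (norm (V \<omega>))\<^sup>2 / 2))
       = (\<integral>\<xi>. complex_of_real (gauss 1 \<xi>) * (LINT \<omega>:A|M. 1 - iexp (\<xi> \<bullet> V \<omega>)) \<partial>lborel)"
proof -
  interpret finite_measure M by fact
  interpret P: pair_sigma_finite M "lborel :: 'a measure" by standard
  let ?f = "\<lambda>\<omega> \<xi>. complex_of_real (gauss 1 \<xi>) * (indicat_real A \<omega> *\<^sub>R (1 - iexp (\<xi> \<bullet> V \<omega>)))"
  have b: "norm (?f \<omega> \<xi>) \<le> 2 * gauss 1 \<xi>" for \<omega> \<xi>
  proof -
    have "norm (1 - iexp (\<xi> \<bullet> V \<omega>)) \<le> 2"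
      by (rule order_trans[OF norm_triangle_ineq4]) simp
    then have "norm (indicat_real A \<omega> *\<^sub>R (1 - iexp (\<xi> \<bullet> V \<omega>))) \<le> 2"
      by (simp add: indicator_def)
    then have "gauss 1 \<xi> * norm (indicat_real A \<omega> *\<^sub>R (1 - iexp (\<xi> \<bullet> V \<omega>))) \<le> gauss 1 \<xi> * 2"
      by (intro mult_left_mono) auto
    then show ?thesis by (simp add: norm_mult mult_ac)
  qed
  have int: "integrable lborel (\<lambda>\<xi>. ?f \<omega> \<xi>)" for \<omega>
    by (rule Bochner_Integration.integrable_bound[where f="\<lambda>\<xi>::'a. 2 * gauss 1 \<xi>"])
       (use b in \<open>auto intro!: fourier_gauss(1)\<close>)
  have "integrable (M \<Otimes>\<^sub>M lborel) (\<lambda>(\<omega>, \<xi>). ?f \<omega> \<xi>)"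
  proof (rule P.Fubini_integrable)
    show "(\<lambda>(\<omega>, \<xi>). ?f \<omega> \<xi>) \<in> borel_measurable (M \<Otimes>\<^sub>M lborel)" by measurable
    show "AE x in M. integrable lborel (\<lambda>y. case (x, y) of (\<omega>, \<xi>) \<Rightarrow> ?f \<omega> \<xi>)"
      using int by simp
    have "norm (LBINT \<xi>. norm (?f \<omega> \<xi>)) \<le> 2" for \<omega>
    proof -
      have "(LBINT \<xi>. norm (?f \<omega> \<xi>)) \<le> (LBINT \<xi>::'a. 2 * gauss 1 \<xi>)"
        by (rule integral_mono[OF integrable_norm[OF int]]) (use b in \<open>auto intro!: fourier_gauss(1)\<close>)
      then show ?thesis by (simp add: integral_gauss integral_nonneg_AE)
    qed
    then show "integrable M (\<lambda>x. LBINT y. norm (case (x, y) of (\<omega>, \<xi>) \<Rightarrow> ?f \<omega> \<xi>))"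
      by (intro integrable_const_bound[where B=2]) auto
  qed
  then have "(\<integral>\<xi>. (\<integral>\<omega>. ?f \<omega> \<xi> \<partial>M) \<partial>lborel) = (\<integral>\<omega>. (\<integral>\<xi>. ?f \<omega> \<xi> \<partial>lborel) \<partial>M)"
    by (rule P.Fubini_integral)
  moreover have "(\<integral>\<xi>. ?f \<omega> \<xi> \<partial>lborel) = complex_of_real (indicat_real A \<omega> *\<^sub>R (1 - exp (- (norm (V \<omega>))\<^sup>2 / 2)))" for \<omega>
  proof -
    have "(\<integral>\<xi>. ?f \<omega> \<xi> \<partial>lborel) = (\<integral>\<xi>. indicat_real A \<omega> *\<^sub>R (complex_of_real (gauss 1 \<xi>) - iexp (V \<omega> \<bullet> \<xi>) * complex_of_real (gauss 1 \<xi>)) \<partial>lborel)"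
      by (intro Bochner_Integration.integral_cong refl) (simp add: algebra_simps inner_commute)
    also have "\<dots> = indicat_real A \<omega> *\<^sub>R ((\<integral>\<xi>. complex_of_real (gauss 1 (\<xi>::'a)) \<partial>lborel) - (\<integral>\<xi>. iexp (V \<omega> \<bullet> \<xi>) * complex_of_real (gauss 1 \<xi>) \<partial>lborel))"
    proof -
      have "integrable lborel (\<lambda>\<xi>. iexp (V \<omega> \<bullet> \<xi>) * complex_of_real (gauss 1 \<xi>))"
        by (rule Bochner_Integration.integrable_bound[where f="\<lambda>\<xi>::'a. gauss 1 \<xi>"])
           (auto intro!: fourier_gauss(1) simp: norm_mult)
      then show ?thesis
        by (subst integral_scaleR_right, subst Bochner_Integration.integral_diff)
           (auto intro!: integrable_of_real fourier_gauss(1))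
    qed
    also have "\<dots> = complex_of_real (indicat_real A \<omega> *\<^sub>R (1 - exp (- (norm (V \<omega>))\<^sup>2 / 2)))"
      by (simp add: fourier_gauss(2) integral_gauss scaleR_conv_of_real)
    finally show ?thesis .
  qed
  moreover have "(\<integral>\<omega>. ?f \<omega> \<xi> \<partial>M) = complex_of_real (gauss 1 \<xi>) * (\<integral>\<omega>. indicat_real A \<omega> *\<^sub>R (1 - iexp (\<xi> \<bullet> V \<omega>)) \<partial>M)" for \<xi>
    by (rule integral_mult_right_zero)
  ultimately show ?thesis
    unfolding set_lebesgue_integral_def by (simp only: integral_complex_of_real)
qed

lemma gauss_average_bound:
  fixes V :: "'w \<Rightarrow> 'a::euclidean_space"
  assumes M: "finite_measure M" and meas: "V \<in> borel_measurable M" "A \<in> sets M"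
    and \<alpha>: "0 < \<alpha>" "\<alpha> < 2"
    and le: "\<And>\<xi>. norm (LINT \<omega>:A|M. 1 - iexp (\<xi> \<bullet> V \<omega>)) \<le> c * norm \<xi> powr \<alpha>"
  shows "(LINT \<omega>:A|M. 1 - exp (- (norm (V \<omega>))\<^sup>2 / 2)) \<le> c * gauss_moment TYPE('a) \<alpha>"
proof -
  interpret finite_measure M by fact
  have [measurable]: "V \<in> borel_measurable M" "A \<in> sets M" by fact+
  let ?g = "\<lambda>\<xi>. complex_of_real (gauss 1 \<xi>) * (LINT \<omega>:A|M. 1 - iexp (\<xi> \<bullet> V \<omega>))"
  have b: "norm (?g \<xi>) \<le> c * (gauss 1 \<xi> * norm \<xi> powr \<alpha>)" for \<xi>
    using mult_left_mono[OF le[of \<xi>], of "gauss 1 \<xi>"] by (simp add: norm_mult mult_ac)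
  have "(LINT \<omega>:A|M. 1 - exp (- (norm (V \<omega>))\<^sup>2 / 2)) = Re (\<integral>\<xi>. ?g \<xi> \<partial>lborel)"
    using gauss_average_iexp[OF M meas] by (metis Re_complex_of_real)
  also have "\<dots> \<le> norm (\<integral>\<xi>. ?g \<xi> \<partial>lborel)" by (rule complex_Re_le_cmod)
  also have "\<dots> \<le> (\<integral>\<xi>. norm (?g \<xi>) \<partial>lborel)" by (rule integral_norm_bound)
  also have "\<dots> \<le> (\<integral>\<xi>. c * (gauss 1 \<xi> * norm (\<xi>::'a) powr \<alpha>) \<partial>lborel)"
    by (rule integral_mono') (use b integrable_powr_norm_gauss[OF \<alpha>] in \<open>auto intro: order_trans[OF norm_ge_zero]\<close>)
  also have "\<dots> = c * gauss_moment TYPE('a) \<alpha>"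
    by (simp add: gauss_moment_def)
  finally show ?thesis .
qed

lemma measure_norm_ge_le:
  fixes V :: "'w \<Rightarrow> 'a::euclidean_space"
  assumes M: "finite_measure M" and [measurable]: "V \<in> borel_measurable M" "A \<in> sets M"
    and \<epsilon>: "\<epsilon> > 0"
  shows "measure M {\<omega>\<in>space M. \<omega> \<in> A \<and> \<epsilon> \<le> norm (V \<omega>)} * (1 - exp (- \<epsilon>\<^sup>2 / 2))
       \<le> (LINT \<omega>:A|M. 1 - exp (- (norm (V \<omega>))\<^sup>2 / 2))"
proof -
  interpret finite_measure M by fact
  let ?E = "{\<omega>\<in>space M. \<omega> \<in> A \<and> \<epsilon> \<le> norm (V \<omega>)}"
  have "measure M ?E * (1 - exp (- \<epsilon>\<^sup>2 / 2)) = (\<integral>\<omega>. indicat_real ?E \<omega> * (1 - exp (- \<epsilon>\<^sup>2 / 2)) \<partial>M)"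
    by simp
  also have "\<dots> \<le> (\<integral>\<omega>. indicat_real A \<omega> *\<^sub>R (1 - exp (- (norm (V \<omega>))\<^sup>2 / 2)) \<partial>M)"
  proof (rule integral_mono')
    show "integrable M (\<lambda>\<omega>. indicat_real A \<omega> *\<^sub>R (1 - exp (- (norm (V \<omega>))\<^sup>2 / 2)))"
      by (rule integrable_const_bound[where B=1]) (auto simp: indicator_def)
    show "indicat_real ?E \<omega> * (1 - exp (- \<epsilon>\<^sup>2 / 2)) \<le> indicat_real A \<omega> *\<^sub>R (1 - exp (- (norm (V \<omega>))\<^sup>2 / 2))" for \<omega>
      using \<epsilon> power_mono[of \<epsilon> "norm (V \<omega>)" 2] by (auto simp: indicator_def)
    show "0 \<le> indicat_real A \<omega> *\<^sub>R (1 - exp (- (norm (V \<omega>))\<^sup>2 / 2))" for \<omega>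
      by (simp add: indicator_def)
  qed
  finally show ?thesis by (simp add: set_lebesgue_integral_def)
qed

text \<open>
  The Gaussian average of the constant characteristic function vanishes, so
  \<open>1 - exp (- (norm (V \<omega>))\<^sup>2 / 2)\<close> is \<open>0\<close> almost everywhere on \<open>A\<close>.
\<close>

lemma AE_zero_if_iexp_one:
  fixes V :: "'w \<Rightarrow> 'a::euclidean_space"
  assumes M: "finite_measure M" and meas: "V \<in> borel_measurable M" "A \<in> sets M"
    and eq: "\<And>\<xi>. (LINT \<omega>:A|M. iexp (\<xi> \<bullet> V \<omega>)) = complex_of_real (measure M A)"
  shows "AE \<omega> in M. \<omega> \<in> A \<longrightarrow> V \<omega> = 0"
proof -
  interpret finite_measure M by fact
  have [measurable]: "V \<in> borel_measurable M" "A \<in> sets M" by fact+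
  have "(LINT \<omega>:A|M. 1 - iexp (\<xi> \<bullet> V \<omega>)) = 0" for \<xi>
  proof -
    have i: "integrable M (\<lambda>\<omega>. indicat_real A \<omega> *\<^sub>R iexp (\<xi> \<bullet> V \<omega>))"
        "integrable M (\<lambda>\<omega>. indicat_real A \<omega> *\<^sub>R (1::complex))"
      by (rule integrable_const_bound[where B=1]; simp add: indicator_def)+
    have "(LINT \<omega>:A|M. 1 - iexp (\<xi> \<bullet> V \<omega>)) = (LINT \<omega>:A|M. (1::complex)) - (LINT \<omega>:A|M. iexp (\<xi> \<bullet> V \<omega>))"
      unfolding set_lebesgue_integral_def scaleR_diff_right using i by simp
    moreover have "(LINT \<omega>:A|M. (1::complex)) = complex_of_real (measure M A)"
      unfolding set_lebesgue_integral_def by (simp add: scaleR_conv_of_real)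
    ultimately show ?thesis by (simp add: eq)
  qed
  then have "complex_of_real (LINT \<omega>:A|M. 1 - exp (- (norm (V \<omega>))\<^sup>2 / 2)) = 0"
    by (subst gauss_average_iexp[OF M meas]) simp
  then have "(\<integral>\<omega>. indicat_real A \<omega> *\<^sub>R (1 - exp (- (norm (V \<omega>))\<^sup>2 / 2)) \<partial>M) = 0"
    by (simp add: set_lebesgue_integral_def)
  moreover have "integrable M (\<lambda>\<omega>. indicat_real A \<omega> *\<^sub>R (1 - exp (- (norm (V \<omega>))\<^sup>2 / 2)))"
    by (rule integrable_const_bound[where B=1]) (auto simp: indicator_def)
  ultimately have "AE \<omega> in M. indicat_real A \<omega> *\<^sub>R (1 - exp (- (norm (V \<omega>))\<^sup>2 / 2)) = 0"
    by (subst (asm) integral_nonneg_eq_0_iff_AE) (auto simp: indicator_def)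
  then show ?thesis
    by eventually_elim (auto simp: indicator_def split: if_splits)
qed

context stable_motion
begin

text \<open>
  By the strong Markov property the character of the displacement after \<open>T\<close> averages to
  \<open>exp (- (t - T) * norm \<xi> powr \<alpha>)\<close>, which differs from \<open>1\<close> by at most
  \<open>t * norm \<xi> powr \<alpha>\<close>. The factor \<open>t\<close> is what makes two successive displacements
  negligible against one.
\<close>

lemma displacement_after_gauss:
  assumes T: "optional T" and t: "0 \<le> t"
  shows "(LINT \<omega>:{\<omega>\<in>space M. T \<omega> < ereal t}|M. 1 - exp (- (norm (Y t \<omega> - at_time T \<omega>))\<^sup>2 / 2))
     \<le> t * prob {\<omega>\<in>space M. T \<omega> < ereal t} * gauss_moment TYPE('a) \<alpha>"
proof (rule gauss_average_bound[OF finite_measure_axioms _ _ alpha])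
  note [measurable] = optional_measurable[OF T] optional_real_measurable[OF T]
  let ?A = "{\<omega>\<in>space M. T \<omega> < ereal t}"
  have [measurable]: "Y t \<in> borel_measurable M" using t by simp
  show "(\<lambda>\<omega>. Y t \<omega> - at_time T \<omega>) \<in> borel_measurable M" "?A \<in> events" by measurable
  fix \<xi> :: 'a
  let ?p = "norm \<xi> powr \<alpha>"
  let ?r = "\<lambda>\<omega>. real_of_ereal (T \<omega>)"
  have r: "0 \<le> ?r \<omega>" "?r \<omega> \<le> t" if "\<omega> \<in> ?A" for \<omega>
    using that optional_nonneg[OF T, of \<omega>] by (cases "T \<omega>"; force)+
  have ex: "0 \<le> 1 - exp (- (t - ?r \<omega>) * ?p) \<and> 1 - exp (- (t - ?r \<omega>) * ?p) \<le> t * ?p" if "\<omega> \<in> ?A" for \<omega>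
  proof
    show "0 \<le> 1 - exp (- (t - ?r \<omega>) * ?p)"
      using r[OF that] by (simp add: mult_nonpos_nonneg)
    have "1 - exp (- (t - ?r \<omega>) * ?p) \<le> (t - ?r \<omega>) * ?p"
      using exp_ge_add_one_self[of "- (t - ?r \<omega>) * ?p"] by linarith
    also have "\<dots> \<le> t * ?p" using r[OF that] by (intro mult_right_mono) auto
    finally show "1 - exp (- (t - ?r \<omega>) * ?p) \<le> t * ?p" .
  qed
  have i1: "integrable M (\<lambda>\<omega>. indicat_real ?A \<omega> *\<^sub>R (1::complex))"
    by (rule integrable_const_bound[where B=1]) (auto simp: indicator_def)
  have i2: "integrable M (\<lambda>\<omega>. indicat_real ?A \<omega> *\<^sub>R iexp (\<xi> \<bullet> (Y t \<omega> - at_time T \<omega>)))"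
    by (rule integrable_const_bound[where B=1]) (auto simp: indicator_def)
  have i3: "integrable M (\<lambda>\<omega>. indicat_real ?A \<omega> *\<^sub>R complex_of_real (exp (- (t - ?r \<omega>) * ?p)))"
    by (rule integrable_const_bound[where B=1]) (use ex in \<open>auto simp: indicator_def\<close>)
  have "(\<integral>\<omega>. indicat_real ?A \<omega> *\<^sub>R iexp (\<xi> \<bullet> (Y t \<omega> - at_time T \<omega>)) \<partial>M)
      = (\<integral>\<omega>. indicat_real ?A \<omega> *\<^sub>R complex_of_real (exp (- (t - ?r \<omega>) * ?p)) \<partial>M)"
  proof -
    have "(\<integral>\<omega>. indicat_real ?A \<omega> *\<^sub>R iexp (\<xi> \<bullet> (Y t \<omega> - at_time T \<omega>)) \<partial>M)
       = (\<integral>\<omega>. (if T \<omega> < ereal t then iexp (0 \<bullet> at_time T \<omega>) * iexp (\<xi> \<bullet> (Y t \<omega> - at_time T \<omega>)) else 0) \<partial>M)"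
      by (intro Bochner_Integration.integral_cong refl) (auto simp: indicator_def)
    also have "\<dots> = (\<integral>\<omega>. (if T \<omega> < ereal t then iexp (0 \<bullet> at_time T \<omega>)
               * complex_of_real (exp (- (t - ?r \<omega>) * ?p)) else 0) \<partial>M)"
      using strong_markov[OF T, of t "\<lambda>_. t" 0 \<xi>] by (simp add: mono_def)
    also have "\<dots> = (\<integral>\<omega>. indicat_real ?A \<omega> *\<^sub>R complex_of_real (exp (- (t - ?r \<omega>) * ?p)) \<partial>M)"
      by (intro Bochner_Integration.integral_cong refl) (auto simp: indicator_def)
    finally show ?thesis .
  qed
  then have "(LINT \<omega>:?A|M. 1 - iexp (\<xi> \<bullet> (Y t \<omega> - at_time T \<omega>)))
      = (\<integral>\<omega>. indicat_real ?A \<omega> *\<^sub>R complex_of_real (1 - exp (- (t - ?r \<omega>) * ?p)) \<partial>M)"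
    unfolding set_lebesgue_integral_def of_real_diff scaleR_diff_right using i1 i2 i3 by simp
  also have "norm \<dots> \<le> (\<integral>\<omega>. norm (indicat_real ?A \<omega> *\<^sub>R complex_of_real (1 - exp (- (t - ?r \<omega>) * ?p))) \<partial>M)"
    by (rule integral_norm_bound)
  also have "\<dots> \<le> (\<integral>\<omega>. indicat_real ?A \<omega> * (t * ?p) \<partial>M)"
  proof (rule integral_mono')
    fix \<omega>
    show "norm (indicat_real ?A \<omega> *\<^sub>R complex_of_real (1 - exp (- (t - ?r \<omega>) * ?p))) \<le> indicat_real ?A \<omega> * (t * ?p)"
      using ex[of \<omega>] by (cases "\<omega> \<in> ?A") (simp_all only: norm_scaleR norm_of_real indicator_simps, simp_all)
    show "0 \<le> indicat_real ?A \<omega> * (t * ?p)" using t by simp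
    show "integrable M (\<lambda>\<omega>. indicat_real ?A \<omega> * (t * ?p))"
      by (intro integrable_mult_left integrable_real_indicator) (auto simp: less_top[symmetric])
  qed
  also have "\<dots> = t * prob ?A * ?p" by simp
  finally show "norm (LINT \<omega>:?A|M. 1 - iexp (\<xi> \<bullet> (Y t \<omega> - at_time T \<omega>))) \<le> t * prob ?A * ?p" .
qed

lemma prob_displacement_after:
  assumes T: "optional T" and t: "0 \<le> t" and \<epsilon>: "\<epsilon> > 0"
  shows "prob {\<omega>\<in>space M. T \<omega> < ereal t \<and> \<epsilon> \<le> norm (Y t \<omega> - at_time T \<omega>)} * (1 - exp (- \<epsilon>\<^sup>2 / 2))
     \<le> t * prob {\<omega>\<in>space M. T \<omega> < ereal t} * gauss_moment TYPE('a) \<alpha>"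
proof -
  note [measurable] = optional_measurable[OF T] optional_real_measurable[OF T]
  have [measurable]: "Y t \<in> borel_measurable M" using t by simp
  have "{\<omega>\<in>space M. T \<omega> < ereal t \<and> \<epsilon> \<le> norm (Y t \<omega> - at_time T \<omega>)}
      = {\<omega>\<in>space M. \<omega> \<in> {\<omega>\<in>space M. T \<omega> < ereal t} \<and> \<epsilon> \<le> norm (Y t \<omega> - at_time T \<omega>)}" by auto
  then show ?thesis
    using measure_norm_ge_le[OF finite_measure_axioms, of "\<lambda>\<omega>. Y t \<omega> - at_time T \<omega>" "{\<omega>\<in>space M. T \<omega> < ereal t}" \<epsilon>]
      displacement_after_gauss[OF T t] \<epsilon> by simp
qed


end

section \<open>Quasi-left-continuity\<close>

text \<open>Left limits at points just after \<open>t\<close> are limits of values of the path just after \<open>t\<close>.\<close>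

lemma cadlag_left_lim_tendsto_right:
  fixes w :: "real \<Rightarrow> 'a::metric_space"
  assumes w: "cadlag w" and t: "0 \<le> t" and u: "u \<longlonglongrightarrow> t" "\<And>n. t < u n"
  shows "(\<lambda>n. left_lim w (u n)) \<longlonglongrightarrow> w t"
proof (rule metric_LIMSEQ_I)
  fix e :: real assume e: "e > 0"
  have "(w \<longlongrightarrow> w t) (at_right t)" using w t by (simp add: cadlag_def)
  then have "\<forall>\<^sub>F s in at_right t. dist (w s) (w t) < e / 2"
    using e by (intro tendstoD) auto
  then obtain b where b: "b > t" "\<And>s. t < s \<Longrightarrow> s < b \<Longrightarrow> dist (w s) (w t) < e / 2"
    unfolding eventually_at_right_field by auto
  have le: "dist (left_lim w s) (w t) \<le> e / 2" if s: "t < s" "s < b" for s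
  proof (rule tendsto_upperbound)
    show "((\<lambda>v. dist (w v) (w t)) \<longlongrightarrow> dist (left_lim w s) (w t)) (at_left s)"
      using s t by (intro tendsto_intros cadlag_at_left[OF w]) auto
    show "\<forall>\<^sub>F v in at_left s. dist (w v) (w t) \<le> e / 2"
      unfolding eventually_at_left_field using s b(2) by (intro exI[of _ t]) (auto simp: less_imp_le)
  qed simp
  obtain N where "\<And>n. n \<ge> N \<Longrightarrow> u n < b"
    using order_tendstoD(2)[OF u(1) b(1)] unfolding eventually_sequentially by auto
  then show "\<exists>N. \<forall>n\<ge>N. dist (left_lim w (u n)) (w t) < e"
    using le u(2) e by (intro exI[of _ N] allI impI) (smt (verit) field_sum_of_halves)
qed

context stable_motion
begin

text \<open>
  Let \<open>T n\<close> increase to \<open>S\<close>. Over a period \<open>\<delta>\<close> after the optional time \<open>T n\<close> the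
  character of the displacement averages to \<open>exp (- \<delta> * norm \<xi> powr \<alpha>)\<close>. Letting \<open>n\<close> tend
  to infinity and then \<open>\<delta>\<close> to \<open>0\<close>, the displacement becomes the difference of \<open>Y S\<close> and
  the limit of \<open>Y (T n)\<close>, while the average tends to \<open>1\<close>; so this difference vanishes
  almost surely. Where all \<open>T n\<close> are smaller than \<open>S\<close>, it is the jump at \<open>S\<close>.
\<close>

theorem quasi_left_continuity:
  assumes T: "\<And>n. optional (T n)" and inc: "\<And>n \<omega>. \<omega> \<in> space M \<Longrightarrow> T n \<omega> \<le> T (Suc n) \<omega>"
    and lim: "\<And>\<omega>. \<omega> \<in> space M \<Longrightarrow> (\<lambda>n. T n \<omega>) \<longlonglongrightarrow> S \<omega>"
  shows "AE \<omega> in M. S \<omega> < \<infinity> \<longrightarrow> (\<forall>n. T n \<omega> < S \<omega>) \<longrightarrow>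
           left_lim (\<lambda>t. Y t \<omega>) (real_of_ereal (S \<omega>)) = Y (real_of_ereal (S \<omega>)) \<omega>"
proof -
  define \<tau> where "\<tau> n \<omega> = real_of_ereal (T n \<omega>)" for n \<omega>
  define \<sigma> where "\<sigma> \<omega> = real_of_ereal (S \<omega>)" for \<omega>
  have Tm[measurable]: "T n \<in> borel_measurable M" for n using T by (rule optional_measurable)
  have \<tau>m[measurable]: "\<tau> n \<in> borel_measurable M" for n unfolding \<tau>_def by measurable
  have T0: "0 \<le> T n \<omega>" if "\<omega> \<in> space M" for n \<omega> using optional_nonneg[OF T that] .
  have \<tau>0: "0 \<le> \<tau> n \<omega>" if "\<omega> \<in> space M" for n \<omega>
    using T0[OF that] unfolding \<tau>_def by (rule real_of_ereal_pos)
  have TS: "T n \<omega> \<le> S \<omega>" if "\<omega> \<in> space M" for n \<omega>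
    using incseq_le[OF incseq_SucI lim[OF that], of n] inc[OF that] by simp
  define L where "L K = {\<omega>\<in>space M. \<forall>n. T n \<omega> < ereal (real K)}" for K :: nat
  have Lm[measurable]: "L K \<in> events" for K unfolding L_def by measurable
  have fin: "S \<omega> = ereal (\<sigma> \<omega>)" "T n \<omega> = ereal (\<tau> n \<omega>)" "\<tau> n \<omega> \<le> \<sigma> \<omega>" "(\<lambda>n. \<tau> n \<omega>) \<longlonglongrightarrow> \<sigma> \<omega>" "0 \<le> \<sigma> \<omega>"
    if \<omega>: "\<omega> \<in> space M" and S: "S \<omega> < \<infinity>" for \<omega> n
  proof -
    have S0: "0 \<le> S \<omega>" using T0[OF \<omega>] TS[OF \<omega>] order_trans by blast
    show Se: "S \<omega> = ereal (\<sigma> \<omega>)" using S0 S unfolding \<sigma>_def by (cases "S \<omega>") auto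
    show Te: "T n \<omega> = ereal (\<tau> n \<omega>)" for n
      using T0[OF \<omega>, of n] TS[OF \<omega>, of n] Se unfolding \<tau>_def by (cases "T n \<omega>") auto
    show "\<tau> n \<omega> \<le> \<sigma> \<omega>" using TS[OF \<omega>, of n] by (simp add: Se Te)
    show "(\<lambda>n. \<tau> n \<omega>) \<longlonglongrightarrow> \<sigma> \<omega>" using lim[OF \<omega>] by (simp add: Se Te)
    show "0 \<le> \<sigma> \<omega>" using S0 by (simp add: Se)
  qed
  have L_fin: "S \<omega> < \<infinity>" if "\<omega> \<in> L K" for \<omega> K
  proof -
    have "S \<omega> \<le> ereal (real K)"
      by (rule LIMSEQ_le_const2[OF lim]) (use that in \<open>auto simp: L_def less_imp_le\<close>)
    then show ?thesis by (cases "S \<omega>") auto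
  qed
  have L_space: "\<omega> \<in> space M" if "\<omega> \<in> L K" for \<omega> K using that by (simp add: L_def)
  \<comment> \<open>The limit of the path along \<open>T n + \<delta>\<close>.\<close>
  define Z where "Z \<delta> \<omega> = (if \<forall>n. T n \<omega> < S \<omega> then left_lim (\<lambda>t. Y t \<omega>) (\<sigma> \<omega> + \<delta>) else Y (\<sigma> \<omega> + \<delta>) \<omega>)" for \<delta> \<omega>
  have Z_lim: "(\<lambda>n. Y (\<tau> n \<omega> + \<delta>) \<omega>) \<longlonglongrightarrow> Z \<delta> \<omega>" if \<omega>: "\<omega> \<in> space M" "S \<omega> < \<infinity>" and \<delta>: "0 \<le> \<delta>" for \<delta> \<omega>
  proof (cases "\<forall>n. T n \<omega> < S \<omega>")
    case True
    then have lt: "\<tau> n \<omega> < \<sigma> \<omega>" for n using fin[OF \<omega>] by (metis less_ereal.simps(1))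
    have "(\<lambda>n. Y (\<tau> n \<omega> + \<delta>) \<omega>) \<longlonglongrightarrow> left_lim (\<lambda>t. Y t \<omega>) (\<sigma> \<omega> + \<delta>)"
    proof (rule cadlag_tendsto_left[OF Y_cadlag[OF \<omega>(1)]])
      show "0 < \<sigma> \<omega> + \<delta>" using lt[of 0] \<tau>0[OF \<omega>(1), of 0] \<delta> by linarith
      show "(\<lambda>n. \<tau> n \<omega> + \<delta>) \<longlonglongrightarrow> \<sigma> \<omega> + \<delta>" by (intro tendsto_intros fin \<omega>)
    qed (use lt in auto)
    then show ?thesis using True by (simp add: Z_def)
  next
    case False
    then obtain N where "S \<omega> \<le> T N \<omega>" by (auto simp: not_less)
    have eq: "\<tau> n \<omega> = \<sigma> \<omega>" if "n \<ge> N" for n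
    proof -
      have "T N \<omega> \<le> T n \<omega>" using lift_Suc_mono_le[of "\<lambda>n. T n \<omega>"] inc[OF \<omega>(1)] that by blast
      then have "T n \<omega> = S \<omega>" using \<open>S \<omega> \<le> T N \<omega>\<close> TS[OF \<omega>(1), of n] by order
      then show ?thesis using fin[OF \<omega>] by (metis ereal.inject)
    qed
    have "\<forall>\<^sub>F n in sequentially. Y (\<tau> n \<omega> + \<delta>) \<omega> = Y (\<sigma> \<omega> + \<delta>) \<omega>"
      unfolding eventually_sequentially by (rule exI[of _ N]) (simp add: eq)
    moreover have "Z \<delta> \<omega> = Y (\<sigma> \<omega> + \<delta>) \<omega>"
      using False by (auto simp: Z_def)
    ultimately show ?thesis by (simp add: tendsto_eventually)
  qed
  have Yt_meas[measurable]: "(\<lambda>\<omega>. Y (\<tau> n \<omega> + \<delta>) \<omega>) \<in> borel_measurable M" if "0 \<le> \<delta>" for n \<delta>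
    using \<tau>0 that by (intro Y_random_time_measurable) auto
  have indZ_meas: "(\<lambda>\<omega>. indicat_real (L K) \<omega> *\<^sub>R Z \<delta> \<omega>) \<in> borel_measurable M" if "0 \<le> \<delta>" for K \<delta>
  proof (rule borel_measurable_LIMSEQ_metric)
    show "(\<lambda>\<omega>. indicat_real (L K) \<omega> *\<^sub>R Y (\<tau> n \<omega> + \<delta>) \<omega>) \<in> borel_measurable M" for n
      using Yt_meas[OF that] by measurable
    show "(\<lambda>n. indicat_real (L K) \<omega> *\<^sub>R Y (\<tau> n \<omega> + \<delta>) \<omega>) \<longlonglongrightarrow> indicat_real (L K) \<omega> *\<^sub>R Z \<delta> \<omega>" for \<omega>
      using Z_lim[OF _ _ that] L_fin L_space by (cases "\<omega> \<in> L K") auto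
  qed
  \<comment> \<open>The events \<open>T n < K\<close> decrease to \<open>L K\<close>, on which \<open>S\<close> is at most \<open>K\<close>.\<close>
  have indL: "(\<lambda>n. indicat_real {\<omega>\<in>space M. T n \<omega> < ereal (real K)} \<omega>) \<longlonglongrightarrow> indicat_real (L K) \<omega>"
    if \<omega>: "\<omega> \<in> space M" for \<omega> K
  proof (cases "\<omega> \<in> L K")
    case True then show ?thesis by (simp add: L_def indicator_def)
  next
    case False
    then obtain N where N: "\<not> T N \<omega> < ereal (real K)" using \<omega> by (auto simp: L_def)
    have "\<not> T n \<omega> < ereal (real K)" if "n \<ge> N" for n
      using lift_Suc_mono_le[of "\<lambda>n. T n \<omega>", OF _ that] inc[OF \<omega>] N by (meson order.strict_trans1)
    then have "\<forall>\<^sub>F n in sequentially. indicat_real {\<omega>\<in>space M. T n \<omega> < ereal (real K)} \<omega> = 0"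
      unfolding eventually_sequentially by (intro exI[of _ N]) (auto simp: indicator_def)
    then show ?thesis using False by (simp add: tendsto_eventually)
  qed
  have step: "(LINT \<omega>:L K|M. iexp (\<xi> \<bullet> (Z \<delta> \<omega> - Z 0 \<omega>))) = complex_of_real (prob (L K) * exp (- \<delta> * norm \<xi> powr \<alpha>))"
    if \<delta>: "0 \<le> \<delta>" for K \<delta> and \<xi> :: 'a
  proof -
    let ?A = "\<lambda>n. {\<omega>\<in>space M. T n \<omega> < ereal (real K)}"
    let ?e = "complex_of_real (exp (- \<delta> * norm \<xi> powr \<alpha>))"
    note [measurable] = Yt_meas[OF \<delta>] Yt_meas[of 0, OF order_refl, simplified]
    have sm: "(\<integral>\<omega>. indicat_real (?A n) \<omega> *\<^sub>R iexp (\<xi> \<bullet> (Y (\<tau> n \<omega> + \<delta>) \<omega> - Y (\<tau> n \<omega>) \<omega>)) \<partial>M)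
        = (\<integral>\<omega>. indicat_real (?A n) \<omega> *\<^sub>R ?e \<partial>M)" for n
    proof -
      have "(\<integral>\<omega>. indicat_real (?A n) \<omega> *\<^sub>R iexp (\<xi> \<bullet> (Y (\<tau> n \<omega> + \<delta>) \<omega> - Y (\<tau> n \<omega>) \<omega>)) \<partial>M)
        = (\<integral>\<omega>. (if T n \<omega> < ereal (real K) then iexp (0 \<bullet> at_time (T n) \<omega>)
               * iexp (\<xi> \<bullet> (Y (real_of_ereal (T n \<omega>) + \<delta>) \<omega> - at_time (T n) \<omega>)) else 0) \<partial>M)"
        by (intro Bochner_Integration.integral_cong refl) (auto simp: indicator_def \<tau>_def at_time_def)
      also have "\<dots> = (\<integral>\<omega>. (if T n \<omega> < ereal (real K) then iexp (0 \<bullet> at_time (T n) \<omega>)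
               * complex_of_real (exp (- ((real_of_ereal (T n \<omega>) + \<delta>) - real_of_ereal (T n \<omega>)) * norm \<xi> powr \<alpha>)) else 0) \<partial>M)"
        by (rule strong_markov[OF T, where \<rho>="\<lambda>s. s + \<delta>"])
           (use \<delta> in \<open>auto simp: mono_def intro!: continuous_intros\<close>)
      also have "\<dots> = (\<integral>\<omega>. indicat_real (?A n) \<omega> *\<^sub>R ?e \<partial>M)"
        by (intro Bochner_Integration.integral_cong refl) (auto simp: indicator_def)
      finally show ?thesis .
    qed
    have Lexp: "(\<lambda>n. indicat_real (?A n) \<omega> *\<^sub>R iexp (\<xi> \<bullet> (Y (\<tau> n \<omega> + \<delta>) \<omega> - Y (\<tau> n \<omega>) \<omega>)))
        \<longlonglongrightarrow> indicat_real (L K) \<omega> *\<^sub>R iexp (\<xi> \<bullet> (Z \<delta> \<omega> - Z 0 \<omega>))" if \<omega>: "\<omega> \<in> space M" for \<omega>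
    proof (cases "\<omega> \<in> L K")
      case True
      show ?thesis
        using Z_lim[OF \<omega> L_fin[OF True] \<delta>] Z_lim[OF \<omega> L_fin[OF True], of 0]
        by (intro tendsto_intros indL[OF \<omega>]) simp_all
    next
      case False
      show ?thesis
      proof (rule tendsto_norm_zero_cancel[THEN tendsto_eq_rhs])
        show "(\<lambda>n. norm (indicat_real (?A n) \<omega> *\<^sub>R iexp (\<xi> \<bullet> (Y (\<tau> n \<omega> + \<delta>) \<omega> - Y (\<tau> n \<omega>) \<omega>)))) \<longlonglongrightarrow> 0"
          using indL[OF \<omega>, of K] False by simp
      qed (use False in simp)
    qed
    have "(\<lambda>n. \<integral>\<omega>. indicat_real (?A n) \<omega> *\<^sub>R iexp (\<xi> \<bullet> (Y (\<tau> n \<omega> + \<delta>) \<omega> - Y (\<tau> n \<omega>) \<omega>)) \<partial>M)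
        \<longlonglongrightarrow> (\<integral>\<omega>. indicat_real (L K) \<omega> *\<^sub>R iexp (\<xi> \<bullet> (Z \<delta> \<omega> - Z 0 \<omega>)) \<partial>M)"
    proof (rule integral_dominated_convergence[where w="\<lambda>_. 1"])
      show "(\<lambda>\<omega>. indicat_real (L K) \<omega> *\<^sub>R iexp (\<xi> \<bullet> (Z \<delta> \<omega> - Z 0 \<omega>))) \<in> borel_measurable M"
        by (rule borel_measurable_LIMSEQ_metric[OF _ Lexp]) measurable
    qed (use Lexp in \<open>auto simp: indicator_def\<close>)
    moreover have "(\<lambda>n. \<integral>\<omega>. indicat_real (?A n) \<omega> *\<^sub>R ?e \<partial>M) \<longlonglongrightarrow> (\<integral>\<omega>. indicat_real (L K) \<omega> *\<^sub>R ?e \<partial>M)"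
    proof (rule integral_dominated_convergence[where w="\<lambda>_. 1"])
      show "AE \<omega> in M. (\<lambda>n. indicat_real (?A n) \<omega> *\<^sub>R ?e) \<longlonglongrightarrow> indicat_real (L K) \<omega> *\<^sub>R ?e"
        using indL by (intro AE_I2 tendsto_intros) auto
      show "AE \<omega> in M. norm (indicat_real (?A n) \<omega> *\<^sub>R ?e) \<le> 1" for n
        using \<delta> by (intro AE_I2) (simp add: indicator_def)
    qed auto
    ultimately have "(\<integral>\<omega>. indicat_real (L K) \<omega> *\<^sub>R iexp (\<xi> \<bullet> (Z \<delta> \<omega> - Z 0 \<omega>)) \<partial>M) = (\<integral>\<omega>. indicat_real (L K) \<omega> *\<^sub>R ?e \<partial>M)"
      unfolding sm by (rule LIMSEQ_unique)
    then show ?thesis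
      unfolding set_lebesgue_integral_def by (simp add: scaleR_conv_of_real less_top[symmetric])
  qed
  have Y_meas: "(\<lambda>\<omega>. indicat_real (L K) \<omega> *\<^sub>R (Y (\<sigma> \<omega>) \<omega> - Z 0 \<omega>)) \<in> borel_measurable M"
    and char: "(LINT \<omega>:L K|M. iexp (\<xi> \<bullet> (indicat_real (L K) \<omega> *\<^sub>R (Y (\<sigma> \<omega>) \<omega> - Z 0 \<omega>)))) = complex_of_real (prob (L K))"
    for K and \<xi> :: 'a
  proof -
    let ?d = "\<lambda>m. 1 / real (Suc m)"
    have d: "?d \<longlonglongrightarrow> 0"
      using LIMSEQ_inverse_real_of_nat by (simp add: inverse_eq_divide)
    have Zd: "(\<lambda>m. Z (?d m) \<omega>) \<longlonglongrightarrow> Y (\<sigma> \<omega>) \<omega>" if \<omega>: "\<omega> \<in> L K" for \<omega>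
    proof -
      note f = fin[OF L_space[OF \<omega>] L_fin[OF \<omega>]]
      have s: "(\<lambda>m. \<sigma> \<omega> + ?d m) \<longlonglongrightarrow> \<sigma> \<omega>" using tendsto_add[OF tendsto_const d] by simp
      show ?thesis
      proof (cases "\<forall>n. T n \<omega> < S \<omega>")
        case True
        then show ?thesis
          using cadlag_left_lim_tendsto_right[OF Y_cadlag[OF L_space[OF \<omega>]] f(5) s] by (simp add: Z_def)
      next
        case False
        then show ?thesis
          unfolding Z_def if_not_P[OF False]
          using cadlag_tendsto_right[OF Y_cadlag[OF L_space[OF \<omega>]] f(5) s] by simp
      qed
    qed
    have Vm: "(\<lambda>\<omega>. indicat_real (L K) \<omega> *\<^sub>R (Z (?d m) \<omega> - Z 0 \<omega>)) \<in> borel_measurable M" for m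
      using indZ_meas[of "?d m" K] indZ_meas[of 0 K] unfolding scaleR_diff_right by measurable
    have Vlim: "(\<lambda>m. indicat_real (L K) \<omega> *\<^sub>R (Z (?d m) \<omega> - Z 0 \<omega>)) \<longlonglongrightarrow> indicat_real (L K) \<omega> *\<^sub>R (Y (\<sigma> \<omega>) \<omega> - Z 0 \<omega>)" for \<omega>
      using Zd by (cases "\<omega> \<in> L K") (auto intro!: tendsto_intros)
    show Ym: "(\<lambda>\<omega>. indicat_real (L K) \<omega> *\<^sub>R (Y (\<sigma> \<omega>) \<omega> - Z 0 \<omega>)) \<in> borel_measurable M"
      by (rule borel_measurable_LIMSEQ_metric[OF Vm Vlim])
    have gen: "(\<lambda>\<omega>. indicat_real (L K) \<omega> *\<^sub>R iexp (\<xi> \<bullet> W \<omega>)) \<in> borel_measurable M"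
      if [measurable]: "W \<in> borel_measurable M" for W by measurable
    have "(\<lambda>m. \<integral>\<omega>. indicat_real (L K) \<omega> *\<^sub>R iexp (\<xi> \<bullet> (indicat_real (L K) \<omega> *\<^sub>R (Z (?d m) \<omega> - Z 0 \<omega>))) \<partial>M)
       \<longlonglongrightarrow> (\<integral>\<omega>. indicat_real (L K) \<omega> *\<^sub>R iexp (\<xi> \<bullet> (indicat_real (L K) \<omega> *\<^sub>R (Y (\<sigma> \<omega>) \<omega> - Z 0 \<omega>))) \<partial>M)"
    proof (rule integral_dominated_convergence[where w="\<lambda>_. 1"])
      show "AE \<omega> in M. (\<lambda>m. indicat_real (L K) \<omega> *\<^sub>R iexp (\<xi> \<bullet> (indicat_real (L K) \<omega> *\<^sub>R (Z (?d m) \<omega> - Z 0 \<omega>))))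
         \<longlonglongrightarrow> indicat_real (L K) \<omega> *\<^sub>R iexp (\<xi> \<bullet> (indicat_real (L K) \<omega> *\<^sub>R (Y (\<sigma> \<omega>) \<omega> - Z 0 \<omega>)))"
        by (intro AE_I2 tendsto_intros Vlim)
      show "AE \<omega> in M. norm (indicat_real (L K) \<omega> *\<^sub>R iexp (\<xi> \<bullet> (indicat_real (L K) \<omega> *\<^sub>R (Z (?d m) \<omega> - Z 0 \<omega>)))) \<le> 1" for m
        by (simp add: indicator_def)
    qed (rule gen[OF Ym] gen[OF Vm] integrable_const)+
    moreover have "(\<integral>\<omega>. indicat_real (L K) \<omega> *\<^sub>R iexp (\<xi> \<bullet> (indicat_real (L K) \<omega> *\<^sub>R (Z (?d m) \<omega> - Z 0 \<omega>))) \<partial>M)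
        = complex_of_real (prob (L K) * exp (- ?d m * norm \<xi> powr \<alpha>))" for m
    proof -
      have "(\<integral>\<omega>. indicat_real (L K) \<omega> *\<^sub>R iexp (\<xi> \<bullet> (indicat_real (L K) \<omega> *\<^sub>R (Z (?d m) \<omega> - Z 0 \<omega>))) \<partial>M)
         = (\<integral>\<omega>. indicat_real (L K) \<omega> *\<^sub>R iexp (\<xi> \<bullet> (Z (?d m) \<omega> - Z 0 \<omega>)) \<partial>M)"
        by (intro Bochner_Integration.integral_cong refl) (simp add: indicator_def)
      then show ?thesis using step[of "?d m" K \<xi>] by (simp add: set_lebesgue_integral_def)
    qed
    moreover have "(\<lambda>m. complex_of_real (prob (L K) * exp (- ?d m * norm \<xi> powr \<alpha>))) \<longlonglongrightarrow> complex_of_real (prob (L K) * exp (- 0 * norm \<xi> powr \<alpha>))"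
      by (intro tendsto_intros d)
    ultimately show "(LINT \<omega>:L K|M. iexp (\<xi> \<bullet> (indicat_real (L K) \<omega> *\<^sub>R (Y (\<sigma> \<omega>) \<omega> - Z 0 \<omega>)))) = complex_of_real (prob (L K))"
      unfolding set_lebesgue_integral_def using LIMSEQ_unique by fastforce
  qed
  have "AE \<omega> in M. \<omega> \<in> L K \<longrightarrow> indicat_real (L K) \<omega> *\<^sub>R (Y (\<sigma> \<omega>) \<omega> - Z 0 \<omega>) = 0" for K
    by (rule AE_zero_if_iexp_one[OF finite_measure_axioms Y_meas Lm char])
  then have "AE \<omega> in M. \<forall>K. \<omega> \<in> L K \<longrightarrow> indicat_real (L K) \<omega> *\<^sub>R (Y (\<sigma> \<omega>) \<omega> - Z 0 \<omega>) = 0"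
    unfolding AE_all_countable by blast
  then show ?thesis
  proof (rule AE_mp, intro AE_I2 impI)
    fix \<omega>
    assume \<omega>: "\<omega> \<in> space M" and *: "\<forall>K. \<omega> \<in> L K \<longrightarrow> indicat_real (L K) \<omega> *\<^sub>R (Y (\<sigma> \<omega>) \<omega> - Z 0 \<omega>) = 0"
      and S: "S \<omega> < \<infinity>" and all: "\<forall>n. T n \<omega> < S \<omega>"
    obtain K :: nat where "S \<omega> < ereal (real K)" using S less_PInf_Ex_of_nat by auto
    then have "\<omega> \<in> L K" using \<omega> TS[OF \<omega>] by (auto simp: L_def intro: le_less_trans)
    then have "Y (\<sigma> \<omega>) \<omega> = Z 0 \<omega>" using * by auto
    then show "left_lim (\<lambda>t. Y t \<omega>) (real_of_ereal (S \<omega>)) = Y (real_of_ereal (S \<omega>)) \<omega>"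
      using all by (simp add: Z_def \<sigma>_def)
  qed
qed

corollary no_fixed_jump:
  assumes t: "0 < t"
  shows "AE \<omega> in M. left_lim (\<lambda>t. Y t \<omega>) t = Y t \<omega>"
proof -
  let ?T = "\<lambda>(n::nat) (\<omega>::'w). ereal (t - t / Suc n)"
  have "AE \<omega> in M. ereal t < \<infinity> \<longrightarrow> (\<forall>n. ?T n \<omega> < ereal t) \<longrightarrow>
           left_lim (\<lambda>t. Y t \<omega>) (real_of_ereal (ereal t)) = Y (real_of_ereal (ereal t)) \<omega>"
  proof (rule quasi_left_continuity)
    show "optional (?T n)" for n
      using t by (intro optional_const) (simp add: field_simps)
    show "?T n \<omega> \<le> ?T (Suc n) \<omega>" for n \<omega>
      using t by (simp add: field_simps)
    have "(\<lambda>n. t - t * inverse (real (Suc n))) \<longlonglongrightarrow> t - t * 0"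
      by (intro tendsto_intros LIMSEQ_inverse_real_of_nat)
    then show "(\<lambda>n. ?T n \<omega>) \<longlonglongrightarrow> ereal t" for \<omega>
      by (simp add: divide_inverse)
  qed
  then show ?thesis using t by simp
qed

end

section \<open>Hitting times of jump relations\<close>

text \<open>
  The shot-down time, and up to a null set the exit time, is the first time at which the
  pair of the left limit and the value of the path satisfies some relation \<open>R\<close>. Both are
  handled at once.
\<close>

definition jump_times :: "('a::t2_space \<times> 'a) set \<Rightarrow> (real \<Rightarrow> 'a) \<Rightarrow> real set" where
  "jump_times R w = {t. t > 0 \<and> (left_lim w t, w t) \<in> R}"

definition hit_time :: "('a::t2_space \<times> 'a) set \<Rightarrow> (real \<Rightarrow> 'a) \<Rightarrow> ereal" where
  "hit_time R w = Inf (ereal ` jump_times R w)"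

text \<open>
  The diagonal condition, together with closedness of \<open>R\<close>, makes the set of hitting times
  closed: near a time \<open>s\<close>, pairs of values of the path accumulate at \<open>(left_lim w s, w s)\<close>
  and at the two diagonal points.
\<close>

definition jump_closed :: "('a::metric_space \<times> 'a) set \<Rightarrow> bool" where
  "jump_closed R \<longleftrightarrow> closed R \<and> (\<forall>a b. (a, a) \<in> R \<longrightarrow> (a, b) \<in> R \<and> (b, a) \<in> R)"

text \<open>
  Pairs of values at times near \<open>s\<close>, in temporal order, are close to one of three pairs
  made of the left limit and the value at \<open>s\<close>. None of the three is in \<open>R\<close>, by the
  diagonal condition.
\<close>

lemma cadlag_locally_avoids:
  fixes w :: "real \<Rightarrow> 'a::metric_space"
  assumes R: "jump_closed R" and w: "cadlag w" and s: "0 \<le> s"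
    and no: "s > 0 \<Longrightarrow> (left_lim w s, w s) \<notin> R" "s = 0 \<Longrightarrow> (w 0, w 0) \<notin> R"
  obtains d e where "d > 0" "e > 0"
    "\<And>q r. 0 \<le> q \<Longrightarrow> q \<le> r \<Longrightarrow> \<bar>q - s\<bar> < d \<Longrightarrow> \<bar>r - s\<bar> < d \<Longrightarrow> ball (w q, w r) e \<inter> R = {}"
proof -
  define l where "l = left_lim w s"
  have Rc: "open (- R)" using R by (auto simp: jump_closed_def)
  have "(l, w s) \<notin> R"
    using no s by (cases "s = 0") (auto simp: l_def left_lim_def)
  then have notR: "(l, w s) \<notin> R" "(l, l) \<notin> R" "(w s, w s) \<notin> R"
    using R unfolding jump_closed_def by blast+
  have "\<exists>e>0. ball p e \<subseteq> - R" if "p \<notin> R" for p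
    using Rc that open_contains_ball by blast
  then obtain e1 e2 e3 where e: "e1 > 0" "ball (l, w s) e1 \<subseteq> - R" "e2 > 0" "ball (l, l) e2 \<subseteq> - R"
      "e3 > 0" "ball (w s, w s) e3 \<subseteq> - R"
    using notR by meson
  define e where "e = min e1 (min e2 e3) / 4"
  have e0: "e > 0" using e by (simp add: e_def)
  have "\<forall>\<^sub>F v in at_right s. dist (w v) (w s) < e"
    using w s e0 by (intro tendstoD) (auto simp: cadlag_def)
  then obtain b where b: "b > s" "\<And>v. s < v \<Longrightarrow> v < b \<Longrightarrow> dist (w v) (w s) < e"
    unfolding eventually_at_right_field by auto
  have "\<exists>a<s. \<forall>v. 0 \<le> v \<and> a < v \<and> v < s \<longrightarrow> dist (w v) l < e"
  proof (cases "s = 0")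
    case True then show ?thesis by (intro exI[of _ "-1"]) auto
  next
    case False
    then have "\<forall>\<^sub>F v in at_left s. dist (w v) l < e"
      using cadlag_at_left[OF w, of s] s e0 unfolding l_def by (intro tendstoD) auto
    then show ?thesis
      unfolding eventually_at_left_field by auto
  qed
  then obtain a where a: "a < s" "\<And>v. 0 \<le> v \<Longrightarrow> a < v \<Longrightarrow> v < s \<Longrightarrow> dist (w v) l < e" by blast
  define d where "d = min (b - s) (s - a)"
  have d0: "d > 0" using a b by (simp add: d_def)
  have side: "dist (w v) (w s) < e" if "\<bar>v - s\<bar> < d" "s \<le> v" for v
    using that b e0 by (cases "v = s") (auto simp: d_def)
  have side': "dist (w v) l < e" if "\<bar>v - s\<bar> < d" "v < s" "0 \<le> v" for v
    using that a(2)[of v] by (auto simp: d_def)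
  have near: "ball (w q, w r) e \<inter> R = {}"
    if p: "p = (l, w s) \<or> p = (l, l) \<or> p = (w s, w s)" and q: "dist (w q) (fst p) < e" and r: "dist (w r) (snd p) < e" for p q r
  proof -
    have "dist (w q, w r) p \<le> dist (w q) (fst p) + dist (w r) (snd p)"
      by (cases p) (simp add: dist_Pair_Pair sqrt_sum_squares_le_sum)
    then have dp: "dist (w q, w r) p < 2 * e" using q r by simp
    have "ball p (4 * e) \<subseteq> - R"
      using p e by (auto simp: e_def)
    moreover have "ball (w q, w r) e \<subseteq> ball p (4 * e)"
    proof
      fix x assume "x \<in> ball (w q, w r) e"
      then show "x \<in> ball p (4 * e)"
        using dp dist_triangle[of p x "(w q, w r)"] e0 by (simp add: dist_commute)
    qed
    ultimately show ?thesis by blast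
  qed
  show ?thesis
  proof (rule that[OF d0 e0])
    fix q r assume qr: "0 \<le> q" "q \<le> r" "\<bar>q - s\<bar> < d" "\<bar>r - s\<bar> < d"
    consider "s \<le> q" | "q < s" "s \<le> r" | "r < s" using qr by linarith
    then show "ball (w q, w r) e \<inter> R = {}"
    proof cases
      case 1 then show ?thesis using near[of "(w s, w s)" q r] side[of q] side[of r] qr by auto
    next
      case 2 then show ?thesis using near[of "(l, w s)" q r] side'[of q] side[of r] qr by auto
    next
      case 3 then show ?thesis using near[of "(l, l)" q r] side'[of q] side'[of r] qr by auto
    qed
  qed
qed

lemma cadlag_locally_no_jump:
  fixes w :: "real \<Rightarrow> 'a::metric_space"
  assumes R: "jump_closed R" and w: "cadlag w" and s: "0 \<le> s"
    and no: "s > 0 \<Longrightarrow> (left_lim w s, w s) \<notin> R" "s = 0 \<Longrightarrow> (w 0, w 0) \<notin> R"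
  obtains d where "d > 0" "\<And>t. \<bar>t - s\<bar> < d \<Longrightarrow> t \<notin> jump_times R w"
proof -
  obtain d e where de: "d > 0" "e > 0"
    "\<And>q r. 0 \<le> q \<Longrightarrow> q \<le> r \<Longrightarrow> \<bar>q - s\<bar> < d \<Longrightarrow> \<bar>r - s\<bar> < d \<Longrightarrow> ball (w q, w r) e \<inter> R = {}"
    using cadlag_locally_avoids[OF assms] by blast
  show ?thesis
  proof (rule that[OF de(1)], rule notI)
    fix t assume t: "\<bar>t - s\<bar> < d" and "t \<in> jump_times R w"
    then have t0: "t > 0" and tR: "(left_lim w t, w t) \<in> R" by (auto simp: jump_times_def)
    have "\<forall>\<^sub>F v in at_left t. dist (w v) (left_lim w t) < e"
      using cadlag_at_left[OF w t0] de(2) by (rule tendstoD)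
    then obtain a where a: "a < t" "\<And>v. a < v \<Longrightarrow> v < t \<Longrightarrow> dist (w v) (left_lim w t) < e"
      unfolding eventually_at_left_field by auto
    define m where "m = max 0 (max a (s - d))"
    have "m < t" using a(1) t t0 by (auto simp: m_def)
    then obtain v where v: "m < v" "v < t" using dense by blast
    have "ball (w v, w t) e \<inter> R = {}"
      by (rule de(3)) (use v t in \<open>auto simp: m_def\<close>)
    moreover have "(left_lim w t, w t) \<in> ball (w v, w t) e"
      using a(2)[of v] v by (simp add: m_def dist_Pair_Pair)
    ultimately show False using tR by blast
  qed
qed

text \<open>The set of hitting times is closed, by \<open>cadlag_locally_no_jump\<close>.\<close>

lemma hit_time_attained:
  fixes w :: "real \<Rightarrow> 'a::metric_space"
  assumes R: "jump_closed R" and w: "cadlag w" and w0: "(w 0, w 0) \<notin> R" and fin: "hit_time R w < \<infinity>"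
  obtains t where "hit_time R w = ereal t" "t \<in> jump_times R w" "\<And>s. s \<in> jump_times R w \<Longrightarrow> t \<le> s"
proof -
  let ?J = "jump_times R w"
  have ne: "?J \<noteq> {}" using fin by (auto simp: hit_time_def top_ereal_def)
  have bdd: "bdd_below ?J" by (rule bdd_belowI[of _ 0]) (auto simp: jump_times_def)
  define t where "t = Inf ?J"
  have eq: "hit_time R w = ereal t"
    unfolding hit_time_def t_def using ne bdd by (simp add: ereal_Inf')
  have t0: "0 \<le> t" unfolding t_def using ne by (intro cInf_greatest) (auto simp: jump_times_def)
  have lb: "t \<le> s" if "s \<in> ?J" for s unfolding t_def using that bdd by (rule cInf_lower)
  have "t \<in> ?J"
  proof (rule ccontr)
    assume "t \<notin> ?J"
    then obtain d where d: "d > 0" "\<And>s. \<bar>s - t\<bar> < d \<Longrightarrow> s \<notin> ?J"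
      using cadlag_locally_no_jump[OF R w t0] w0 by (auto simp: jump_times_def)
    obtain s where "s \<in> ?J" "s < t + d"
      using cInf_lessD[OF ne, of "t + d"] d(1) unfolding t_def by auto
    then show False using lb[of s] d(2)[of s] by auto
  qed
  then show ?thesis using that eq lb by blast
qed

lemma hit_time_le: "t \<in> jump_times R w \<Longrightarrow> hit_time R w \<le> ereal t"
  unfolding hit_time_def by (intro Inf_lower) auto

lemma hit_time_nonneg: "0 \<le> hit_time R w"
  unfolding hit_time_def by (intro Inf_greatest) (auto simp: jump_times_def)

lemma hit_time_pos:
  fixes w :: "real \<Rightarrow> 'a::metric_space"
  assumes "jump_closed R" "cadlag w" "(w 0, w 0) \<notin> R"
  shows "0 < hit_time R w"
proof (cases "hit_time R w < \<infinity>")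
  case True
  then obtain t where "hit_time R w = ereal t" "t \<in> jump_times R w"
    using hit_time_attained[OF assms] by metis
  then show ?thesis by (simp add: jump_times_def)
qed (simp add: not_less)

text \<open>
  Countably many pairs of times up to \<open>u\<close> decide whether \<open>R\<close> has been hit, which makes
  the hitting time measurable without completing the probability space. Pairs of times
  that get closer and closer and at which the path nearly satisfies \<open>R\<close> accumulate at a
  time where \<open>R\<close> is hit, by \<open>cadlag_locally_avoids\<close>. The time \<open>u\<close> itself is needed as the
  second member of a pair if \<open>R\<close> is hit exactly at \<open>u\<close>.
\<close>

lemma hit_time_le_iff:
  fixes w :: "real \<Rightarrow> 'a::metric_space"
  assumes R: "jump_closed R" and w: "cadlag w" and w0: "(w 0, w 0) \<notin> R" and u: "0 \<le> u"
  shows "hit_time R w \<le> ereal u \<longleftrightarrow>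
    (\<forall>n::nat. \<exists>q\<in>\<rat> \<inter> {0..u}. \<exists>r\<in>insert u (\<rat> \<inter> {0..u}). q \<le> r \<and> r - q < 1 / Suc n \<and>
       (w q, w r) \<in> (\<Union>p\<in>R. ball p (1 / Suc n)))" (is "?l \<longleftrightarrow> (\<forall>n. ?P n)")
proof
  assume ?l
  then have "hit_time R w < \<infinity>" using le_less_trans[of _ "ereal u" \<infinity>] by simp
  then obtain s where s: "hit_time R w = ereal s" "s \<in> jump_times R w"
    using hit_time_attained[OF R w w0] by metis
  have su: "s \<le> u" "0 < s" and sR: "(left_lim w s, w s) \<in> R"
    using \<open>?l\<close> s by (auto simp: jump_times_def)
  show "\<forall>n. ?P n"
  proof
    fix n :: nat
    define e where "e = 1 / real (Suc n)"
    have e: "e > 0" by (simp add: e_def)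
    have "\<forall>\<^sub>F v in at_left s. dist (w v) (left_lim w s) < e / 2"
      using cadlag_at_left[OF w su(2)] by (rule tendstoD) (use e in simp)
    then obtain a where a: "a < s" "\<And>v. a < v \<Longrightarrow> v < s \<Longrightarrow> dist (w v) (left_lim w s) < e / 2"
      unfolding eventually_at_left_field by auto
    have "\<forall>\<^sub>F v in at_right s. dist (w v) (w s) < e / 2"
      using w su e by (intro tendstoD) (use w su e in \<open>auto simp: cadlag_def\<close>)
    then obtain b where b: "b > s" "\<And>v. s < v \<Longrightarrow> v < b \<Longrightarrow> dist (w v) (w s) < e / 2"
      unfolding eventually_at_right_field by auto
    obtain q where q: "q \<in> \<rat>" "max 0 (max a (s - e / 2)) < q" "q < s"
      using Rats_dense_in_real[of "max 0 (max a (s - e / 2))" s] a(1) su(2) e by (auto simp: less_max_iff_disj)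
    have "\<exists>r\<in>insert u (\<rat> \<inter> {0..u}). s \<le> r \<and> r < s + e / 2 \<and> dist (w r) (w s) < e / 2"
    proof (cases "s = u")
      case False
      then obtain r where "r \<in> \<rat>" "s < r" "r < min u (min b (s + e / 2))"
        using Rats_dense_in_real[of s "min u (min b (s + e / 2))"] su b e by auto
      then show ?thesis using b(2)[of r] su by (intro bexI[of _ r]) auto
    qed (use e in auto)
    then obtain r where r: "r \<in> insert u (\<rat> \<inter> {0..u})" "s \<le> r" "r < s + e / 2" "dist (w r) (w s) < e / 2"
      by blast
    have "dist (left_lim w s, w s) (w q, w r) \<le> dist (left_lim w s) (w q) + dist (w s) (w r)"
      by (simp add: dist_Pair_Pair sqrt_sum_squares_le_sum)
    also have "\<dots> < e / 2 + e / 2"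
      using a(2)[of q] q r(4) by (intro add_strict_mono) (auto simp: dist_commute simp del: of_nat_Suc)
    also have "\<dots> = e" by (rule field_sum_of_halves)
    finally have "(w q, w r) \<in> (\<Union>p\<in>R. ball p e)" using sR by auto
    moreover have "r - q < e / 2 + e / 2"
    proof -
      have "s - e / 2 < q" using q(2) by (simp del: of_nat_Suc)
      then show ?thesis using r(3) by linarith
    qed
    then have "r - q < e" by (simp only: field_sum_of_halves)
    ultimately have "\<exists>r\<in>insert u (\<rat> \<inter> {0..u}). q \<le> r \<and> r - q < e \<and> (w q, w r) \<in> (\<Union>p\<in>R. ball p e)"
      using q(3) r(2) by (intro bexI[OF _ r(1)] conjI) auto
    then show "?P n" unfolding e_def by (rule bexI) (use q su in auto)
  qed
next
  assume P: "\<forall>n. ?P n"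
  then obtain q r where qr: "\<And>n. q n \<in> \<rat> \<inter> {0..u}" "\<And>n. r n \<in> insert u (\<rat> \<inter> {0..u})"
     "\<And>n. q n \<le> r n" "\<And>n. r n - q n < 1 / Suc n" "\<And>n. (w (q n), w (r n)) \<in> (\<Union>p\<in>R. ball p (1 / Suc n))"
    by metis
  have "\<exists>l\<in>{0..u}. \<exists>f. strict_mono f \<and> (q \<circ> f) \<longlonglongrightarrow> l"
    using compact_Icc[of 0 u] qr(1) unfolding compact_def by (metis IntD2)
  then obtain s f where s: "s \<in> {0..u}" and f: "strict_mono f" and lim: "(\<lambda>n. q (f n)) \<longlonglongrightarrow> s"
    by (auto simp: o_def)
  have inv: "(\<lambda>n. 1 / real (Suc (f n))) \<longlonglongrightarrow> 0"
    using LIMSEQ_subseq_LIMSEQ[OF LIMSEQ_inverse_real_of_nat f] by (simp add: o_def inverse_eq_divide)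
  have diff: "(\<lambda>n. r (f n) - q (f n)) \<longlonglongrightarrow> 0"
    by (rule tendsto_sandwich[OF _ _ tendsto_const inv])
       (use qr(3,4) in \<open>auto intro!: always_eventually less_imp_le simp del: of_nat_Suc\<close>)
  have limr: "(\<lambda>n. r (f n)) \<longlonglongrightarrow> s"
    using tendsto_add[OF diff lim] by simp
  have "s \<in> jump_times R w"
  proof (rule ccontr)
    assume "s \<notin> jump_times R w"
    then obtain d e where de: "d > 0" "e > 0"
      "\<And>q r. 0 \<le> q \<Longrightarrow> q \<le> r \<Longrightarrow> \<bar>q - s\<bar> < d \<Longrightarrow> \<bar>r - s\<bar> < d \<Longrightarrow> ball (w q, w r) e \<inter> R = {}"
      using cadlag_locally_avoids[OF R w, of s] s w0 by (auto simp: jump_times_def)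
    have "\<forall>\<^sub>F n in sequentially. \<bar>q (f n) - s\<bar> < d"
      using tendstoD[OF lim de(1)] by (simp add: dist_real_def)
    moreover have "\<forall>\<^sub>F n in sequentially. \<bar>r (f n) - s\<bar> < d"
      using tendstoD[OF limr de(1)] by (simp add: dist_real_def)
    moreover have "\<forall>\<^sub>F n in sequentially. 1 / real (Suc (f n)) < e"
      using order_tendstoD(2)[OF inv de(2)] .
    ultimately have "\<forall>\<^sub>F n in sequentially. False"
    proof eventually_elim
      case (elim n)
      obtain p where p: "p \<in> R" "dist p (w (q (f n)), w (r (f n))) < 1 / real (Suc (f n))"
        using qr(5)[of "f n"] by (auto simp del: of_nat_Suc)
      then have "p \<in> ball (w (q (f n)), w (r (f n))) e"
        using elim(3) by (simp add: dist_commute)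
      moreover have "ball (w (q (f n)), w (r (f n))) e \<inter> R = {}"
        by (rule de(3)) (use elim qr(1,3) in auto)
      ultimately show ?case using p(1) by blast
    qed
    then show False by simp
  qed
  then show ?l using hit_time_le[of s R w] s by (auto intro: order_trans)
qed

lemma cadlag_add_const: "cadlag w \<Longrightarrow> cadlag (\<lambda>t. x + w t)"
  for w :: "real \<Rightarrow> 'a::real_normed_vector"
  unfolding cadlag_def using tendsto_add[OF tendsto_const[of x]] by metis

lemma left_lim_add_const:
  fixes w :: "real \<Rightarrow> 'a::real_normed_vector"
  assumes "cadlag w" "0 \<le> t"
  shows "left_lim (\<lambda>t. x + w t) t = x + left_lim w t"
proof (cases "t = 0")
  case False
  then have "((\<lambda>t. x + w t) \<longlongrightarrow> x + left_lim w t) (at_left t)"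
    using assms by (intro tendsto_intros cadlag_at_left) auto
  then show ?thesis
    using cadlag_at_left[OF cadlag_add_const[OF assms(1)], of t x] False assms(2)
    by (intro tendsto_unique[of "at_left t"]) auto
qed (simp add: left_lim_def)

context stable_motion
begin

definition path :: "'a \<Rightarrow> 'w \<Rightarrow> real \<Rightarrow> 'a" where
  "path x \<omega> t = x + Y t \<omega>"

lemma cadlag_path: "\<omega> \<in> space M \<Longrightarrow> cadlag (path x \<omega>)"
  unfolding path_def by (intro cadlag_add_const Y_cadlag)

lemma path_0: "\<omega> \<in> space M \<Longrightarrow> path x \<omega> 0 = x"
  by (simp add: path_def Y_zero)

theorem optional_hit_time:
  assumes R: "jump_closed R" and x: "(x, x) \<notin> R"
  shows "optional (\<lambda>\<omega>. hit_time R (path x \<omega>))"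
  unfolding optional_def
proof safe
  show "0 \<le> hit_time R (path x \<omega>)" for \<omega> by (rule hit_time_nonneg)
  interpret H: sigma_algebra "space M" "hist u" for u by (rule sigma_algebra_hist)
  have le: "{\<omega>\<in>space M. hit_time R (path x \<omega>) \<le> ereal v} \<in> hist v" if v: "0 \<le> v" for v
  proof -
    let ?U = "\<lambda>n. \<Union>p\<in>R. ball p (1 / real (Suc n))"
    have ev: "{\<omega>\<in>space M. (path x \<omega> q, path x \<omega> r) \<in> U} \<in> hist v"
      if q: "0 \<le> q" "q \<le> v" and r: "0 \<le> r" "r \<le> v" and U: "open U" for q r and U :: "('a \<times> 'a) set"
    proof -
      let ?N = "sigma (space M) (hist v)"
      have N: "sets ?N = hist v" "space ?N = space M" by (auto simp: H.sigma_sets_eq)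
      have m[measurable]: "Y s \<in> borel_measurable ?N" if "0 \<le> s" "s \<le> v" for s
        using hist_vimage[OF that] by (auto simp: measurable_def N)
      have "(\<lambda>\<omega>. (path x \<omega> q, path x \<omega> r)) \<in> ?N \<rightarrow>\<^sub>M borel \<Otimes>\<^sub>M borel"
        unfolding path_def using m[OF q] m[OF r] by measurable
      then have "(\<lambda>\<omega>. (path x \<omega> q, path x \<omega> r)) \<in> ?N \<rightarrow>\<^sub>M borel" by (simp add: borel_prod)
      from measurable_sets[OF this borel_open[OF U]] show ?thesis
        by (simp only: N vimage_def Int_def mem_Collect_eq conj_commute)
    qed
    have "{\<omega>\<in>space M. hit_time R (path x \<omega>) \<le> ereal v} = {\<omega>\<in>space M. \<forall>n::nat. \<exists>q\<in>\<rat> \<inter> {0..v}. \<exists>r\<in>insert v (\<rat> \<inter> {0..v}).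
         q \<le> r \<and> r - q < 1 / Suc n \<and> (path x \<omega> q, path x \<omega> r) \<in> ?U n}"
      by (intro Collect_cong conj_cong refl hit_time_le_iff[OF R cadlag_path _ v]) (use x in \<open>auto simp: path_0\<close>)
    also have "\<dots> = (\<Inter>n. \<Union>q\<in>\<rat> \<inter> {0..v}. \<Union>r\<in>{r\<in>insert v (\<rat> \<inter> {0..v}). q \<le> r \<and> r - q < 1 / real (Suc n)}.
         {\<omega>\<in>space M. (path x \<omega> q, path x \<omega> r) \<in> ?U n})"
      by (intro set_eqI, simp only: INT_iff UN_iff mem_Collect_eq, blast)
    also have "\<dots> \<in> hist v"
    proof (rule H.countable_INT, safe)
      fix n :: nat
      show "(\<Union>q\<in>\<rat> \<inter> {0..v}. \<Union>r\<in>{r\<in>insert v (\<rat> \<inter> {0..v}). q \<le> r \<and> r - q < 1 / real (Suc n)}.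
         {\<omega>\<in>space M. (path x \<omega> q, path x \<omega> r) \<in> ?U n}) \<in> hist v"
      proof (rule H.countable_UN')
        show "countable (\<rat> \<inter> {0..v})" using countable_rat by auto
        show "(\<lambda>q. \<Union>r\<in>{r\<in>insert v (\<rat> \<inter> {0..v}). q \<le> r \<and> r - q < 1 / real (Suc n)}.
         {\<omega>\<in>space M. (path x \<omega> q, path x \<omega> r) \<in> ?U n}) ` (\<rat> \<inter> {0..v}) \<subseteq> hist v"
        proof (rule image_subsetI, rule H.countable_UN')
          fix q assume q: "q \<in> \<rat> \<inter> {0..v}"
          show "countable {r\<in>insert v (\<rat> \<inter> {0..v}). q \<le> r \<and> r - q < 1 / real (Suc n)}"
            by (rule countable_subset[of _ "insert v \<rat>"]) (use countable_rat in auto)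
          show "(\<lambda>r. {\<omega>\<in>space M. (path x \<omega> q, path x \<omega> r) \<in> ?U n}) `
              {r\<in>insert v (\<rat> \<inter> {0..v}). q \<le> r \<and> r - q < 1 / real (Suc n)} \<subseteq> hist v"
            by (rule image_subsetI, rule ev) (use q v in auto)
        qed
      qed
    qed
    finally show ?thesis .
  qed
  show "{\<omega>\<in>space M. hit_time R (path x \<omega>) < ereal u} \<in> hist u" for u
  proof (cases "0 < u")
    case True
    have "{\<omega>\<in>space M. hit_time R (path x \<omega>) < ereal u} = (\<Union>n. {\<omega>\<in>space M. hit_time R (path x \<omega>) \<le> ereal (u - u / Suc n)})" (is "_ = (\<Union>n. ?A n)")
    proof safe
      fix \<omega> assume \<omega>: "\<omega> \<in> space M" and lt: "hit_time R (path x \<omega>) < ereal u"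
      obtain h where h: "hit_time R (path x \<omega>) = ereal h"
        using lt hit_time_nonneg[of R "path x \<omega>"] by (cases "hit_time R (path x \<omega>)") auto
      then have "0 < (u - h) / u" using lt True by simp
      then obtain n where "inverse (real (Suc n)) < (u - h) / u" using reals_Archimedean by blast
      then have "h \<le> u - u / Suc n" using True by (simp add: field_simps)
      then show "\<omega> \<in> (\<Union>n. ?A n)" using \<omega> h by auto
    next
      fix \<omega> n assume "hit_time R (path x \<omega>) \<le> ereal (u - u / real (Suc n))"
      also have "\<dots> < ereal u" using True by simp
      finally show "hit_time R (path x \<omega>) < ereal u" .
    qed
    moreover have "?A n \<in> hist u" for n
      by (rule subsetD[OF hist_mono le]) (use True in \<open>auto simp: field_simps\<close>)
    ultimately show ?thesis by auto
  next
    case False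
    then have "{\<omega>\<in>space M. hit_time R (path x \<omega>) < ereal u} = {}"
      by (auto simp: not_less intro: order_trans[OF _ hit_time_nonneg])
    then show ?thesis by (simp only: H.empty_sets)
  qed
qed

end

section \<open>Exit and shot-down times as hitting times\<close>

definition exit_rel :: "'a set \<Rightarrow> ('a \<times> 'a) set" where
  "exit_rel K = {(a, b). a \<in> K \<or> b \<in> K}"

definition segment_rel :: "'a::real_vector set \<Rightarrow> ('a \<times> 'a) set" where
  "segment_rel K = {(a, b). closed_segment a b \<inter> K \<noteq> {}}"

lemma jump_closed_exit_rel:
  assumes "closed K" shows "jump_closed (exit_rel K)"
proof -
  have "exit_rel K = K \<times> UNIV \<union> UNIV \<times> K" by (auto simp: exit_rel_def)
  then have "closed (exit_rel K)" using assms by (simp add: closed_Times closed_Un)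
  then show ?thesis by (auto simp: jump_closed_def exit_rel_def)
qed

lemma jump_closed_segment_rel:
  fixes K :: "'a::euclidean_space set"
  assumes K: "closed K" shows "jump_closed (segment_rel K)"
proof -
  have "closed (segment_rel K)"
    unfolding closed_sequential_limits
  proof safe
    fix z :: "nat \<Rightarrow> 'a \<times> 'a" and a b
    assume z: "\<forall>n. z n \<in> segment_rel K" and lim: "z \<longlonglongrightarrow> (a, b)"
    have "\<forall>n. \<exists>u. 0 \<le> u \<and> u \<le> 1 \<and> (1 - u) *\<^sub>R fst (z n) + u *\<^sub>R snd (z n) \<in> K"
    proof
      fix n
      from z have "closed_segment (fst (z n)) (snd (z n)) \<inter> K \<noteq> {}"
        by (auto simp: segment_rel_def case_prod_beta)
      then show "\<exists>u. 0 \<le> u \<and> u \<le> 1 \<and> (1 - u) *\<^sub>R fst (z n) + u *\<^sub>R snd (z n) \<in> K"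
        unfolding closed_segment_def by blast
    qed
    then obtain u where u: "\<And>n. u n \<in> {0..1}" "\<And>n. (1 - u n) *\<^sub>R fst (z n) + u n *\<^sub>R snd (z n) \<in> K"
      by (metis atLeastAtMost_iff)
    obtain l f where l: "l \<in> {0..1}" and f: "strict_mono f" and ul: "(u \<circ> f) \<longlonglongrightarrow> l"
      using compact_Icc[of "0::real" 1] u(1) unfolding compact_def by metis
    have zf: "(z \<circ> f) \<longlonglongrightarrow> (a, b)" using lim f by (rule LIMSEQ_subseq_LIMSEQ)
    have "(\<lambda>n. (1 - (u \<circ> f) n) *\<^sub>R fst ((z \<circ> f) n) + (u \<circ> f) n *\<^sub>R snd ((z \<circ> f) n)) \<longlonglongrightarrow> (1 - l) *\<^sub>R fst (a, b) + l *\<^sub>R snd (a, b)"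
      by (intro tendsto_intros ul tendsto_fst[OF zf] tendsto_snd[OF zf])
    then have "(1 - l) *\<^sub>R a + l *\<^sub>R b \<in> K"
      using K u(2) by (intro Lim_in_closed_set[of K _ sequentially]) auto
    then show "(a, b) \<in> segment_rel K"
      using l unfolding segment_rel_def closed_segment_def by auto
  qed
  then show ?thesis by (auto simp: jump_closed_def segment_rel_def)
qed

lemma shot_down_time_eq: "shot_down_time D w = hit_time (segment_rel (- D)) w"
  by (simp add: shot_down_time_def hit_time_def jump_times_def segment_rel_def)

text \<open>The segment of a jump between two points of a convex set stays in the set.\<close>

lemma segment_rel_eq_exit_rel:
  assumes "convex D" shows "segment_rel (- D) = exit_rel (- D)"
proof -
  have "closed_segment a b \<subseteq> D" if "a \<in> D" "b \<in> D" for a b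
    using assms that by (simp add: convex_contains_segment)
  then show ?thesis by (fastforce simp: segment_rel_def exit_rel_def)
qed

lemma hit_time_anti: "R \<subseteq> R' \<Longrightarrow> hit_time R' w \<le> hit_time R w"
  unfolding hit_time_def jump_times_def by (intro Inf_superset_mono image_mono) auto

text \<open>
  The relation of touching the closed \<open>d\<close>-neighbourhood of \<open>K\<close>. Its hitting times
  announce the exit.
\<close>

definition near_rel :: "'a::metric_space set \<Rightarrow> real \<Rightarrow> ('a \<times> 'a) set" where
  "near_rel K d = exit_rel {a. infdist a K \<le> d}"

lemma jump_closed_near_rel: "jump_closed (near_rel K d)"
  unfolding near_rel_def by (intro jump_closed_exit_rel closed_Collect_le continuous_intros)

lemma near_rel_mono: "d \<le> d' \<Longrightarrow> near_rel K d \<subseteq> near_rel K d'"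
  by (auto simp: near_rel_def exit_rel_def)

text \<open>
  At the limit of the hitting times of the shrinking neighbourhoods the path is at
  distance \<open>0\<close> from the closed set \<open>K\<close>, on the left if the limit is not attained. The
  radii start below the distance of the starting point from \<open>K\<close>, so that no neighbourhood
  is hit at time \<open>0\<close>.
\<close>

lemma near_hit_times_tendsto:
  fixes w :: "real \<Rightarrow> 'a::metric_space"
  assumes K: "closed K" "K \<noteq> {}" and w: "cadlag w" and w0: "infdist (w 0) K = \<delta>" "\<delta> > 0"
  shows "(\<lambda>n. hit_time (near_rel K (\<delta> / (n + 2))) w) \<longlonglongrightarrow> hit_time (exit_rel K) w"
proof -
  define \<rho> where "\<rho> n = \<delta> / real (n + 2)" for n :: nat
  define T where "T n = hit_time (near_rel K (\<rho> n)) w" for n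
  let ?S = "hit_time (exit_rel K) w"
  have \<rho>: "0 < \<rho> n" "\<rho> n < \<delta>" for n
    using w0 by (auto simp: \<rho>_def field_simps intro: add_pos_nonneg)
  have \<rho>0: "\<rho> \<longlonglongrightarrow> 0"
  proof -
    have "(\<lambda>n. \<delta> / real n) \<longlonglongrightarrow> 0" by (rule lim_const_over_n)
    then show ?thesis unfolding \<rho>_def by (rule LIMSEQ_ignore_initial_segment)
  qed
  have w0near: "(w 0, w 0) \<notin> near_rel K (\<rho> n)" for n
    using w0 \<rho>(2)[of n] by (auto simp: near_rel_def exit_rel_def)
  have inc: "incseq T"
    unfolding incseq_Suc_iff T_def
    by (intro allI hit_time_anti near_rel_mono) (use w0 in \<open>auto simp: \<rho>_def intro!: divide_left_mono\<close>)
  have TS: "T n \<le> ?S" for n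
    unfolding T_def by (rule hit_time_anti) (use \<rho>(1)[of n] in \<open>auto simp: near_rel_def exit_rel_def\<close>)
  define L where "L = (SUP n. T n)"
  have TL: "T \<longlonglongrightarrow> L" unfolding L_def using inc by (rule LIMSEQ_SUP)
  have T_le_L: "T n \<le> L" for n unfolding L_def by (rule SUP_upper) simp
  have LS: "L \<le> ?S" unfolding L_def using TS by (rule SUP_least)
  have "?S \<le> L"
  proof (cases "L < \<infinity>")
    case True
    have "\<exists>t. T n = ereal t \<and> t \<in> jump_times (near_rel K (\<rho> n)) w" for n
    proof -
      have "T n < \<infinity>" using T_le_L True by (rule le_less_trans)
      then show ?thesis
        using hit_time_attained[OF jump_closed_near_rel w w0near] unfolding T_def by metis
    qed
    then obtain \<tau> where \<tau>: "\<And>n. T n = ereal (\<tau> n)" "\<And>n. \<tau> n \<in> jump_times (near_rel K (\<rho> n)) w" by metis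
    have \<tau>0: "\<tau> n > 0" for n using \<tau>(2)[of n] by (simp add: jump_times_def)
    obtain l where l: "L = ereal l"
      using True T_le_L[of 0] \<tau>(1)[of 0] by (cases L) auto
    have \<tau>l: "\<tau> n \<le> l" for n using T_le_L[of n] by (simp add: \<tau> l)
    have \<tau>lim: "\<tau> \<longlonglongrightarrow> l" using TL by (simp add: \<tau>(1)[abs_def] l lim_ereal)
    have l0: "l > 0" using \<tau>0[of 0] \<tau>l[of 0] by linarith
    have near: "infdist (left_lim w (\<tau> n)) K \<le> \<rho> n \<or> infdist (w (\<tau> n)) K \<le> \<rho> n" for n
      using \<tau>(2)[of n] by (auto simp: jump_times_def near_rel_def exit_rel_def)
    have "left_lim w l \<in> K \<or> w l \<in> K"
    proof (cases "\<forall>n. \<tau> n < l")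
      case True
      \<comment> \<open>Left limits near \<open>K\<close> are replaced by values at slightly earlier times.\<close>
      have "\<exists>v. \<tau> n - 1 / Suc n < v \<and> v \<le> \<tau> n \<and> infdist (w v) K \<le> 2 * \<rho> n" for n
      proof (cases "infdist (w (\<tau> n)) K \<le> \<rho> n")
        case True
        then show ?thesis using \<rho>(1)[of n] by (intro exI[of _ "\<tau> n"]) auto
      next
        case False
        then have "infdist (left_lim w (\<tau> n)) K < 2 * \<rho> n" using near[of n] \<rho>(1)[of n] by linarith
        moreover have "((\<lambda>v. infdist (w v) K) \<longlongrightarrow> infdist (left_lim w (\<tau> n)) K) (at_left (\<tau> n))"
          by (intro tendsto_intros cadlag_at_left[OF w \<tau>0])
        ultimately have "\<forall>\<^sub>F v in at_left (\<tau> n). infdist (w v) K < 2 * \<rho> n"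
          by (rule order_tendstoD(2)[rotated])
        then obtain a where a: "a < \<tau> n" "\<And>v. a < v \<Longrightarrow> v < \<tau> n \<Longrightarrow> infdist (w v) K < 2 * \<rho> n"
          unfolding eventually_at_left_field by auto
        have "max a (\<tau> n - 1 / Suc n) < \<tau> n" using a(1) by simp
        then obtain v where "max a (\<tau> n - 1 / Suc n) < v" "v < \<tau> n" using dense by blast
        then show ?thesis using a(2)[of v] by (intro exI[of _ v]) auto
      qed
      then obtain v where v: "\<And>n. \<tau> n - 1 / Suc n < v n" "\<And>n. v n \<le> \<tau> n" "\<And>n. infdist (w (v n)) K \<le> 2 * \<rho> n"
        by metis
      have "(\<lambda>n. \<tau> n - 1 / Suc n) \<longlonglongrightarrow> l - 0"
        using tendsto_diff[OF \<tau>lim LIMSEQ_inverse_real_of_nat] by (simp add: inverse_eq_divide)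
      then have lower: "(\<lambda>n. \<tau> n - 1 / Suc n) \<longlonglongrightarrow> l" by (simp only: diff_zero)
      have "v \<longlonglongrightarrow> l"
        by (rule tendsto_sandwich[OF _ _ lower \<tau>lim])
           (intro always_eventually allI less_imp_le v(1), intro always_eventually allI v(2))
      moreover have "v n < l" for n using v(2)[of n] True by (auto intro: le_less_trans)
      ultimately have "(\<lambda>n. w (v n)) \<longlonglongrightarrow> left_lim w l"
        by (intro cadlag_tendsto_left[OF w l0])
      then have "(\<lambda>n. infdist (w (v n)) K) \<longlonglongrightarrow> infdist (left_lim w l) K"
        by (intro tendsto_intros)
      moreover have "(\<lambda>n. 2 * \<rho> n) \<longlonglongrightarrow> 2 * 0" by (intro tendsto_intros \<rho>0)
      ultimately have "infdist (left_lim w l) K \<le> 0"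
        using v(3) by (intro LIMSEQ_le[where Y="\<lambda>n. 2 * \<rho> n"]) auto
      then have "left_lim w l \<in> K"
        using in_closed_iff_infdist_zero[OF K, of "left_lim w l"] infdist_nonneg[of "left_lim w l" K] by linarith
      then show ?thesis ..
    next
      case False
      then obtain N where "\<tau> N = l" using \<tau>l by (auto simp: not_less intro: antisym)
      have eq: "\<tau> n = l" if "n \<ge> N" for n
      proof -
        have "T N \<le> T n" using inc that by (rule incseqD)
        then show ?thesis using \<tau>(1) \<tau>l[of n] \<open>\<tau> N = l\<close> by simp
      qed
      show ?thesis
      proof (rule ccontr)
        assume "\<not> ?thesis"
        then have "infdist (left_lim w l) K > 0" "infdist (w l) K > 0"
          using in_closed_iff_infdist_zero[OF K] infdist_nonneg by (metis less_eq_real_def)+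
        then have "0 < min (infdist (left_lim w l) K) (infdist (w l) K)" by simp
        from order_tendstoD(2)[OF \<rho>0 this] obtain N' where "\<And>n. n \<ge> N' \<Longrightarrow> \<rho> n < min (infdist (left_lim w l) K) (infdist (w l) K)"
          unfolding eventually_sequentially by auto
        from this[of "max N N'"] near[of "max N N'"] eq[of "max N N'"] show False by simp
      qed
    qed
    then have "l \<in> jump_times (exit_rel K) w"
      using l0 by (simp add: jump_times_def exit_rel_def)
    then show ?thesis unfolding l by (rule hit_time_le)
  qed (simp add: not_less)
  then have "L = ?S" using LS by (rule antisym[rotated])
  then show ?thesis using TL unfolding T_def \<rho>_def by (simp add: add.commute)
qed

text \<open>
  The two times differ only if the left limit is in the complement and the value is not.
  In that case the neighbourhoods are hit strictly earlier, so quasi-left-continuity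
  forbids a jump. The second part, that the path has left \<open>D\<close> at that time, bounds from
  below the distance it must cover to return.
\<close>

lemma (in stable_motion) AE_exit_time_eq:
  assumes K: "open D" "- D \<noteq> {}" and x: "x \<in> D"
  shows "AE \<omega> in M. exit_time D (path x \<omega>) = hit_time (exit_rel (- D)) (path x \<omega>) \<and>
     (hit_time (exit_rel (- D)) (path x \<omega>) < \<infinity> \<longrightarrow>
        path x \<omega> (real_of_ereal (hit_time (exit_rel (- D)) (path x \<omega>))) \<in> - D)"
proof -
  let ?K = "- D"
  let ?S = "\<lambda>\<omega>. hit_time (exit_rel ?K) (path x \<omega>)"
  have Kc: "closed ?K" using K by auto
  define \<delta> where "\<delta> = infdist x ?K"
  have \<delta>: "\<delta> > 0"
    using x K in_closed_iff_infdist_zero[OF Kc K(2), of x] infdist_nonneg[of x ?K] by (auto simp: \<delta>_def less_le)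
  let ?\<rho> = "\<lambda>n. \<delta> / (real n + 2)"
  let ?T = "\<lambda>n \<omega>. hit_time (near_rel ?K (?\<rho> n)) (path x \<omega>)"
  have \<rho>: "0 < ?\<rho> n" "?\<rho> n < \<delta>" for n :: nat
    using \<delta> by (auto simp: field_simps intro: add_pos_nonneg)
  have "AE \<omega> in M. ?S \<omega> < \<infinity> \<longrightarrow> (\<forall>n. ?T n \<omega> < ?S \<omega>) \<longrightarrow>
           left_lim (\<lambda>t. Y t \<omega>) (real_of_ereal (?S \<omega>)) = Y (real_of_ereal (?S \<omega>)) \<omega>"
  proof (rule quasi_left_continuity)
    show "optional (?T n)" for n
      by (rule optional_hit_time[OF jump_closed_near_rel])
         (use \<rho>(2)[of n] in \<open>auto simp: near_rel_def exit_rel_def \<delta>_def\<close>)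
    show "?T n \<omega> \<le> ?T (Suc n) \<omega>" for n \<omega>
      by (intro hit_time_anti near_rel_mono) (use \<delta> in \<open>auto intro!: divide_left_mono\<close>)
    show "(\<lambda>n. ?T n \<omega>) \<longlonglongrightarrow> ?S \<omega>" if "\<omega> \<in> space M" for \<omega>
      using near_hit_times_tendsto[OF Kc K(2) cadlag_path[OF that] _ \<delta>, of x] path_0[OF that]
      by (simp add: \<delta>_def add.commute)
  qed
  then show ?thesis
  proof (rule AE_mp, intro AE_I2 impI)
    fix \<omega> assume \<omega>: "\<omega> \<in> space M"
      and q: "?S \<omega> < \<infinity> \<longrightarrow> (\<forall>n. ?T n \<omega> < ?S \<omega>) \<longrightarrow>
           left_lim (\<lambda>t. Y t \<omega>) (real_of_ereal (?S \<omega>)) = Y (real_of_ereal (?S \<omega>)) \<omega>"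
    let ?w = "path x \<omega>"
    note w = cadlag_path[OF \<omega>, of x]
    have le: "?S \<omega> \<le> exit_time D ?w"
      unfolding hit_time_def exit_time_def jump_times_def
      by (intro Inf_superset_mono image_mono) (auto simp: exit_rel_def)
    have "exit_time D ?w \<le> ?S \<omega> \<and> (?S \<omega> < \<infinity> \<longrightarrow> ?w (real_of_ereal (?S \<omega>)) \<in> ?K)"
    proof (cases "?S \<omega> < \<infinity>")
      case True
      have "(?w 0, ?w 0) \<notin> exit_rel ?K" using x path_0[OF \<omega>] by (simp add: exit_rel_def)
      then obtain s where s: "?S \<omega> = ereal s" "s \<in> jump_times (exit_rel ?K) ?w"
        using hit_time_attained[OF jump_closed_exit_rel[OF Kc] w _ True] by metis
      have s0: "s > 0" and or: "left_lim ?w s \<in> ?K \<or> ?w s \<in> ?K"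
        using s(2) by (auto simp: jump_times_def exit_rel_def)
      have "?w s \<in> ?K"
      proof (rule ccontr)
        assume not: "?w s \<notin> ?K"
        then have ll: "left_lim ?w s \<in> ?K" using or by blast
        have "?T n \<omega> < ?S \<omega>" for n
        proof -
          have "((\<lambda>v. infdist (?w v) ?K) \<longlongrightarrow> infdist (left_lim ?w s) ?K) (at_left s)"
            by (intro tendsto_intros cadlag_at_left[OF w s0])
          then have "\<forall>\<^sub>F v in at_left s. infdist (?w v) ?K < ?\<rho> n"
            by (rule order_tendstoD(2)) (use ll \<rho>(1)[of n] in simp)
          then obtain a where a: "a < s" "\<And>v. a < v \<Longrightarrow> v < s \<Longrightarrow> infdist (?w v) ?K < ?\<rho> n"
            unfolding eventually_at_left_field by auto
          obtain v where v: "max 0 a < v" "v < s" using dense[of "max 0 a" s] a(1) s0 by auto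
          have "v \<in> jump_times (near_rel ?K (?\<rho> n)) ?w"
            using v a(2)[of v] by (auto simp: jump_times_def near_rel_def exit_rel_def)
          then have "?T n \<omega> \<le> ereal v" by (rule hit_time_le)
          also have "\<dots> < ?S \<omega>" using v s(1) by simp
          finally show ?thesis .
        qed
        then have "left_lim (\<lambda>t. Y t \<omega>) s = Y s \<omega>" using q True s(1) by simp
        then have "left_lim ?w s = ?w s"
          using left_lim_add_const[OF Y_cadlag[OF \<omega>], of s x] s0 unfolding path_def by simp
        then show False using ll not by simp
      qed
      moreover from this have "exit_time D ?w \<le> ereal s"
        unfolding exit_time_def using s0 by (intro Inf_lower) auto
      ultimately show ?thesis using s(1) by simp
    qed (simp add: not_less)
    then show "exit_time D ?w = ?S \<omega> \<and> (?S \<omega> < \<infinity> \<longrightarrow> ?w (real_of_ereal (?S \<omega>)) \<in> ?K)"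
      using le by auto
  qed
qed

section \<open>The transition density and the stopped kernels\<close>

text \<open>
  A power series term of sufficiently high order shows that \<open>exp (c * \<bar>u\<bar> powr \<alpha>)\<close>
  dominates \<open>1 + u\<^sup>2\<close> up to a constant.
\<close>

lemma integrable_exp_minus_powr:
  fixes \<alpha> c :: real
  assumes \<alpha>: "0 < \<alpha>" and c: "0 < c"
  shows "integrable lborel (\<lambda>u::real. exp (- c * \<bar>u\<bar> powr \<alpha>))"
proof -
  \<comment> \<open>The \<open>k\<close>-th power of \<open>\<bar>u\<bar> powr \<alpha>\<close> is then at least \<open>u\<^sup>2\<close> outside the unit interval.\<close>
  obtain k :: nat where k: "2 / \<alpha> \<le> real k" using real_arch_simple by blast
  then have k2: "2 \<le> \<alpha> * real k" using \<alpha> by (simp add: field_simps)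
  define K where "K = 2 + 2 * fact k / c ^ k"
  have int: "integrable lborel (\<lambda>u::real. K * inverse (1 + u\<^sup>2))"
    using integrable_inverse_1_plus_square
    by (intro integrable_mult_right) (simp add: set_integrable_def einterval_def)
  show ?thesis
  proof (rule Bochner_Integration.integrable_bound[OF int])
    show "AE u in lborel. norm (exp (- c * \<bar>u\<bar> powr \<alpha>)) \<le> norm (K * inverse (1 + u\<^sup>2))"
    proof (rule AE_I2)
      fix u :: real
      let ?e = "exp (c * \<bar>u\<bar> powr \<alpha>)"
      have e1: "1 \<le> ?e" using c by simp
      have K0: "K \<ge> 2" using c by (simp add: K_def)
      have "1 + u\<^sup>2 \<le> K * ?e"
      proof (cases "\<bar>u\<bar> \<le> 1")
        case True
        then have "u\<^sup>2 \<le> 1" by (simp add: abs_square_le_1)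
        then have "1 + u\<^sup>2 \<le> 2 * 1" by simp
        also have "\<dots> \<le> K * ?e" using K0 e1 by (intro mult_mono) auto
        finally show ?thesis .
      next
        case False
        then have u: "1 \<le> \<bar>u\<bar>" by simp
        have "1 + u\<^sup>2 \<le> 2 * \<bar>u\<bar>\<^sup>2" using u power_mono[OF u, of 2] by simp
        also have "\<bar>u\<bar>\<^sup>2 = \<bar>u\<bar> powr 2" using u by (simp add: powr_numeral)
        also have "\<bar>u\<bar> powr 2 \<le> \<bar>u\<bar> powr (\<alpha> * real k)" using u k2 by (intro powr_mono)
        also have "\<bar>u\<bar> powr (\<alpha> * real k) = (\<bar>u\<bar> powr \<alpha>) ^ k"
          using u by (simp add: powr_powr[symmetric] powr_realpow)
        also have "2 * (\<bar>u\<bar> powr \<alpha>) ^ k = 2 * fact k / c ^ k * ((c * \<bar>u\<bar> powr \<alpha>) ^ k / fact k)"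
          using c by (simp add: power_mult_distrib)
        also have "\<dots> \<le> 2 * fact k / c ^ k * ?e"
        proof (rule mult_left_mono)
          have "(c * \<bar>u\<bar> powr \<alpha>) ^ k / fact k = (\<Sum>n\<in>{k}. (c * \<bar>u\<bar> powr \<alpha>) ^ n /\<^sub>R fact n)"
            by (simp add: divide_inverse)
          also have "\<dots> \<le> (\<Sum>n. (c * \<bar>u\<bar> powr \<alpha>) ^ n /\<^sub>R fact n)"
            using c by (intro sum_le_suminf summable_exp_generic) auto
          finally show "(c * \<bar>u\<bar> powr \<alpha>) ^ k / fact k \<le> ?e" by (simp add: exp_def)
        qed (use c in auto)
        also have "\<dots> \<le> K * ?e" using e1 by (intro mult_right_mono) (auto simp: K_def)
        finally show ?thesis by simp
      qed
      then have "inverse ?e \<le> K * inverse (1 + u\<^sup>2)"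
        using K0 by (simp add: field_simps add_pos_nonneg)
      then show "norm (exp (- c * \<bar>u\<bar> powr \<alpha>)) \<le> norm (K * inverse (1 + u\<^sup>2))"
        using K0 by (simp add: exp_minus abs_mult)
    qed
  qed measurable
qed

text \<open>
  Every coordinate is at most the norm, so the function is dominated by a product over
  the coordinates.
\<close>

lemma integrable_exp_minus_norm_powr:
  fixes \<alpha> s :: real
  assumes \<alpha>: "0 < \<alpha>" and s: "0 < s"
  shows "integrable lborel (\<lambda>\<xi>::'a::euclidean_space. exp (- s * norm \<xi> powr \<alpha>))"
proof -
  let ?c = "s / DIM('a)"
  let ?f = "\<lambda>(b::'a) u. complex_of_real (exp (- ?c * \<bar>u\<bar> powr \<alpha>))"
  have "integrable lborel (\<lambda>\<xi>::'a. \<Prod>b\<in>Basis. ?f b (\<xi> \<bullet> b))"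
    using \<alpha> s by (intro lborel_prod_Basis(1) integrable_of_real integrable_exp_minus_powr) auto
  then show ?thesis
  proof (rule Bochner_Integration.integrable_bound)
    show "AE \<xi> in lborel. norm (exp (- s * norm \<xi> powr \<alpha>)) \<le> norm (\<Prod>b\<in>Basis. ?f b (\<xi> \<bullet> b))"
    proof (rule AE_I2)
      fix \<xi> :: 'a
      have "(\<Sum>b\<in>Basis. \<bar>\<xi> \<bullet> b\<bar> powr \<alpha>) \<le> (\<Sum>b\<in>(Basis::'a set). norm \<xi> powr \<alpha>)"
        using \<alpha> by (intro sum_mono powr_mono2) (auto simp: Basis_le_norm)
      also have "\<dots> = DIM('a) * norm \<xi> powr \<alpha>" by simp
      finally have "?c * (\<Sum>b\<in>Basis. \<bar>\<xi> \<bullet> b\<bar> powr \<alpha>) \<le> ?c * (DIM('a) * norm \<xi> powr \<alpha>)"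
        using s by (intro mult_left_mono) auto
      also have "\<dots> = s * norm \<xi> powr \<alpha>" by simp
      finally have "exp (- s * norm \<xi> powr \<alpha>) \<le> exp (\<Sum>b\<in>Basis. - ?c * \<bar>\<xi> \<bullet> b\<bar> powr \<alpha>)"
        by (simp add: sum_distrib_left sum_negf)
      also have "\<dots> = norm (\<Prod>b\<in>Basis. ?f b (\<xi> \<bullet> b))"
        by (simp add: exp_sum flip: prod_norm)
      finally show "norm (exp (- s * norm \<xi> powr \<alpha>)) \<le> norm (\<Prod>b\<in>Basis. ?f b (\<xi> \<bullet> b))" by simp
    qed
  qed measurable
qed

lemma stable_density_measurable [measurable]:
  "(\<lambda>(s, z). stable_density \<alpha> s z) \<in> borel_measurable (borel \<Otimes>\<^sub>M (borel :: 'a::euclidean_space measure))"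
  unfolding stable_density_def by measurable

lemma stable_density_measurable' [measurable (raw)]:
  fixes g :: "'b \<Rightarrow> 'a::euclidean_space"
  assumes [measurable]: "f \<in> borel_measurable N" "g \<in> borel_measurable N"
  shows "(\<lambda>x. stable_density \<alpha> (f x) (g x)) \<in> borel_measurable N"
  using measurable_compose[OF _ stable_density_measurable, of "\<lambda>x. (f x, g x)" N \<alpha>] by simp

context stable_motion
begin

lemma fourier_distr_Y:
  assumes s: "0 \<le> s"
  shows "fourier (distr M borel (\<lambda>\<omega>. z + Y s \<omega>)) \<xi> = iexp (\<xi> \<bullet> z) * complex_of_real (exp (- s * norm \<xi> powr \<alpha>))"
proof -
  have [measurable]: "Y s \<in> borel_measurable M" using s by simp
  have "fourier (distr M borel (\<lambda>\<omega>. z + Y s \<omega>)) \<xi> = (\<integral>\<omega>. iexp (\<xi> \<bullet> (z + Y s \<omega>)) \<partial>M)"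
    unfolding fourier_def by (subst integral_distr) auto
  also have "\<dots> = (\<integral>\<omega>. iexp (\<xi> \<bullet> z) * iexp (\<xi> \<bullet> (Y s \<omega> - Y 0 \<omega>)) \<partial>M)"
    by (intro Bochner_Integration.integral_cong refl) (simp add: Y_zero inner_add_right ring_distribs exp_add)
  also have "\<dots> = iexp (\<xi> \<bullet> z) * complex_of_real (exp (- (s - 0) * norm \<xi> powr \<alpha>))"
    by (subst integral_mult_right_zero, subst Y_char) (use s in auto)
  finally show ?thesis by simp
qed

lemma
  assumes s: "0 < s"
  shows stable_density_nonneg: "0 \<le> stable_density \<alpha> s (y - z :: 'a)"
    and distr_Y_density: "distr M borel (\<lambda>\<omega>. z + Y s \<omega>) = density lborel (\<lambda>y. ennreal (stable_density \<alpha> s (y - z)))"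
proof -
  have [measurable]: "Y s \<in> borel_measurable M" using s by simp
  let ?N = "distr M borel (\<lambda>\<omega>. z + Y s \<omega>)"
  have N: "finite_measure ?N" "sets ?N = sets borel"
    using prob_space_distr[of "\<lambda>\<omega>. z + Y s \<omega>" borel] by (auto intro: prob_space.finite_measure)
  have f: "fourier ?N \<xi> = iexp (\<xi> \<bullet> z) * complex_of_real (exp (- s * norm \<xi> powr \<alpha>))" for \<xi>
    using s by (intro fourier_distr_Y) simp
  have int: "integrable lborel (fourier ?N)"
    by (rule Bochner_Integration.integrable_bound[OF integrable_exp_minus_norm_powr[OF alpha(1) s]])
       (auto simp: f norm_mult intro!: measurable_fourier N)
  have eq: "Re (\<integral>\<xi>. iexp (- (y \<bullet> \<xi>)) * fourier ?N \<xi> \<partial>lborel) / (2 * pi) ^ DIM('a) = stable_density \<alpha> s (y - z)" for y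
  proof -
    have "iexp (- (y \<bullet> \<xi>)) * fourier ?N \<xi> = exp (- \<i> * complex_of_real ((y - z) \<bullet> \<xi>)) * complex_of_real (exp (- s * norm \<xi> powr \<alpha>))" for \<xi>
      by (simp add: f inner_diff_left inner_commute[of \<xi> z] exp_diff exp_minus ring_distribs field_simps)
    then show ?thesis by (simp add: stable_density_def)
  qed
  show "0 \<le> stable_density \<alpha> s (y - z)"
    using fourier_inversion(1)[OF N int, of y] by (simp only: eq)
  show "?N = density lborel (\<lambda>y. ennreal (stable_density \<alpha> s (y - z)))"
    using fourier_inversion(2)[OF N int] by (simp only: eq)
qed

lemma integrable_stable_density:
  assumes s: "0 < s"
  shows "integrable lborel (\<lambda>y. stable_density \<alpha> s (y - z :: 'a))"
    and "(\<integral>y. stable_density \<alpha> s (y - z :: 'a) \<partial>lborel) = 1"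
proof -
  have [measurable]: "Y s \<in> borel_measurable M" using s by simp
  interpret N: prob_space "distr M borel (\<lambda>\<omega>. z + Y s \<omega>)" by (rule prob_space_distr) simp
  have "(\<integral>\<^sup>+y. ennreal (stable_density \<alpha> s (y - z :: 'a)) \<partial>lborel) = 1"
    using N.emeasure_space_1 unfolding distr_Y_density[OF s] by (simp add: emeasure_density)
  then have "has_bochner_integral lborel (\<lambda>y. stable_density \<alpha> s (y - z :: 'a)) 1"
    by (intro has_bochner_integral_nn_integral) (auto intro!: stable_density_nonneg[OF s])
  then show "integrable lborel (\<lambda>y. stable_density \<alpha> s (y - z :: 'a))"
    and "(\<integral>y. stable_density \<alpha> s (y - z :: 'a) \<partial>lborel) = 1"
    by (auto simp: has_bochner_integral_iff)
qed

lemma fourier_stable_density: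
  fixes z \<xi> :: 'a
  assumes s: "0 < s"
  shows "(\<integral>y. stable_density \<alpha> s (y - z) *\<^sub>R iexp (\<xi> \<bullet> y) \<partial>lborel) = iexp (\<xi> \<bullet> z) * complex_of_real (exp (- s * norm \<xi> powr \<alpha>))"
proof -
  have "(\<integral>y. stable_density \<alpha> s (y - z) *\<^sub>R iexp (\<xi> \<bullet> y) \<partial>lborel) = fourier (distr M borel (\<lambda>\<omega>. z + Y s \<omega>)) \<xi>"
    unfolding distr_Y_density[OF s] fourier_def
    by (subst integral_density) (auto intro!: stable_density_nonneg[OF s])
  then show ?thesis using s by (simp add: fourier_distr_Y)
qed

text \<open>
  The density at \<open>y\<close> of the position at time \<open>t\<close>, given the path up to a time \<open>T\<close> before
  \<open>t\<close>. Its expectation is what a stopped kernel subtracts from the free density.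
\<close>

definition density_after :: "('w \<Rightarrow> ereal) \<Rightarrow> real \<Rightarrow> 'a \<Rightarrow> 'w \<Rightarrow> 'a \<Rightarrow> real" where
  "density_after T t x \<omega> y =
     (if T \<omega> < ereal t then stable_density \<alpha> (t - real_of_ereal (T \<omega>)) (y - (x + at_time T \<omega>)) else 0)"

text \<open>
  Two finite measures are compared: the one with density the expectation of
  \<open>density_after\<close>, and the law of \<open>x + Y t\<close> on the event \<open>T < t\<close>. The strong Markov
  property for characters says that their Fourier transforms agree.
\<close>

theorem integral_density_after:
  assumes T: "optional T" and t: "0 \<le> t" and B[measurable]: "B \<in> sets borel"
  shows "integrable lborel (\<lambda>y. \<integral>\<omega>. density_after T t x \<omega> y \<partial>M)"
    and "(LINT y:B|lborel. (\<integral>\<omega>. density_after T t x \<omega> y \<partial>M))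
       = prob {\<omega>\<in>space M. T \<omega> < ereal t \<and> x + Y t \<omega> \<in> B}"
proof -
  note [measurable] = optional_measurable[OF T] optional_real_measurable[OF T]
  have [measurable]: "Y t \<in> borel_measurable M" using t by simp
  interpret P: pair_sigma_finite M "lborel :: 'a measure" by standard
  let ?G = "density_after T t x"
  let ?A = "{\<omega>\<in>space M. T \<omega> < ereal t}"
  let ?r = "\<lambda>\<omega>. real_of_ereal (T \<omega>)"
  have r: "0 < t - ?r \<omega>" if "\<omega> \<in> ?A" for \<omega>
    using that optional_nonneg[OF T, of \<omega>] by (cases "T \<omega>") auto
  have Gm[measurable]: "case_prod ?G \<in> borel_measurable (M \<Otimes>\<^sub>M lborel)"
    unfolding density_after_def by measurable
  have G0: "0 \<le> ?G \<omega> y" if "\<omega> \<in> space M" for \<omega> y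
    using stable_density_nonneg[OF r] that by (auto simp: density_after_def)
  have Gint: "integrable lborel (?G \<omega>)" "(\<integral>y. ?G \<omega> y \<partial>lborel) = indicat_real ?A \<omega>" if "\<omega> \<in> space M" for \<omega>
    using integrable_stable_density[OF r] that
    by (cases "T \<omega> < ereal t"; auto simp: density_after_def[abs_def])+
  have GP: "integrable (M \<Otimes>\<^sub>M lborel) (case_prod ?G)"
  proof (rule P.Fubini_integrable[OF Gm])
    have "integrable M (\<lambda>\<omega>. indicat_real ?A \<omega>)"
      by (rule integrable_const_bound[where B=1]) auto
    moreover have "(LBINT y. norm (case (\<omega>, y) of (\<omega>, y) \<Rightarrow> ?G \<omega> y)) = indicat_real ?A \<omega>" if "\<omega> \<in> space M" for \<omega>
      using Gint[OF that] G0[OF that] by simp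
    ultimately show "integrable M (\<lambda>\<omega>. LBINT y. norm (case (\<omega>, y) of (\<omega>, y) \<Rightarrow> ?G \<omega> y))"
      by (subst Bochner_Integration.integrable_cong[OF refl])
    show "AE \<omega> in M. integrable lborel (\<lambda>y. case (\<omega>, y) of (\<omega>, y) \<Rightarrow> ?G \<omega> y)"
      using Gint by auto
  qed
  show "integrable lborel (\<lambda>y. \<integral>\<omega>. ?G \<omega> y \<partial>M)"
    by (rule P.integrable_snd[OF GP])
  have G0P: "AE p in M \<Otimes>\<^sub>M lborel. 0 \<le> case_prod ?G p"
    using G0 by (intro AE_I2) (auto simp: space_pair_measure)
  define N1 where "N1 = distr (density (M \<Otimes>\<^sub>M lborel) (\<lambda>p. ennreal (case_prod ?G p))) (borel :: 'a measure) snd"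
  define N2 where "N2 = distr (density M (\<lambda>\<omega>. ennreal (indicat_real ?A \<omega>))) borel (\<lambda>\<omega>. x + Y t \<omega>)"
  have sets: "sets N1 = sets borel" "sets N2 = sets borel" by (auto simp: N1_def N2_def)
  have int1: "integral\<^sup>L N1 h = (\<integral>p. case_prod ?G p *\<^sub>R h (snd p) \<partial>(M \<Otimes>\<^sub>M lborel))"
    if [measurable]: "h \<in> borel_measurable borel" for h :: "'a \<Rightarrow> 'b::{banach, second_countable_topology}"
    unfolding N1_def by (subst integral_distr, simp, simp, subst integral_density) (use G0P in auto)
  have int2: "integral\<^sup>L N2 h = (\<integral>\<omega>. indicat_real ?A \<omega> *\<^sub>R h (x + Y t \<omega>) \<partial>M)"
    if [measurable]: "h \<in> borel_measurable borel" for h :: "'a \<Rightarrow> 'b::{banach, second_countable_topology}"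
    unfolding N2_def by (subst integral_distr, simp, simp, subst integral_density) auto
  have fin1: "finite_measure N1"
  proof
    have "emeasure N1 (space N1) = (\<integral>\<^sup>+p. ennreal (case_prod ?G p) \<partial>(M \<Otimes>\<^sub>M lborel))"
    proof -
      have "(\<lambda>p. ennreal (case_prod ?G p)) \<in> borel_measurable (M \<Otimes>\<^sub>M lborel)" by measurable
      from emeasure_density[OF this sets.top] show ?thesis
        unfolding N1_def by (subst emeasure_distr) (auto intro!: nn_integral_cong)
    qed
    also have "\<dots> < \<infinity>"
      using GP G0P by (subst nn_integral_eq_integral) auto
    finally show "emeasure N1 (space N1) \<noteq> \<infinity>" by simp
  qed
  have fin2: "finite_measure N2"
  proof
    have "emeasure N2 (space N2) = emeasure M ?A"
      unfolding N2_def by (subst emeasure_distr) (auto simp: emeasure_density ennreal_indicator)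
    then show "emeasure N2 (space N2) \<noteq> \<infinity>" by simp
  qed
  have "N1 = N2"
  proof (rule fourier_inj[OF fin1 sets(1) fin2 sets(2)])
    fix \<xi> :: 'a
    have GPi: "integrable (M \<Otimes>\<^sub>M lborel) (\<lambda>(\<omega>, y). ?G \<omega> y *\<^sub>R iexp (\<xi> \<bullet> y))"
      by (rule Bochner_Integration.integrable_bound[OF GP]) auto
    have "fourier N1 \<xi> = (\<integral>(\<omega>, y). ?G \<omega> y *\<^sub>R iexp (\<xi> \<bullet> y) \<partial>(M \<Otimes>\<^sub>M lborel))"
      unfolding fourier_def by (subst int1) (auto simp: split_beta')
    also have "\<dots> = (\<integral>\<omega>. (\<integral>y. ?G \<omega> y *\<^sub>R iexp (\<xi> \<bullet> y) \<partial>lborel) \<partial>M)"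
      by (rule P.integral_fst[OF GPi, symmetric])
    also have "\<dots> = (\<integral>\<omega>. iexp (\<xi> \<bullet> x) * (if T \<omega> < ereal t then iexp (\<xi> \<bullet> at_time T \<omega>)
               * complex_of_real (exp (- (t - ?r \<omega>) * norm \<xi> powr \<alpha>)) else 0) \<partial>M)"
    proof (intro Bochner_Integration.integral_cong refl)
      fix \<omega> assume "\<omega> \<in> space M"
      then show "(\<integral>y. ?G \<omega> y *\<^sub>R iexp (\<xi> \<bullet> y) \<partial>lborel) = iexp (\<xi> \<bullet> x) * (if T \<omega> < ereal t then iexp (\<xi> \<bullet> at_time T \<omega>)
               * complex_of_real (exp (- (t - ?r \<omega>) * norm \<xi> powr \<alpha>)) else 0)"
        using fourier_stable_density[OF r, of \<omega> "x + at_time T \<omega>" \<xi>]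
        by (simp add: density_after_def inner_add_right ring_distribs exp_add)
    qed
    also have "\<dots> = iexp (\<xi> \<bullet> x) * (\<integral>\<omega>. (if T \<omega> < ereal t then iexp (\<xi> \<bullet> at_time T \<omega>)
               * iexp (\<xi> \<bullet> (Y t \<omega> - at_time T \<omega>)) else 0) \<partial>M)"
      using strong_markov[OF T, of t "\<lambda>_. t" \<xi> \<xi>] by (simp add: mono_def)
    also have "\<dots> = (\<integral>\<omega>. indicat_real ?A \<omega> *\<^sub>R iexp (\<xi> \<bullet> (x + Y t \<omega>)) \<partial>M)"
      unfolding integral_mult_right_zero[symmetric]
      by (intro Bochner_Integration.integral_cong refl)
         (simp add: indicator_def inner_add_right inner_diff_right ring_distribs exp_add exp_diff)
    also have "\<dots> = fourier N2 \<xi>"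
      unfolding fourier_def by (subst int2) auto
    finally show "fourier N1 \<xi> = fourier N2 \<xi>" .
  qed
  have GPB: "integrable (M \<Otimes>\<^sub>M lborel) (\<lambda>(\<omega>, y). ?G \<omega> y * indicat_real B y)"
    by (rule Bochner_Integration.integrable_bound[OF GP]) (auto simp: indicator_def)
  have "(LINT y:B|lborel. (\<integral>\<omega>. ?G \<omega> y \<partial>M)) = (\<integral>y. (\<integral>\<omega>. ?G \<omega> y * indicat_real B y \<partial>M) \<partial>lborel)"
    unfolding set_lebesgue_integral_def by (simp add: mult.commute)
  also have "\<dots> = (\<integral>(\<omega>, y). ?G \<omega> y * indicat_real B y \<partial>(M \<Otimes>\<^sub>M lborel))"
    by (rule P.integral_snd[OF GPB])
  also have "\<dots> = integral\<^sup>L N1 (indicat_real B)"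
    by (subst int1) (auto simp: split_beta')
  also have "\<dots> = (\<integral>\<omega>. indicat_real ?A \<omega> *\<^sub>R indicat_real B (x + Y t \<omega>) \<partial>M)"
    unfolding \<open>N1 = N2\<close> by (subst int2) auto
  also have "\<dots> = (\<integral>\<omega>. indicat_real {\<omega>\<in>space M. T \<omega> < ereal t \<and> x + Y t \<omega> \<in> B} \<omega> \<partial>M)"
    by (intro Bochner_Integration.integral_cong refl) (auto simp: indicator_def)
  also have "\<dots> = prob {\<omega>\<in>space M. T \<omega> < ereal t \<and> x + Y t \<omega> \<in> B}"
    by simp
  finally show "(LINT y:B|lborel. (\<integral>\<omega>. ?G \<omega> y \<partial>M)) = prob {\<omega>\<in>space M. T \<omega> < ereal t \<and> x + Y t \<omega> \<in> B}" .
qed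

end

text \<open>
  The exit time agrees with a measurable function only almost surely, so measurability of
  the left integrand holds for the completion, where null sets do not matter.
\<close>

lemma integral_completion_AE:
  fixes f g :: "'w \<Rightarrow> real"
  assumes ae: "AE x in M. f x = g x" and g: "g \<in> borel_measurable M"
  shows "integral\<^sup>L (completion M) f = integral\<^sup>L M g"
proof -
  have gc: "g \<in> borel_measurable (completion M)" using g by (rule measurable_completion)
  have fc: "f \<in> borel_measurable (completion M)"
  proof (rule measurableI)
    fix S :: "real set" assume S: "S \<in> sets borel"
    have "AE x in M. \<not> (f x \<in> S \<longleftrightarrow> g x \<notin> S)" using ae by eventually_elim auto
    then have [measurable]: "Measurable.pred (completion M) (\<lambda>x. f x \<in> S \<longleftrightarrow> g x \<notin> S)" by (rule sets_completion_AE)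
    have [measurable]: "Measurable.pred (completion M) (\<lambda>x. g x \<in> S)"
      using gc S by measurable
    have "{x\<in>space (completion M). (f x \<in> S \<longleftrightarrow> g x \<notin> S) \<longleftrightarrow> g x \<notin> S} \<in> sets (completion M)"
      by measurable
    also have "{x\<in>space (completion M). (f x \<in> S \<longleftrightarrow> g x \<notin> S) \<longleftrightarrow> g x \<notin> S} = f -` S \<inter> space (completion M)" by auto
    finally show "f -` S \<inter> space (completion M) \<in> sets (completion M)" .
  qed simp
  have "integral\<^sup>L (completion M) f = integral\<^sup>L (completion M) g"
    by (rule integral_cong_AE[OF fc gc]) (use ae in \<open>rule AE_completion\<close>)
  then show ?thesis using g by (simp add: integral_completion)
qed

lemma stable_process_motion:
  fixes X :: "real \<Rightarrow> 'w \<Rightarrow> 'a::euclidean_space"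
  assumes \<alpha>: "0 < \<alpha>" "\<alpha> < 2" and X: "isotropic_stable_process \<alpha> M X"
  shows "stable_motion M \<alpha> (\<lambda>t \<omega>. X t \<omega> - X 0 \<omega>)"
proof -
  have L: "levy_process M X" using X by (simp add: isotropic_stable_process_def)
  interpret prob_space M using L by (simp add: levy_process_def)
  have Xm[measurable]: "X t \<in> borel_measurable M" if "0 \<le> t" for t
    using L that by (simp add: levy_process_def)
  show ?thesis
  proof
    show "(\<lambda>\<omega>. X t \<omega> - X 0 \<omega>) \<in> borel_measurable M" if "0 \<le> t" for t
      using that by measurable
    show "cadlag (\<lambda>t. X t \<omega> - X 0 \<omega>)" if "\<omega> \<in> space M" for \<omega>
      using cadlag_add_const[of "\<lambda>t. X t \<omega>" "- X 0 \<omega>"] L that by (simp add: levy_process_def add.commute)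
    show "indep_vars (\<lambda>_. borel) (\<lambda>i \<omega>. (X (s (Suc i)) \<omega> - X 0 \<omega>) - (X (s i) \<omega> - X 0 \<omega>)) {..<n}"
      if "0 \<le> s 0" "\<And>i. i < n \<Longrightarrow> s i < s (Suc i)" for s :: "nat \<Rightarrow> real" and n
      using L that by (simp add: levy_process_def)
    show "(\<integral>\<omega>. iexp (\<xi> \<bullet> ((X t \<omega> - X 0 \<omega>) - (X s \<omega> - X 0 \<omega>))) \<partial>M) = complex_of_real (exp (- (t - s) * norm \<xi> powr \<alpha>))"
      if st: "0 \<le> s" "s \<le> t" for s t and \<xi> :: 'a
    proof -
      have d: "distr M borel (\<lambda>\<omega>. X (s + (t - s)) \<omega> - X s \<omega>) = distr M borel (X (t - s))"
      proof -
        have "distr M borel (\<lambda>\<omega>. X (u + v) \<omega> - X u \<omega>) = distr M borel (X v)" if "0 \<le> u" "0 \<le> v" for u v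
          using L that unfolding levy_process_def by blast
        from this[of s "t - s"] show ?thesis using st by simp
      qed
      have [measurable]: "X t \<in> borel_measurable M" "X s \<in> borel_measurable M" "X (t - s) \<in> borel_measurable M"
        using st by auto
      have "(\<integral>\<omega>. iexp (\<xi> \<bullet> ((X t \<omega> - X 0 \<omega>) - (X s \<omega> - X 0 \<omega>))) \<partial>M) = (\<integral>z. iexp (\<xi> \<bullet> z) \<partial>distr M borel (\<lambda>\<omega>. X (s + (t - s)) \<omega> - X s \<omega>))"
        by (subst integral_distr) auto
      also have "\<dots> = (\<integral>\<omega>. iexp (\<xi> \<bullet> X (t - s) \<omega>) \<partial>M)"
        unfolding d by (subst integral_distr) auto
      also have "\<dots> = complex_of_real (exp (- (t - s) * norm \<xi> powr \<alpha>))"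
        using X st unfolding isotropic_stable_process_def by (auto simp: algebra_simps)
      finally show ?thesis .
    qed
  qed (use \<alpha> in auto)
qed

text \<open>
  Stated for a functional of paths that agrees almost surely with an optional time,
  because this is what is known of the exit time.
\<close>

lemma (in stable_motion) stopped_kernel_eq:
  fixes X :: "real \<Rightarrow> 'w \<Rightarrow> 'a"
  assumes XY: "AE \<omega> in M. \<forall>t. X t \<omega> = Y t \<omega>" and T: "optional T"
    and hit: "AE \<omega> in M. hit (path x \<omega>) = T \<omega>"
  shows "stopped_kernel hit \<alpha> M X t x y = stable_density \<alpha> t (y - x) - (\<integral>\<omega>. density_after T t x \<omega> y \<partial>M)"
proof -
  note [measurable] = optional_measurable[OF T] optional_real_measurable[OF T]
  let ?q = "\<lambda>y. \<integral>\<omega>. density_after T t x \<omega> y \<partial>M"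
  have "integral\<^sup>L (completion M) (\<lambda>\<omega>. indicat_real {\<omega>\<in>space M. hit (\<lambda>s. x + X s \<omega>) < ereal t} \<omega> *\<^sub>R
      transition_density \<alpha> (t - real_of_ereal (hit (\<lambda>s. x + X s \<omega>))) (x + X (real_of_ereal (hit (\<lambda>s. x + X s \<omega>))) \<omega>) y)
    = ?q y"
  proof (rule integral_completion_AE)
    show "(\<lambda>\<omega>. density_after T t x \<omega> y) \<in> borel_measurable M"
      unfolding density_after_def by measurable
    have "AE \<omega> in M. \<omega> \<in> space M" by simp
    with XY hit show "AE \<omega> in M. indicat_real {\<omega>\<in>space M. hit (\<lambda>s. x + X s \<omega>) < ereal t} \<omega> *\<^sub>R
      transition_density \<alpha> (t - real_of_ereal (hit (\<lambda>s. x + X s \<omega>))) (x + X (real_of_ereal (hit (\<lambda>s. x + X s \<omega>))) \<omega>) y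
      = density_after T t x \<omega> y"
    proof eventually_elim
      case (elim \<omega>)
      then have "(\<lambda>s. x + X s \<omega>) = path x \<omega>" by (auto simp: path_def)
      with elim show ?case
        by (auto simp: density_after_def transition_density_def at_time_def indicator_def)
    qed
  qed
  then show ?thesis
    unfolding stopped_kernel_def Let_def set_lebesgue_integral_def by (simp add: transition_density_def)
qed

lemma (in stable_motion) integral_stopped_kernel:
  fixes X :: "real \<Rightarrow> 'w \<Rightarrow> 'a"
  assumes XY: "AE \<omega> in M. \<forall>t. X t \<omega> = Y t \<omega>" and T: "optional T"
    and hit: "AE \<omega> in M. hit (path x \<omega>) = T \<omega>"
    and t: "0 < t" and B: "B \<in> sets borel"
  shows "set_integrable lborel B (\<lambda>y. stopped_kernel hit \<alpha> M X t x y)"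
    and "(LINT y:B|lborel. stopped_kernel hit \<alpha> M X t x y) = prob {\<omega>\<in>space M. ereal t \<le> T \<omega> \<and> x + Y t \<omega> \<in> B}"
proof -
  note [measurable] = optional_measurable[OF T] optional_real_measurable[OF T] B
  have [measurable]: "Y t \<in> borel_measurable M" using t by simp
  let ?p = "\<lambda>y. stable_density \<alpha> t (y - x)"
  let ?q = "\<lambda>y. \<integral>\<omega>. density_after T t x \<omega> y \<partial>M"
  note eq = stopped_kernel_eq[OF XY T hit]
  note q = integral_density_after[OF T less_imp_le[OF t] B, of x]
  have ip: "set_integrable lborel B ?p"
    unfolding set_integrable_def using integrable_stable_density(1)[OF t] by (intro integrable_mult_indicator) auto
  have iq: "set_integrable lborel B ?q"
    unfolding set_integrable_def using q(1) by (intro integrable_mult_indicator) auto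
  show "set_integrable lborel B (\<lambda>y. stopped_kernel hit \<alpha> M X t x y)"
    unfolding eq using ip iq by (rule set_integral_diff)
  have pB: "(LINT y:B|lborel. ?p y) = prob {\<omega>\<in>space M. x + Y t \<omega> \<in> B}"
  proof -
    have "(LINT y:B|lborel. ?p y) = integral\<^sup>L (density lborel (\<lambda>y. ennreal (?p y))) (indicat_real B)"
      unfolding set_lebesgue_integral_def
      by (subst integral_density) (auto simp: mult.commute intro!: stable_density_nonneg[OF t])
    also have "\<dots> = measure (distr M borel (\<lambda>\<omega>. x + Y t \<omega>)) B"
      unfolding distr_Y_density[OF t, symmetric] by simp
    also have "\<dots> = prob {\<omega>\<in>space M. x + Y t \<omega> \<in> B}"
      by (subst measure_distr) (auto simp: vimage_def Int_def conj_commute)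
    finally show ?thesis .
  qed
  have "(LINT y:B|lborel. stopped_kernel hit \<alpha> M X t x y)
      = prob {\<omega>\<in>space M. x + Y t \<omega> \<in> B} - prob {\<omega>\<in>space M. T \<omega> < ereal t \<and> x + Y t \<omega> \<in> B}"
    unfolding eq using ip iq by (simp add: set_integral_diff pB q(2))
  also have "\<dots> = prob ({\<omega>\<in>space M. x + Y t \<omega> \<in> B} - {\<omega>\<in>space M. T \<omega> < ereal t \<and> x + Y t \<omega> \<in> B})"
    by (rule finite_measure_Diff[symmetric]) auto
  also have "{\<omega>\<in>space M. x + Y t \<omega> \<in> B} - {\<omega>\<in>space M. T \<omega> < ereal t \<and> x + Y t \<omega> \<in> B}
      = {\<omega>\<in>space M. ereal t \<le> T \<omega> \<and> x + Y t \<omega> \<in> B}" by (auto simp: not_less)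
  finally show "(LINT y:B|lborel. stopped_kernel hit \<alpha> M X t x y) = prob {\<omega>\<in>space M. ereal t \<le> T \<omega> \<and> x + Y t \<omega> \<in> B}" .
qed

section \<open>Subordination\<close>

text \<open>
  With \<open>u = exp s\<close> this is the integral of \<open>(1 - exp (- u)) * u powr (- 1 - \<beta>)\<close> over the
  positive half-line. The logarithmic variable turns scaling into translation and leaves
  only exponential tails.
\<close>

definition subordination_const :: "real \<Rightarrow> real" where
  "subordination_const \<beta> = (\<integral>s. (1 - exp (- exp s)) * exp (- \<beta> * s) \<partial>lborel)"

lemma integrable_subordination_1:
  assumes "0 < \<beta>" "\<beta> < 1"
  shows "integrable lborel (\<lambda>s::real. (1 - exp (- exp s)) * exp (- \<beta> * s))"
proof (rule Bochner_Integration.integrable_bound)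
  let ?w = "\<lambda>s::real. exp (- (1 - \<beta>) * \<bar>s\<bar> powr 1) + exp (- \<beta> * \<bar>s\<bar> powr 1)"
  show "integrable lborel ?w"
    using assms by (intro Bochner_Integration.integrable_add integrable_exp_minus_powr) auto
  show "AE s in lborel. norm ((1 - exp (- exp s)) * exp (- \<beta> * s)) \<le> norm (?w s)"
  proof (rule AE_I2)
    fix s :: real
    have "(1 - exp (- exp s)) * exp (- \<beta> * s) \<le> ?w s"
    proof (cases "s < 0")
      case True
      have "1 - exp (- exp s) \<le> exp s" using exp_ge_add_one_self[of "- exp s"] by simp
      then have "(1 - exp (- exp s)) * exp (- \<beta> * s) \<le> exp s * exp (- \<beta> * s)" by (rule mult_right_mono) simp
      also have "\<dots> = exp (- (1 - \<beta>) * \<bar>s\<bar>)" using True by (simp add: algebra_simps flip: exp_add)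
      finally show ?thesis by (simp add: add_increasing2)
    next
      case False
      have "(1 - exp (- exp s)) * exp (- \<beta> * s) \<le> 1 * exp (- \<beta> * s)" by (intro mult_right_mono) auto
      then show ?thesis using False by (simp add: add_increasing)
    qed
    moreover have "0 \<le> (1 - exp (- exp s)) * exp (- \<beta> * s)" by simp
    ultimately show "norm ((1 - exp (- exp s)) * exp (- \<beta> * s)) \<le> norm (?w s)" by simp
  qed
qed measurable

lemma subordination_const_pos:
  assumes "0 < \<beta>" "\<beta> < 1"
  shows "subordination_const \<beta> > 0"
proof -
  have nn: "0 \<le> (1 - exp (- exp s)) * exp (- \<beta> * s)" for s :: real by simp
  have "subordination_const \<beta> \<noteq> 0"
  proof
    assume "subordination_const \<beta> = 0"
    then have "AE s in lborel. (1 - exp (- exp s)) * exp (- \<beta> * s) = (0::real)"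
      unfolding subordination_const_def
      by (subst (asm) integral_nonneg_eq_0_iff_AE[OF integrable_subordination_1[OF assms]]) (use nn in auto)
    then have "AE s in (lborel :: real measure). False" by eventually_elim simp
    then have "ae_filter (lborel :: real measure) = bot" by (simp add: eventually_False)
    then show False by (simp add: ae_filter_eq_bot_iff)
  qed
  moreover have "subordination_const \<beta> \<ge> 0"
    unfolding subordination_const_def by (rule integral_nonneg_AE) (use nn in auto)
  ultimately show ?thesis by simp
qed

text \<open>
  Multiplication of the argument by \<open>v\<close> is the translation of \<open>s\<close> by \<open>ln v\<close>, which costs
  the factor \<open>v powr \<beta>\<close>.
\<close>

lemma subordination:
  assumes \<beta>: "0 < \<beta>" "\<beta> < 1" and v: "0 \<le> v"
  shows "integrable lborel (\<lambda>s. (1 - exp (- exp s * v)) * exp (- \<beta> * s))"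
    and "(\<integral>s. (1 - exp (- exp s * v)) * exp (- \<beta> * s) \<partial>lborel) = v powr \<beta> * subordination_const \<beta>"
proof -
  have "has_bochner_integral lborel (\<lambda>s. (1 - exp (- exp s * v)) * exp (- \<beta> * s)) (v powr \<beta> * subordination_const \<beta>)"
  proof (cases "v = 0")
    case False
    then have v: "v > 0" using v by simp
    have "has_bochner_integral lborel (\<lambda>s. (1 - exp (- exp s)) * exp (- \<beta> * s)) (subordination_const \<beta>)"
      unfolding subordination_const_def by (intro has_bochner_integral_integrable integrable_subordination_1 \<beta>)
    then have "has_bochner_integral lborel (\<lambda>s. (1 - exp (- exp (ln v + 1 * s))) * exp (- \<beta> * (ln v + 1 * s))) (subordination_const \<beta> /\<^sub>R \<bar>1\<bar>)"
      by (subst (asm) lborel_has_bochner_integral_real_affine_iff[where c=1 and t="ln v"]) auto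
    then have "has_bochner_integral lborel (\<lambda>s. v powr \<beta> * ((1 - exp (- exp (ln v + 1 * s))) * exp (- \<beta> * (ln v + 1 * s)))) (v powr \<beta> * (subordination_const \<beta> /\<^sub>R \<bar>1\<bar>))"
      by (rule has_bochner_integral_mult_right)
    moreover have "v powr \<beta> * ((1 - exp (- exp (ln v + 1 * s))) * exp (- \<beta> * (ln v + 1 * s))) = (1 - exp (- exp s * v)) * exp (- \<beta> * s)" for s
    proof -
      have e1: "exp (ln v + 1 * s) = exp s * v" using v by (simp add: exp_add mult.commute)
      have e2: "exp (- \<beta> * (ln v + 1 * s)) = inverse (v powr \<beta>) * exp (- \<beta> * s)"
        using v by (simp add: powr_def ring_distribs exp_diff exp_minus divide_inverse mult_ac)
      show ?thesis unfolding e1 e2 using v by simp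
    qed
    ultimately show ?thesis by simp
  qed (simp add: has_bochner_integral_zero)
  then show "integrable lborel (\<lambda>s. (1 - exp (- exp s * v)) * exp (- \<beta> * s))"
    and "(\<integral>s. (1 - exp (- exp s * v)) * exp (- \<beta> * s) \<partial>lborel) = v powr \<beta> * subordination_const \<beta>"
    by (auto simp: has_bochner_integral_iff)
qed

section \<open>Small-time lower bound for the probability of a ball\<close>

text \<open>
  A test function concentrated near \<open>y\<close>. The second factor vanishes to second order at
  the origin, so that the part of the expectation at time \<open>t\<close> that comes from far away
  from \<open>y\<close> is at most a small multiple of \<open>t\<close>.
\<close>

definition bump :: "real \<Rightarrow> 'a::euclidean_space \<Rightarrow> 'a \<Rightarrow> real" where
  "bump \<delta> y z = gauss \<delta> (y - z) * (1 - exp (- (norm z)\<^sup>2 / 2))"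

lemma bump_nonneg: "\<delta> > 0 \<Longrightarrow> 0 \<le> bump \<delta> y z"
  by (simp add: bump_def)

lemma bump_measurable [measurable]: "bump \<delta> y \<in> borel_measurable borel"
  unfolding bump_def by measurable

definition bump_coeff :: "real \<Rightarrow> 'a::euclidean_space \<Rightarrow> real" where
  "bump_coeff \<delta> y = exp (- (norm y)\<^sup>2 / (2 * (1 + \<delta>\<^sup>2))) / sqrt (1 + \<delta>\<^sup>2) ^ DIM('a)"

text \<open>
  Completing the square: a product of two Gaussians is a multiple of a Gaussian, so the
  test function is a difference of two Gaussians and has an explicit Fourier transform.
\<close>

lemma bump_eq:
  fixes y z :: "'a::euclidean_space"
  assumes \<delta>: "\<delta> > 0"
  shows "bump \<delta> y z = gauss \<delta> (y - z)
     - bump_coeff \<delta> y * gauss (\<delta> / sqrt (1 + \<delta>\<^sup>2)) (y /\<^sub>R (1 + \<delta>\<^sup>2) - z)"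
proof -
  define a where "a = 1 + \<delta>\<^sup>2"
  have a: "a > 0" by (simp add: a_def add_pos_nonneg)
  have e: "- (norm (y - z))\<^sup>2 / (2 * \<delta>\<^sup>2) - (norm z)\<^sup>2 / 2
     = - (norm y)\<^sup>2 / (2 * a) - (norm (y /\<^sub>R a - z))\<^sup>2 / (2 * (\<delta> / sqrt a)\<^sup>2)"
  proof -
    have "(norm (y /\<^sub>R a - z))\<^sup>2 = (y \<bullet> y) / a\<^sup>2 - 2 * (y \<bullet> z) / a + z \<bullet> z"
      unfolding power2_norm_eq_inner[of "y /\<^sub>R a - z"]
      using a by (simp add: inner_diff_left inner_diff_right inner_commute power2_eq_square divide_inverse algebra_simps)
    moreover have "(norm (y - z))\<^sup>2 = y \<bullet> y - 2 * (y \<bullet> z) + z \<bullet> z"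
      by (simp add: power2_norm_eq_inner inner_diff_left inner_diff_right inner_commute)
    moreover have "(\<delta> / sqrt a)\<^sup>2 = \<delta>\<^sup>2 / a" using a by (simp add: power_divide)
    moreover have "- (A - 2 * B + C) / (2 * d) - C / 2 = - A / (2 * a) - (A / a\<^sup>2 - 2 * B / a + C) / (2 * (d / a))"
      if d: "d > 0" "a = 1 + d" for A B C d :: real
    proof -
      have "(A / a\<^sup>2 - 2 * B / a + C) / (2 * (d / a)) = A / (2 * a * d) - B / d + a * C / (2 * d)"
        using d(1) a by (simp add: field_simps power2_eq_square)
      moreover have "A / (2 * a) + A / (2 * a * d) = A / (2 * d)"
      proof -
        have "A / (2 * a) + A / (2 * a * d) = A * (d + 1) / (2 * a * d)" using d(1) a by (simp add: field_simps)
        moreover have "d + 1 = a" using d(2) by simp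
        ultimately show ?thesis using a by simp
      qed
      moreover have "a * C / (2 * d) = C / (2 * d) + C / 2" using d by (simp add: field_simps)
      moreover have "- (A - 2 * B + C) / (2 * d) = - A / (2 * d) + B / d - C / (2 * d)"
        using d by (simp add: field_simps)
      ultimately show ?thesis by linarith
    qed
    ultimately show ?thesis
      using \<delta> by (simp add: power2_norm_eq_inner a_def)
  qed
  have "gauss \<delta> (y - z) * exp (- (norm z)\<^sup>2 / 2) = exp (- (norm (y - z))\<^sup>2 / (2 * \<delta>\<^sup>2) - (norm z)\<^sup>2 / 2) / (\<delta> * sqrt (2 * pi)) ^ DIM('a)"
    by (simp add: gauss_def flip: exp_add)
  also have "\<dots> = exp (- (norm y)\<^sup>2 / (2 * a)) * exp (- (norm (y /\<^sub>R a - z))\<^sup>2 / (2 * (\<delta> / sqrt a)\<^sup>2)) / (\<delta> * sqrt (2 * pi)) ^ DIM('a)"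
    unfolding e by (simp flip: exp_add)
  also have "\<dots> = bump_coeff \<delta> y * gauss (\<delta> / sqrt a) (y /\<^sub>R a - z)"
  proof -
    have "(\<delta> * sqrt (2 * pi)) ^ DIM('a) = sqrt a ^ DIM('a) * (\<delta> / sqrt a * sqrt (2 * pi)) ^ DIM('a)"
      using a by (simp flip: power_mult_distrib)
    then show ?thesis by (simp add: bump_coeff_def gauss_def a_def)
  qed
  finally show ?thesis by (simp add: bump_def a_def ring_distribs)
qed

text \<open>
  The Fourier transform of the bump, up to a power of \<open>2 * pi\<close>, as read off from
  \<open>bump_eq\<close>.
\<close>

definition bump_ft :: "real \<Rightarrow> 'a::euclidean_space \<Rightarrow> 'a \<Rightarrow> complex" where
  "bump_ft \<delta> y \<xi> = iexp (- (y \<bullet> \<xi>)) * complex_of_real (exp (- \<delta>\<^sup>2 * (norm \<xi>)\<^sup>2 / 2))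
     - complex_of_real (bump_coeff \<delta> y) * (iexp (- ((y /\<^sub>R (1 + \<delta>\<^sup>2)) \<bullet> \<xi>)) * complex_of_real (exp (- (\<delta> / sqrt (1 + \<delta>\<^sup>2))\<^sup>2 * (norm \<xi>)\<^sup>2 / 2)))"

lemma bump_ft_measurable [measurable]: "bump_ft \<delta> y \<in> borel_measurable borel"
  unfolding bump_ft_def by measurable

lemma integrable_bump_ft:
  assumes \<delta>: "\<delta> > 0" and \<alpha>: "0 < \<alpha>" "\<alpha> < 2"
  shows "integrable lborel (bump_ft \<delta> (y :: 'a::euclidean_space))"
    and "integrable lborel (\<lambda>\<xi>. norm \<xi> powr \<alpha> *\<^sub>R bump_ft \<delta> (y :: 'a) \<xi>)"
proof -
  let ?d = "\<delta> / sqrt (1 + \<delta>\<^sup>2)"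
  have d: "?d > 0" using \<delta> by (simp add: add_pos_nonneg)
  let ?h = "\<lambda>\<xi>::'a. exp (- \<delta>\<^sup>2 * (norm \<xi>)\<^sup>2 / 2) + bump_coeff \<delta> y * exp (- ?d\<^sup>2 * (norm \<xi>)\<^sup>2 / 2)"
  have c: "bump_coeff \<delta> y \<ge> 0" by (simp add: bump_coeff_def)
  have b: "norm (bump_ft \<delta> y \<xi>) \<le> ?h \<xi>" for \<xi>
    unfolding bump_ft_def by (rule order_trans[OF norm_triangle_ineq4]) (simp add: norm_mult c)
  have h0: "0 \<le> ?h \<xi>" for \<xi> by (rule order_trans[OF norm_ge_zero b])
  have i1: "integrable lborel ?h"
    using integrable_exp_norm_square[OF \<delta>] integrable_exp_norm_square[OF d]
    by (intro Bochner_Integration.integrable_add integrable_mult_right)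
  show "integrable lborel (bump_ft \<delta> y)"
    by (rule Bochner_Integration.integrable_bound[OF i1]) (use b h0 in auto)
  have "integrable lborel (\<lambda>\<xi>::'a. norm \<xi> powr \<alpha> * exp (- \<delta>\<^sup>2 * (norm \<xi>)\<^sup>2 / 2)
      + bump_coeff \<delta> y * (norm \<xi> powr \<alpha> * exp (- ?d\<^sup>2 * (norm \<xi>)\<^sup>2 / 2)))"
    using integrable_powr_norm_exp[OF \<alpha> \<delta>] integrable_powr_norm_exp[OF \<alpha> d]
    by (intro Bochner_Integration.integrable_add integrable_mult_right)
  then have i2: "integrable lborel (\<lambda>\<xi>::'a. norm \<xi> powr \<alpha> * ?h \<xi>)"
    by (simp add: ring_distribs mult_ac)
  show "integrable lborel (\<lambda>\<xi>. norm \<xi> powr \<alpha> *\<^sub>R bump_ft \<delta> y \<xi>)"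
    by (rule Bochner_Integration.integrable_bound[OF i2]) (use b h0 in \<open>auto intro!: mult_left_mono simp: abs_mult\<close>)
qed

lemma integral_bump_fourier:
  fixes N :: "'a::euclidean_space measure"
  assumes N: "finite_measure N" and [measurable_cong]: "sets N = sets borel" and \<delta>: "\<delta> > 0"
  shows "(2 * pi) ^ DIM('a) * (\<integral>z. bump \<delta> y z \<partial>N) = Re (\<integral>\<xi>. bump_ft \<delta> y \<xi> * fourier N \<xi> \<partial>lborel)"
proof -
  interpret finite_measure N by fact
  let ?d = "\<delta> / sqrt (1 + \<delta>\<^sup>2)" and ?y = "y /\<^sub>R (1 + \<delta>\<^sup>2)"
  have d: "?d > 0" using \<delta> by (simp add: add_pos_nonneg)
  have gi: "integrable N (\<lambda>z. gauss s (v - z))" if "s > 0" for s and v :: 'a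
    by (rule integrable_const_bound[where B="gauss s (0::'a)"]) (use that gauss_bound[OF that] in auto)
  have fi: "integrable lborel (\<lambda>\<xi>. iexp (- (v \<bullet> \<xi>)) * fourier N \<xi> * complex_of_real (exp (- s\<^sup>2 * (norm \<xi>)\<^sup>2 / 2)))"
    if s: "s > 0" for s and v :: 'a
  proof (rule Bochner_Integration.integrable_bound[where f="\<lambda>\<xi>. measure N (space N) * exp (- s\<^sup>2 * (norm \<xi>)\<^sup>2 / 2)"])
    show "integrable lborel (\<lambda>\<xi>::'a. measure N (space N) * exp (- s\<^sup>2 * (norm \<xi>)\<^sup>2 / 2))"
      by (intro integrable_mult_right integrable_exp_norm_square s)
    have [measurable]: "fourier N \<in> borel_measurable borel" by (rule measurable_fourier[OF assms(1,2)])
    show "(\<lambda>\<xi>. iexp (- (v \<bullet> \<xi>)) * fourier N \<xi> * complex_of_real (exp (- s\<^sup>2 * (norm \<xi>)\<^sup>2 / 2))) \<in> borel_measurable lborel"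
      by measurable
    show "AE \<xi> in lborel. norm (iexp (- (v \<bullet> \<xi>)) * fourier N \<xi> * complex_of_real (exp (- s\<^sup>2 * (norm \<xi>)\<^sup>2 / 2)))
       \<le> norm (measure N (space N) * exp (- s\<^sup>2 * (norm \<xi>)\<^sup>2 / 2))"
      using norm_fourier_le[OF N] by (auto simp: norm_mult)
  qed
  have "(\<integral>\<xi>. bump_ft \<delta> y \<xi> * fourier N \<xi> \<partial>lborel)
     = (\<integral>\<xi>. iexp (- (y \<bullet> \<xi>)) * fourier N \<xi> * complex_of_real (exp (- \<delta>\<^sup>2 * (norm \<xi>)\<^sup>2 / 2))
         - complex_of_real (bump_coeff \<delta> y) * (iexp (- (?y \<bullet> \<xi>)) * fourier N \<xi> * complex_of_real (exp (- ?d\<^sup>2 * (norm \<xi>)\<^sup>2 / 2))) \<partial>lborel)"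
    unfolding bump_ft_def left_diff_distrib by (simp only: mult_ac)
  also have "\<dots> = complex_of_real ((2 * pi) ^ DIM('a) * (\<integral>z. gauss \<delta> (y - z) \<partial>N))
     - complex_of_real (bump_coeff \<delta> y) * complex_of_real ((2 * pi) ^ DIM('a) * (\<integral>z. gauss ?d (?y - z) \<partial>N))"
    by (subst Bochner_Integration.integral_diff[OF fi[OF \<delta>, of y] integrable_mult_right[OF fi[OF d, of ?y]]])
       (simp only: integral_mult_right_zero integral_fourier_gauss_eq[OF assms(1,2) \<delta>] integral_fourier_gauss_eq[OF assms(1,2) d])
  also have "\<dots> = complex_of_real ((2 * pi) ^ DIM('a) * ((\<integral>z. gauss \<delta> (y - z) \<partial>N) - bump_coeff \<delta> y * (\<integral>z. gauss ?d (?y - z) \<partial>N)))"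
    by (simp add: algebra_simps)
  also have "(\<integral>z. gauss \<delta> (y - z) \<partial>N) - bump_coeff \<delta> y * (\<integral>z. gauss ?d (?y - z) \<partial>N) = (\<integral>z. bump \<delta> y z \<partial>N)"
    unfolding bump_eq[OF \<delta>]
    using gi[OF \<delta>, of y] gi[OF d, of ?y] by simp
  finally show ?thesis by simp
qed

text \<open>
  The test function vanishes at the origin, so the integral of its Fourier transform is
  \<open>0\<close>, as the case of a point mass at the origin shows, and may be subtracted.
\<close>

lemma integral_bump_fourier_diff:
  fixes N :: "'a::euclidean_space measure"
  assumes N: "finite_measure N" "sets N = sets borel" and \<delta>: "\<delta> > 0"
  shows "(2 * pi) ^ DIM('a) * (\<integral>z. bump \<delta> y z \<partial>N) = - Re (\<integral>\<xi>. bump_ft \<delta> y \<xi> * (1 - fourier N \<xi>) \<partial>lborel)"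
proof -
  let ?D = "return borel (0::'a)"
  have D: "finite_measure ?D" "sets ?D = sets borel"
    using prob_space_return[of "0::'a" borel] by (auto intro: prob_space.finite_measure)
  have "fourier ?D \<xi> = 1" for \<xi>
    unfolding fourier_def by (subst integral_return) auto
  moreover have "(\<integral>z. bump \<delta> y z \<partial>?D) = 0"
    by (subst integral_return) (auto simp: bump_def)
  ultimately have z: "Re (\<integral>\<xi>. bump_ft \<delta> y \<xi> \<partial>lborel) = 0"
    using integral_bump_fourier[OF D \<delta>, of y] by simp
  have i1: "integrable lborel (bump_ft \<delta> y)"
    by (rule integrable_bump_ft(1)[OF \<delta>, of 1]) auto
  have [measurable]: "fourier N \<in> borel_measurable borel" by (rule measurable_fourier[OF N])
  have i2: "integrable lborel (\<lambda>\<xi>. bump_ft \<delta> y \<xi> * fourier N \<xi>)"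
    by (rule Bochner_Integration.integrable_bound[OF integrable_mult_right[OF i1, of "complex_of_real (measure N (space N))"]])
       (use norm_fourier_le[OF N(1)] in \<open>auto simp: norm_mult mult.commute intro!: mult_right_mono\<close>)
  show ?thesis
    unfolding right_diff_distrib mult_1_right
    using integral_bump_fourier[OF N \<delta>, of y] i1 i2 z by simp
qed

lemma fourier_gauss_measure:
  assumes s: "s > 0"
  defines "N \<equiv> density lborel (\<lambda>z::'a::euclidean_space. ennreal (gauss s z))"
  shows "finite_measure N" "sets N = sets borel"
    and "fourier N \<xi> = complex_of_real (exp (- s\<^sup>2 * (norm \<xi>)\<^sup>2 / 2))"
    and "\<And>h::'a \<Rightarrow> real. h \<in> borel_measurable borel \<Longrightarrow> integral\<^sup>L N h = (\<integral>z. gauss s z * h z \<partial>lborel)"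
proof -
  show "finite_measure N"
  proof
    have "emeasure N (space N) = nn_integral lborel (\<lambda>z::'a. ennreal (gauss s z))"
      unfolding N_def by (simp add: emeasure_density)
    also have "\<dots> = 1"
      using s integral_gauss[OF s, where 'a='a] by (subst nn_integral_eq_integral) (auto intro: fourier_gauss(1))
    finally show "emeasure N (space N) \<noteq> \<infinity>" by simp
  qed
  show "sets N = sets borel" by (simp add: N_def)
  show "fourier N \<xi> = complex_of_real (exp (- s\<^sup>2 * (norm \<xi>)\<^sup>2 / 2))"
    unfolding fourier_def N_def using s fourier_gauss(2)[OF s, of \<xi>]
    by (subst integral_density) (auto simp: scaleR_conv_of_real mult.commute)
  show "integral\<^sup>L N h = (\<integral>z. gauss s z * h z \<partial>lborel)" if "h \<in> borel_measurable borel" for h :: "'a \<Rightarrow> real"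
    unfolding N_def using s that by (subst integral_density) auto
qed

text \<open>
  The left side of the identity is the generator of the process applied to the bump,
  evaluated at the origin. By subordination \<open>norm \<xi> powr \<alpha>\<close> is a mixture of the functions
  \<open>1 - exp (- exp s * (norm \<xi>)\<^sup>2 / 2)\<close>, and each of these contributes the integral of the
  nonnegative bump against a Gaussian.
\<close>

lemma bump_symbol_eq:
  fixes y :: "'a::euclidean_space"
  assumes \<delta>: "\<delta> > 0" and \<alpha>: "0 < \<alpha>" "\<alpha> < 2"
  defines "K \<equiv> subordination_const (\<alpha> / 2)"
  shows "integrable lborel (\<lambda>s. exp (- (\<alpha> / 2) * s) * (\<integral>z. gauss (exp (s / 2)) z * bump \<delta> y z \<partial>lborel))"
    and "- Re (\<integral>\<xi>. norm \<xi> powr \<alpha> *\<^sub>R bump_ft \<delta> y \<xi> \<partial>lborel)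
       = 2 powr (\<alpha> / 2) / K * (2 * pi) ^ DIM('a)
         * (\<integral>s. exp (- (\<alpha> / 2) * s) * (\<integral>z. gauss (exp (s / 2)) z * bump \<delta> y z \<partial>lborel) \<partial>lborel)"
proof -
  let ?\<beta> = "\<alpha> / 2"
  have \<beta>: "0 < ?\<beta>" "?\<beta> < 1" using \<alpha> by auto
  have K: "K > 0" unfolding K_def by (rule subordination_const_pos[OF \<beta>])
  let ?v = "\<lambda>\<xi>::'a. (norm \<xi>)\<^sup>2 / 2"
  let ?k = "\<lambda>s \<xi>. (1 - exp (- exp s * ?v \<xi>)) * exp (- ?\<beta> * s)"
  have psi: "norm \<xi> powr \<alpha> = 2 powr ?\<beta> / K * (\<integral>s. ?k s \<xi> \<partial>lborel)" for \<xi> :: 'a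
  proof -
    have "(\<integral>s. ?k s \<xi> \<partial>lborel) = ?v \<xi> powr ?\<beta> * K"
      unfolding K_def by (rule subordination(2)[OF \<beta>]) simp
    moreover have "2 powr ?\<beta> * ?v \<xi> powr ?\<beta> = norm \<xi> powr \<alpha>"
      by (simp add: powr_divide power2_eq_square powr_mult flip: powr_add)
    ultimately show ?thesis using K by simp
  qed
  let ?F = "\<lambda>\<xi> s. ?k s \<xi> *\<^sub>R bump_ft \<delta> y \<xi>"
  have k0: "0 \<le> ?k s \<xi>" for s \<xi> by simp
  have ki: "integrable lborel (\<lambda>s. ?k s \<xi>)" for \<xi> by (rule subordination(1)[OF \<beta>]) simp
  have FP: "integrable (lborel \<Otimes>\<^sub>M lborel) (\<lambda>(\<xi>, s). ?F \<xi> s)"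
  proof (rule lborel_pair.Fubini_integrable)
    show "(\<lambda>(\<xi>, s). ?F \<xi> s) \<in> borel_measurable (lborel \<Otimes>\<^sub>M lborel)" by measurable
    have "integrable lborel (\<lambda>\<xi>. K / 2 powr ?\<beta> * norm (norm \<xi> powr \<alpha> *\<^sub>R bump_ft \<delta> y \<xi>))"
      using integrable_bump_ft(2)[OF \<delta> \<alpha>] by (intro integrable_mult_right integrable_norm)
    moreover have "(LBINT s. norm (case (\<xi>, s) of (\<xi>, s) \<Rightarrow> ?F \<xi> s)) = K / 2 powr ?\<beta> * norm (norm \<xi> powr \<alpha> *\<^sub>R bump_ft \<delta> y \<xi>)" for \<xi>
    proof -
      have "(LBINT s. norm (case (\<xi>, s) of (\<xi>, s) \<Rightarrow> ?F \<xi> s)) = (LBINT s. ?k s \<xi> * norm (bump_ft \<delta> y \<xi>))"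
        using k0 by (simp add: abs_mult)
      also have "\<dots> = (\<integral>s. ?k s \<xi> \<partial>lborel) * norm (bump_ft \<delta> y \<xi>)" by simp
      finally show ?thesis using K psi[of \<xi>] by simp
    qed
    ultimately show "integrable lborel (\<lambda>\<xi>. LBINT s. norm (case (\<xi>, s) of (\<xi>, s) \<Rightarrow> ?F \<xi> s))" by simp
    show "AE \<xi> in lborel. integrable lborel (\<lambda>s. case (\<xi>, s) of (\<xi>, s) \<Rightarrow> ?F \<xi> s)"
      using ki by (intro AE_I2) (simp only: prod.case, intro integrable_scaleR_left)
  qed
  have inner: "(\<integral>\<xi>. ?F \<xi> s \<partial>lborel) = exp (- ?\<beta> * s) *\<^sub>R (\<integral>\<xi>. bump_ft \<delta> y \<xi> * (1 - fourier (density lborel (\<lambda>z. ennreal (gauss (exp (s / 2)) z))) \<xi>) \<partial>lborel)" for s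
  proof -
    have "(exp (s / 2))\<^sup>2 = exp s" by (simp add: power2_eq_square flip: exp_add)
    then show ?thesis
      unfolding integral_scaleR_right[symmetric]
      by (intro Bochner_Integration.integral_cong refl) (simp add: fourier_gauss_measure(3) scaleR_conv_of_real algebra_simps)
  qed
  have Re: "Re (\<integral>\<xi>. ?F \<xi> s \<partial>lborel) = - ((2 * pi) ^ DIM('a) * (exp (- ?\<beta> * s) * (\<integral>z. gauss (exp (s / 2)) z * bump \<delta> y z \<partial>lborel)))" for s
  proof -
    note g = fourier_gauss_measure[of "exp (s / 2)", where 'a='a, OF exp_gt_zero]
    show ?thesis
      unfolding inner using integral_bump_fourier_diff[OF g(1,2) \<delta>, of y] by (simp add: g(4) mult_ac)
  qed
  have "integrable lborel (\<lambda>s. \<integral>\<xi>. ?F \<xi> s \<partial>lborel)" by (rule lborel_pair.integrable_snd[OF FP])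
  then have iR: "integrable lborel (\<lambda>s. Re (\<integral>\<xi>. ?F \<xi> s \<partial>lborel))" by (rule integrable_Re)
  then have i: "integrable lborel (\<lambda>s. - (1 / (2 * pi) ^ DIM('a)) * Re (\<integral>\<xi>. ?F \<xi> s \<partial>lborel))"
    by (rule integrable_mult_right)
  have "exp (- (\<alpha> / 2) * s) * (\<integral>z. gauss (exp (s / 2)) z * bump \<delta> y z \<partial>lborel) = - (1 / (2 * pi) ^ DIM('a)) * Re (\<integral>\<xi>. ?F \<xi> s \<partial>lborel)" for s
    unfolding Re by simp
  with i show "integrable lborel (\<lambda>s. exp (- (\<alpha> / 2) * s) * (\<integral>z. gauss (exp (s / 2)) z * bump \<delta> y z \<partial>lborel))"
    by (simp only:)
  have "(\<integral>\<xi>. norm \<xi> powr \<alpha> *\<^sub>R bump_ft \<delta> y \<xi> \<partial>lborel) = (\<integral>\<xi>. (2 powr ?\<beta> / K) *\<^sub>R (\<integral>s. ?F \<xi> s \<partial>lborel) \<partial>lborel)"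
    using ki by (intro Bochner_Integration.integral_cong refl) (simp add: psi integral_scaleR_left)
  also have "\<dots> = (2 powr ?\<beta> / K) *\<^sub>R (\<integral>\<xi>. (\<integral>s. ?F \<xi> s \<partial>lborel) \<partial>lborel)" by simp
  also have "(\<integral>\<xi>. (\<integral>s. ?F \<xi> s \<partial>lborel) \<partial>lborel) = (\<integral>s. (\<integral>\<xi>. ?F \<xi> s \<partial>lborel) \<partial>lborel)"
    by (rule lborel_pair.Fubini_integral[OF FP, symmetric])
  finally have "Re (\<integral>\<xi>. norm \<xi> powr \<alpha> *\<^sub>R bump_ft \<delta> y \<xi> \<partial>lborel) = 2 powr ?\<beta> / K * Re (\<integral>s. (\<integral>\<xi>. ?F \<xi> s \<partial>lborel) \<partial>lborel)"
    by (simp only: scaleR_complex.simps)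
  also have "Re (\<integral>s. (\<integral>\<xi>. ?F \<xi> s \<partial>lborel) \<partial>lborel) = (\<integral>s. Re (\<integral>\<xi>. ?F \<xi> s \<partial>lborel) \<partial>lborel)"
    using integral_Re[OF lborel_pair.integrable_snd[OF FP]] by simp
  finally show "- Re (\<integral>\<xi>. norm \<xi> powr \<alpha> *\<^sub>R bump_ft \<delta> y \<xi> \<partial>lborel)
       = 2 powr (\<alpha> / 2) / K * (2 * pi) ^ DIM('a)
         * (\<integral>s. exp (- (\<alpha> / 2) * s) * (\<integral>z. gauss (exp (s / 2)) z * bump \<delta> y z \<partial>lborel) \<partial>lborel)"
    unfolding Re by simp
qed


lemma gauss_ball_integral_pos:
  assumes r: "r > 0"
  shows "0 < integral\<^sup>L lborel (\<lambda>w::'a::euclidean_space. indicat_real (ball 0 r) w * gauss 1 w)"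
proof -
  let ?c = "exp (- r\<^sup>2 / 2) / sqrt (2 * pi) ^ DIM('a)"
  have "0 < ?c * measure lborel (ball (0::'a) r)"
    using content_ball_pos[OF r, of "0::'a"] by (intro mult_pos_pos) auto
  also have "\<dots> = integral\<^sup>L lborel (\<lambda>w::'a. ?c * indicat_real (ball 0 r) w)" by simp
  also have "\<dots> \<le> integral\<^sup>L lborel (\<lambda>w::'a. indicat_real (ball 0 r) w * gauss 1 w)"
  proof (rule integral_mono')
    show "integrable lborel (\<lambda>w::'a. indicat_real (ball 0 r) w * gauss 1 w)"
      by (rule Bochner_Integration.integrable_bound[OF fourier_gauss(1)[of 1]]) (auto simp: indicator_def)
    fix w :: 'a
    show "0 \<le> indicat_real (ball 0 r) w * gauss 1 w" by simp
    show "?c * indicat_real (ball 0 r) w \<le> indicat_real (ball 0 r) w * gauss 1 w"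
    proof (cases "w \<in> ball 0 r")
      case True
      then have "(norm w)\<^sup>2 \<le> r\<^sup>2" using r by (intro power_mono) auto
      then show ?thesis using True by (auto simp: gauss_def intro!: divide_right_mono)
    qed simp
  qed
  finally show ?thesis .
qed

text \<open>
  The bound is uniform in the width \<open>\<delta>\<close>: near \<open>y\<close> the Gaussian weight and the second
  factor of the bump are bounded below, and a Gaussian of width at most \<open>1\<close> has at least
  as much mass in the ball as the one of width \<open>1\<close>.
\<close>

lemma bump_gauss_lower_bound:
  fixes y :: "'a::euclidean_space"
  assumes r: "0 < r" "r < norm y"
  obtains m where "m > 0"
    "\<And>\<delta> s. 0 < \<delta> \<Longrightarrow> \<delta> \<le> 1 \<Longrightarrow> s \<in> {0..1} \<Longrightarrow> m \<le> (\<integral>z. gauss (exp (s / 2)) z * bump \<delta> y z \<partial>lborel)"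
proof -
  define R where "R = norm y + r"
  define g0 where "g0 = exp (- R\<^sup>2 / 2) / (exp (1 / 2) * sqrt (2 * pi)) ^ DIM('a)"
  define e0 where "e0 = 1 - exp (- (norm y - r)\<^sup>2 / 2)"
  define b where "b = (\<integral>w. indicat_real (ball 0 r) w * gauss 1 (w::'a) \<partial>lborel)"
  have b: "b > 0" unfolding b_def by (rule gauss_ball_integral_pos[OF r(1)])
  have g0: "g0 > 0" by (simp add: g0_def)
  have e0: "e0 > 0" using r by (simp add: e0_def)
  show ?thesis
  proof (rule that[of "g0 * e0 * b"])
    show "g0 * e0 * b > 0" using b g0 e0 by simp
    fix \<delta> s :: real assume \<delta>: "0 < \<delta>" "\<delta> \<le> 1" and s: "s \<in> {0..1}"
    let ?f = "\<lambda>z. gauss (exp (s / 2)) z * bump \<delta> y z"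
    have bd: "bump \<delta> y z \<le> gauss \<delta> (0::'a)" for z
      using gauss_bound[OF \<delta>(1), of "y - z"] \<delta> unfolding bump_def by (intro order_trans[OF mult_left_le]) auto
    have "integrable lborel (\<lambda>z. gauss (exp (s / 2)) z * gauss \<delta> (0::'a))"
      by (intro integrable_mult_left fourier_gauss(1)) auto
    then have fi: "integrable lborel ?f"
    proof (rule Bochner_Integration.integrable_bound)
      show "AE z in lborel. norm (?f z) \<le> norm (gauss (exp (s / 2)) z * gauss \<delta> (0::'a))"
        using bd bump_nonneg[OF \<delta>(1), of y] \<delta> by (intro AE_I2) (simp add: abs_mult mult_left_mono)
    qed measurable
    have gi: "integrable lborel (\<lambda>z. g0 * e0 * (indicat_real (ball y r) z * gauss \<delta> (z - y)))"
      by (intro integrable_mult_right, rule Bochner_Integration.integrable_bound[OF integrable_gauss_translate[OF \<delta>(1), of y]])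
         (use \<delta> in \<open>auto simp: indicator_def\<close>)
    have "b \<le> (\<integral>w. indicat_real (ball y r) (y + \<delta> *\<^sub>R w) * gauss 1 w \<partial>lborel)"
      unfolding b_def
    proof (rule integral_mono')
      show "integrable lborel (\<lambda>w. indicat_real (ball y r) (y + \<delta> *\<^sub>R w) * gauss 1 w)"
        by (rule Bochner_Integration.integrable_bound[OF fourier_gauss(1)[of 1]]) (auto simp: indicator_def)
      fix w :: 'a
      show "0 \<le> indicat_real (ball y r) (y + \<delta> *\<^sub>R w) * gauss 1 w" by simp
      have "\<delta> * norm w \<le> 1 * norm w" using \<delta> by (intro mult_right_mono) auto
      then show "indicat_real (ball 0 r) w * gauss 1 w \<le> indicat_real (ball y r) (y + \<delta> *\<^sub>R w) * gauss 1 w"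
        using \<delta> by (auto simp: indicator_def dist_norm)
    qed
    also have "\<dots> = (\<integral>z. indicat_real (ball y r) z * gauss \<delta> (z - y) \<partial>lborel)"
      by (rule integral_gauss_translate[symmetric]) (use \<delta> in \<open>auto intro!: borel_measurable_indicator\<close>)
    finally have "g0 * e0 * b \<le> (\<integral>z. g0 * e0 * (indicat_real (ball y r) z * gauss \<delta> (z - y)) \<partial>lborel)"
      using g0 e0 by (simp add: mult_left_mono)
    also have "\<dots> \<le> integral\<^sup>L lborel ?f"
    proof (rule integral_mono[OF gi fi])
      fix z :: 'a
      show "g0 * e0 * (indicat_real (ball y r) z * gauss \<delta> (z - y)) \<le> ?f z"
      proof (cases "z \<in> ball y r")
        case True
        then have zd: "norm (y - z) < r" by (simp add: dist_norm)
        have nz: "norm z \<le> R" "norm y - r \<le> norm z"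
          using zd norm_triangle_ineq2[of z y] norm_triangle_ineq2[of y z] norm_minus_commute[of y z] unfolding R_def by linarith+
        have "g0 \<le> gauss (exp (s / 2)) z"
          unfolding g0_def gauss_def
        proof (rule frac_le)
          have "(norm z)\<^sup>2 \<le> R\<^sup>2" using nz by (intro power_mono) auto
          moreover have "(norm z)\<^sup>2 / (2 * (exp (s / 2))\<^sup>2) \<le> (norm z)\<^sup>2 / 2"
            using s by (intro divide_left_mono) (auto intro: one_le_power)
          ultimately show "exp (- R\<^sup>2 / 2) \<le> exp (- (norm z)\<^sup>2 / (2 * (exp (s / 2))\<^sup>2))" by simp
          show "(exp (s / 2) * sqrt (2 * pi)) ^ DIM('a) \<le> (exp (1 / 2) * sqrt (2 * pi)) ^ DIM('a)"
            using s by (intro power_mono mult_right_mono) auto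
        qed auto
        moreover have "e0 \<le> 1 - exp (- (norm z)\<^sup>2 / 2)"
          unfolding e0_def using nz r by (auto intro!: power_mono)
        ultimately have "g0 * e0 \<le> gauss (exp (s / 2)) z * (1 - exp (- (norm z)\<^sup>2 / 2))"
          using g0 e0 by (intro mult_mono) auto
        then have "g0 * e0 * gauss \<delta> (z - y) \<le> gauss (exp (s / 2)) z * (1 - exp (- (norm z)\<^sup>2 / 2)) * gauss \<delta> (z - y)"
          using \<delta> by (intro mult_right_mono) auto
        then show ?thesis using True by (simp add: bump_def gauss_commute[of \<delta> y z] mult_ac)
      qed (use bump_nonneg[OF \<delta>(1), of y z] in simp)
    qed
    finally show "g0 * e0 * b \<le> integral\<^sup>L lborel ?f" .
  qed
qed

text \<open>The value of a Gaussian at distance \<open>r\<close> from its centre tends to \<open>0\<close> with its width.\<close>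

lemma gauss_tail_small:
  assumes r: "0 < r" and \<epsilon>: "0 < \<epsilon>"
  obtains \<delta> where "0 < \<delta>" "\<delta> \<le> 1" "exp (- r\<^sup>2 / (2 * \<delta>\<^sup>2)) / (\<delta> * sqrt (2 * pi)) ^ DIM('a::euclidean_space) \<le> \<epsilon>"
proof -
  let ?d = "DIM('a)"
  define A where "A = fact ?d * (2 / r\<^sup>2) ^ ?d / sqrt (2 * pi) ^ ?d"
  have A: "A > 0" using r by (simp add: A_def)
  define \<delta> where "\<delta> = min 1 (\<epsilon> / A)"
  have \<delta>: "0 < \<delta>" "\<delta> \<le> 1" "\<delta> \<le> \<epsilon> / A" using \<epsilon> A by (auto simp: \<delta>_def)
  define x where "x = r\<^sup>2 / (2 * \<delta>\<^sup>2)"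
  define c where "c = sqrt (2 * pi)"
  have x: "x > 0" using r \<delta> by (simp add: x_def)
  have c: "c > 0" by (simp add: c_def)
  have "x ^ ?d / fact ?d = (\<Sum>n\<in>{?d}. x ^ n /\<^sub>R fact n)" by (simp add: divide_inverse)
  also have "\<dots> \<le> (\<Sum>n. x ^ n /\<^sub>R fact n)"
    using x by (intro sum_le_suminf summable_exp_generic) auto
  finally have "x ^ ?d / fact ?d \<le> exp x" by (simp add: exp_def)
  then have "inverse (exp x) \<le> inverse (x ^ ?d / fact ?d)"
    using x by (intro le_imp_inverse_le) auto
  then have "exp (- x) \<le> fact ?d / x ^ ?d" by (simp add: exp_minus)
  then have "exp (- x) / (\<delta> * c) ^ ?d \<le> fact ?d / x ^ ?d / (\<delta> * c) ^ ?d"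
    using \<delta> c by (intro divide_right_mono) auto
  also have "\<dots> = fact ?d * (1 / (x * (\<delta> * c))) ^ ?d"
    by (simp add: power_divide power_mult_distrib)
  also have "1 / (x * (\<delta> * c)) = 2 / r\<^sup>2 * \<delta> / c"
    using r \<delta> c by (simp add: x_def field_simps power2_eq_square)
  also have "fact ?d * (2 / r\<^sup>2 * \<delta> / c) ^ ?d = A * \<delta> ^ ?d"
    unfolding A_def c_def[symmetric] by (simp only: power_mult_distrib power_divide) simp
  also have "\<dots> \<le> A * \<delta> ^ 1"
    using A \<delta> by (intro mult_left_mono power_decreasing) auto
  also have "\<dots> \<le> \<epsilon>" using \<delta>(3) A by (simp add: field_simps)
  finally have "exp (- r\<^sup>2 / (2 * \<delta>\<^sup>2)) / (\<delta> * sqrt (2 * pi)) ^ ?d \<le> \<epsilon>"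
    unfolding x_def c_def by (simp only: minus_divide_left)
  then show ?thesis using that[OF \<delta>(1,2)] by blast
qed

context stable_motion
begin

text \<open>
  Divided by \<open>t\<close>, the function \<open>1 - exp (- t * norm \<xi> powr \<alpha>)\<close> tends to \<open>norm \<xi> powr \<alpha>\<close>
  and is dominated by it.
\<close>

lemma expectation_bump_tendsto:
  assumes \<delta>: "\<delta> > 0"
  shows "(\<lambda>n. real (Suc n) * (\<integral>\<omega>. bump \<delta> y (Y (1 / Suc n) \<omega>) \<partial>M))
     \<longlonglongrightarrow> - Re (\<integral>\<xi>. norm \<xi> powr \<alpha> *\<^sub>R bump_ft \<delta> y \<xi> \<partial>lborel) / (2 * pi) ^ DIM('a)"
proof -
  let ?t = "\<lambda>n. 1 / real (Suc n)"
  let ?psi = "\<lambda>\<xi>::'a. norm \<xi> powr \<alpha>"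
  let ?q = "\<lambda>n \<xi>. real (Suc n) * (1 - exp (- ?t n * ?psi \<xi>))"
  have t0: "?t n > 0" for n by simp
  have tl: "?t \<longlonglongrightarrow> 0"
    using LIMSEQ_inverse_real_of_nat by (simp add: inverse_eq_divide)
  have q: "(\<lambda>n. ?q n \<xi>) \<longlonglongrightarrow> ?psi \<xi>" for \<xi>
  proof -
    have "((\<lambda>t. - exp (- t * ?psi \<xi>)) has_real_derivative ?psi \<xi>) (at 0)"
      by (auto intro!: derivative_eq_intros)
    then have "((\<lambda>h. (- exp (- h * ?psi \<xi>) - - 1) / h) \<longlongrightarrow> ?psi \<xi>) (at 0)"
      by (simp add: DERIV_def)
    moreover have "filterlim ?t (at 0) sequentially"
      using tl t0 by (auto simp: filterlim_at less_imp_neq[symmetric] simp del: of_nat_Suc)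
    ultimately have "(\<lambda>n. (- exp (- ?t n * ?psi \<xi>) - - 1) / ?t n) \<longlonglongrightarrow> ?psi \<xi>"
      by (rule filterlim_compose)
    then show ?thesis by (simp add: mult.commute)
  qed
  have q0: "0 \<le> ?q n \<xi>" "?q n \<xi> \<le> ?psi \<xi>" for n \<xi>
  proof -
    show "0 \<le> ?q n \<xi>" by simp
    have "1 - exp (- ?t n * ?psi \<xi>) \<le> ?t n * ?psi \<xi>"
      using exp_ge_add_one_self[of "- ?t n * ?psi \<xi>"] by linarith
    then have "?q n \<xi> \<le> real (Suc n) * (?t n * ?psi \<xi>)" by (rule mult_left_mono) simp
    then show "?q n \<xi> \<le> ?psi \<xi>" by simp
  qed
  have lim: "(\<lambda>n. \<integral>\<xi>. ?q n \<xi> *\<^sub>R bump_ft \<delta> y \<xi> \<partial>lborel) \<longlonglongrightarrow> (\<integral>\<xi>. ?psi \<xi> *\<^sub>R bump_ft \<delta> y \<xi> \<partial>lborel)"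
  proof (rule integral_dominated_convergence[where w="\<lambda>\<xi>. norm (?psi \<xi> *\<^sub>R bump_ft \<delta> y \<xi>)"])
    show "integrable lborel (\<lambda>\<xi>. norm (?psi \<xi> *\<^sub>R bump_ft \<delta> y \<xi>))"
      by (rule integrable_norm[OF integrable_bump_ft(2)[OF \<delta> alpha]])
    show "AE \<xi> in lborel. (\<lambda>n. ?q n \<xi> *\<^sub>R bump_ft \<delta> y \<xi>) \<longlonglongrightarrow> ?psi \<xi> *\<^sub>R bump_ft \<delta> y \<xi>"
      by (intro AE_I2 tendsto_intros q)
    show "AE \<xi> in lborel. norm (?q n \<xi> *\<^sub>R bump_ft \<delta> y \<xi>) \<le> norm (?psi \<xi> *\<^sub>R bump_ft \<delta> y \<xi>)" for n
      unfolding norm_scaleR using q0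
      by (intro AE_I2 mult_right_mono) (simp_all only: real_norm_def abs_of_nonneg powr_ge_zero norm_ge_zero)
  qed measurable
  have eq: "real (Suc n) * (\<integral>\<omega>. bump \<delta> y (Y (?t n) \<omega>) \<partial>M) = - Re (\<integral>\<xi>. ?q n \<xi> *\<^sub>R bump_ft \<delta> y \<xi> \<partial>lborel) / (2 * pi) ^ DIM('a)" for n
  proof -
    have [measurable]: "Y (?t n) \<in> borel_measurable M" by (rule Y_measurable) simp
    let ?N = "distr M borel (\<lambda>\<omega>. 0 + Y (?t n) \<omega>)"
    have N: "finite_measure ?N" "sets ?N = sets borel"
      using prob_space_distr[of "\<lambda>\<omega>. 0 + Y (?t n) \<omega>" borel] by (auto intro: prob_space.finite_measure)
    have f: "fourier ?N \<xi> = complex_of_real (exp (- ?t n * ?psi \<xi>))" for \<xi>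
      by (subst fourier_distr_Y) auto
    have "(\<integral>\<omega>. bump \<delta> y (Y (?t n) \<omega>) \<partial>M) = (\<integral>z. bump \<delta> y z \<partial>?N)"
      by (subst integral_distr) auto
    then have "(2 * pi) ^ DIM('a) * (\<integral>\<omega>. bump \<delta> y (Y (?t n) \<omega>) \<partial>M)
       = - Re (\<integral>\<xi>. bump_ft \<delta> y \<xi> * (1 - fourier ?N \<xi>) \<partial>lborel)"
      using integral_bump_fourier_diff[OF N \<delta>, of y] by simp
    also have "(\<integral>\<xi>. bump_ft \<delta> y \<xi> * (1 - fourier ?N \<xi>) \<partial>lborel) = (\<integral>\<xi>. ?t n *\<^sub>R (?q n \<xi> *\<^sub>R bump_ft \<delta> y \<xi>) \<partial>lborel)"
    proof (intro Bochner_Integration.integral_cong refl)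
      fix \<xi> :: 'a
      have tq: "?t n * ?q n \<xi> = 1 - exp (- ?t n * ?psi \<xi>)" by simp
      show "bump_ft \<delta> y \<xi> * (1 - fourier ?N \<xi>) = ?t n *\<^sub>R (?q n \<xi> *\<^sub>R bump_ft \<delta> y \<xi>)"
        unfolding f scaleR_scaleR tq by (simp add: scaleR_conv_of_real mult.commute)
    qed
    also have "\<dots> = ?t n *\<^sub>R (\<integral>\<xi>. ?q n \<xi> *\<^sub>R bump_ft \<delta> y \<xi> \<partial>lborel)" by (rule integral_scaleR_right)
    finally have "(2 * pi) ^ DIM('a) * (\<integral>\<omega>. bump \<delta> y (Y (?t n) \<omega>) \<partial>M) = - (?t n * Re (\<integral>\<xi>. ?q n \<xi> *\<^sub>R bump_ft \<delta> y \<xi> \<partial>lborel))"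
      by (simp only: scaleR_complex.simps)
    then show ?thesis
      by (simp add: field_simps)
  qed
  show ?thesis
    unfolding eq by (intro tendsto_intros lim) simp
qed

lemma expectation_one_minus_gauss_le:
  assumes t: "0 < t"
  shows "(\<integral>\<omega>. 1 - exp (- (norm (Y t \<omega>))\<^sup>2 / 2) \<partial>M) \<le> t * gauss_moment TYPE('a) \<alpha>"
proof -
  have s: "{\<omega>\<in>space M. ereal 0 < ereal t} = space M" using t by auto
  have "(\<integral>\<omega>. 1 - exp (- (norm (Y t \<omega>))\<^sup>2 / 2) \<partial>M) = (LINT \<omega>:space M|M. 1 - exp (- (norm (Y t \<omega> - at_time (\<lambda>_. ereal 0) \<omega>))\<^sup>2 / 2))"
    unfolding set_lebesgue_integral_def
    by (intro Bochner_Integration.integral_cong refl) (simp add: at_time_def Y_zero)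
  also have "\<dots> \<le> t * prob (space M) * gauss_moment TYPE('a) \<alpha>"
    using displacement_after_gauss[OF optional_const[OF order_refl], of t] t unfolding s by simp
  finally show ?thesis by (simp add: prob_space)
qed

text \<open>
  The expectation of a narrow bump is at least a constant times \<open>t\<close>, with a constant that
  does not depend on the width. Outside the ball the bump is small, and its expectation
  there is at most a small multiple of \<open>t\<close> because of the second factor. The remainder
  comes from the ball. A sequence of times that tends to \<open>0\<close> suffices for the application.
\<close>

theorem prob_ball_lower_bound:
  assumes y: "y \<noteq> 0" and r: "0 < r"
  obtains c where "c > 0" "\<forall>\<^sub>F n in sequentially. c / Suc n \<le> prob {\<omega>\<in>space M. Y (1 / Suc n) \<omega> \<in> ball y r}"
proof -
  define r' where "r' = min r (norm y / 2)"
  have r': "0 < r'" "r' < norm y" "r' \<le> r" using y r by (auto simp: r'_def min_def)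
  obtain m where m: "m > 0"
    "\<And>\<delta> s. 0 < \<delta> \<Longrightarrow> \<delta> \<le> 1 \<Longrightarrow> s \<in> {0..1} \<Longrightarrow> m \<le> (\<integral>z. gauss (exp (s / 2)) z * bump \<delta> y z \<partial>lborel)"
    using bump_gauss_lower_bound[OF r'(1,2)] by blast
  let ?\<beta> = "\<alpha> / 2"
  define K where "K = subordination_const ?\<beta>"
  have K: "K > 0" unfolding K_def by (rule subordination_const_pos) (use alpha in auto)
  define \<kappa> where "\<kappa> = 2 powr ?\<beta> / K * (exp (- ?\<beta>) * m)"
  have \<kappa>: "\<kappa> > 0" using m K by (simp add: \<kappa>_def)
  let ?C = "gauss_moment TYPE('a) \<alpha>"
  have C: "?C \<ge> 0" by (rule gauss_moment_nonneg)
  \<comment> \<open>With this width the contribution from outside the ball is at most \<open>\<kappa> * t / 4\<close>, while the bump has expectation at least \<open>\<kappa> * t / 2\<close>.\<close>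
  obtain \<delta> where \<delta>: "0 < \<delta>" "\<delta> \<le> 1" and small: "exp (- r'\<^sup>2 / (2 * \<delta>\<^sup>2)) / (\<delta> * sqrt (2 * pi)) ^ DIM('a) \<le> \<kappa> / (4 * (?C + 1))"
    using gauss_tail_small[OF r'(1), of "\<kappa> / (4 * (?C + 1))", where 'a='a] \<kappa> C by auto
  define G where "G = exp (- r'\<^sup>2 / (2 * \<delta>\<^sup>2)) / (\<delta> * sqrt (2 * pi)) ^ DIM('a)"
  have G: "0 \<le> G" "G * ?C \<le> \<kappa> / 4"
  proof -
    show "0 \<le> G" using \<delta> by (simp add: G_def)
    have "G * ?C \<le> \<kappa> / (4 * (?C + 1)) * ?C" using small C unfolding G_def by (rule mult_right_mono)
    also have "\<dots> \<le> \<kappa> / 4" using \<kappa> C by (simp add: field_simps)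
    finally show "G * ?C \<le> \<kappa> / 4" .
  qed
  let ?L = "- Re (\<integral>\<xi>. norm \<xi> powr \<alpha> *\<^sub>R bump_ft \<delta> y \<xi> \<partial>lborel) / (2 * pi) ^ DIM('a)"
  have L: "\<kappa> \<le> ?L"
  proof -
    let ?J = "\<lambda>s. exp (- ?\<beta> * s) * (\<integral>z. gauss (exp (s / 2)) z * bump \<delta> y z \<partial>lborel)"
    note b = bump_symbol_eq[OF \<delta>(1) alpha, of y]
    have J0: "0 \<le> ?J s" for s
      by (intro mult_nonneg_nonneg integral_nonneg_AE AE_I2) (simp_all add: bump_nonneg[OF \<delta>(1)])
    have "exp (- ?\<beta>) * m = (\<integral>s. indicat_real {0..1::real} s * (exp (- ?\<beta>) * m) \<partial>lborel)" by simp
    also have "\<dots> \<le> (\<integral>s. ?J s \<partial>lborel)"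
    proof (rule integral_mono'[OF b(1)])
      fix s :: real
      show "indicat_real {0..1} s * (exp (- ?\<beta>) * m) \<le> ?J s"
      proof (cases "s \<in> {0..1}")
        case True
        have "?\<beta> * s \<le> ?\<beta> * 1" using True alpha by (intro mult_left_mono) auto
        then have "exp (- ?\<beta>) * m \<le> ?J s"
          using m(2)[OF \<delta> True] m(1) by (intro mult_mono) auto
        then show ?thesis using True by simp
      qed (use J0 in simp)
    qed (rule J0)
    finally have "2 powr ?\<beta> / K * (exp (- ?\<beta>) * m) \<le> 2 powr ?\<beta> / K * (\<integral>s. ?J s \<partial>lborel)"
      using K by (intro mult_left_mono) auto
    then show ?thesis
      unfolding b(2) \<kappa>_def K_def by simp
  qed
  have "\<forall>\<^sub>F n in sequentially. \<kappa> / 2 < real (Suc n) * (\<integral>\<omega>. bump \<delta> y (Y (1 / Suc n) \<omega>) \<partial>M)"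
    by (rule order_tendstoD(1)[OF expectation_bump_tendsto[OF \<delta>(1)]]) (use L \<kappa> in linarith)
  then have ev: "\<forall>\<^sub>F n in sequentially. \<kappa> / (4 * gauss \<delta> (0::'a)) / Suc n \<le> prob {\<omega>\<in>space M. Y (1 / Suc n) \<omega> \<in> ball y r}"
  proof eventually_elim
    case (elim n)
    let ?t = "1 / real (Suc n)"
    have [measurable]: "Y ?t \<in> borel_measurable M" by (rule Y_measurable) simp
    let ?A = "{\<omega>\<in>space M. Y ?t \<omega> \<in> ball y r}"
    \<comment> \<open>Inside the ball the maximum of the Gaussian is used, outside it the second factor of the bump.\<close>
    have pt: "bump \<delta> y z \<le> gauss \<delta> (0::'a) * indicat_real (ball y r) z + G * (1 - exp (- (norm z)\<^sup>2 / 2))" for z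
    proof (cases "z \<in> ball y r")
      case True
      have "bump \<delta> y z \<le> gauss \<delta> (y - z)" using \<delta> unfolding bump_def by (intro mult_left_le) auto
      also have "\<dots> \<le> gauss \<delta> (0::'a)" by (rule gauss_bound[OF \<delta>(1)])
      finally show ?thesis using True G by (simp add: add_increasing2)
    next
      case False
      then have "r' \<le> norm (y - z)" using r' by (simp add: dist_norm)
      then have "r'\<^sup>2 \<le> (norm (y - z))\<^sup>2" using r' by (intro power_mono) auto
      then have "gauss \<delta> (y - z) \<le> G"
        unfolding gauss_def G_def using \<delta> by (auto intro!: divide_right_mono)
      then show ?thesis using False unfolding bump_def by (simp add: mult_right_mono)
    qed
    have "(\<integral>\<omega>. bump \<delta> y (Y ?t \<omega>) \<partial>M) \<le> (\<integral>\<omega>. gauss \<delta> (0::'a) * indicat_real ?A \<omega> + G * (1 - exp (- (norm (Y ?t \<omega>))\<^sup>2 / 2)) \<partial>M)"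
    proof (rule integral_mono)
      have "\<bar>bump \<delta> y z\<bar> \<le> gauss \<delta> (0::'a) + G" for z
      proof -
        have "gauss \<delta> (0::'a) * indicat_real (ball y r) z \<le> gauss \<delta> (0::'a)" "G * (1 - exp (- (norm z)\<^sup>2 / 2)) \<le> G"
          using \<delta> G(1) by (auto intro!: mult_left_le simp: indicator_def)
        then show ?thesis using pt[of z] bump_nonneg[OF \<delta>(1), of y z] by simp
      qed
      then show "integrable M (\<lambda>\<omega>. bump \<delta> y (Y ?t \<omega>))"
        by (intro integrable_const_bound[where B="gauss \<delta> (0::'a) + G"]) auto
      have "integrable M (\<lambda>\<omega>. 1 - exp (- (norm (Y ?t \<omega>))\<^sup>2 / 2))"
        by (rule integrable_const_bound[where B=1]) auto
      then show "integrable M (\<lambda>\<omega>. gauss \<delta> (0::'a) * indicat_real ?A \<omega> + G * (1 - exp (- (norm (Y ?t \<omega>))\<^sup>2 / 2)))"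
        by (intro Bochner_Integration.integrable_add integrable_mult_right integrable_real_indicator) (auto simp: less_top[symmetric])
    next
      fix \<omega> assume "\<omega> \<in> space M"
      then show "bump \<delta> y (Y ?t \<omega>) \<le> gauss \<delta> (0::'a) * indicat_real ?A \<omega> + G * (1 - exp (- (norm (Y ?t \<omega>))\<^sup>2 / 2))"
        using pt[of "Y ?t \<omega>"] by (simp add: indicator_def)
    qed
    also have "\<dots> = gauss \<delta> (0::'a) * prob ?A + G * (\<integral>\<omega>. 1 - exp (- (norm (Y ?t \<omega>))\<^sup>2 / 2) \<partial>M)"
    proof -
      have "integrable M (\<lambda>\<omega>. 1 - exp (- (norm (Y ?t \<omega>))\<^sup>2 / 2))"
        by (rule integrable_const_bound[where B=1]) auto
      then show ?thesis
        by (subst Bochner_Integration.integral_add) (auto simp: less_top[symmetric] intro!: integrable_mult_right)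
    qed
    also have "\<dots> \<le> gauss \<delta> (0::'a) * prob ?A + G * (?t * ?C)"
      using expectation_one_minus_gauss_le[of ?t] G(1) by (intro add_left_mono mult_left_mono) auto
    also have "\<dots> \<le> gauss \<delta> (0::'a) * prob ?A + ?t * (\<kappa> / 4)"
      using mult_left_mono[OF G(2), of ?t] by (simp add: mult_ac)
    finally have "real (Suc n) * (\<integral>\<omega>. bump \<delta> y (Y ?t \<omega>) \<partial>M) \<le> real (Suc n) * (gauss \<delta> (0::'a) * prob ?A + ?t * (\<kappa> / 4))"
      by (rule mult_left_mono) simp
    also have "\<dots> = real (Suc n) * (gauss \<delta> (0::'a) * prob ?A) + \<kappa> / 4"
      by (simp add: distrib_left del: of_nat_Suc)
    finally have "\<kappa> / 4 \<le> real (Suc n) * (gauss \<delta> (0::'a) * prob ?A)" using elim by linarith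
    moreover have "k / (4 * g) / N \<le> p" if "k / 4 \<le> N * (g * p)" "g > 0" "N > 0" for k g N p :: real
      using that by (simp add: field_simps)
    ultimately show ?case using gauss_pos[OF \<delta>(1), of "0::'a"] by simp
  qed
  show ?thesis
    by (rule that[OF _ ev]) (simp add: \<kappa> gauss_pos[OF \<delta>(1)])
qed

end

section \<open>Convexity and comparability\<close>

text \<open>
  At a boundary point the exterior ball shows that there are interior points of the
  complement nearby.
\<close>

lemma C11_Compl_subset_closure_interior:
  fixes D :: "'a::euclidean_space set"
  assumes "C11_set D"
  shows "- D \<subseteq> closure (interior (- D))"
proof
  fix z assume z: "z \<in> - D"
  obtain r where r: "r > 0" and C: "C11_at_scale r D" using assms by (auto simp: C11_set_def)
  have "open D" using C by (simp add: C11_at_scale_def)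
  show "z \<in> closure (interior (- D))"
  proof (cases "z \<in> closure D")
    case True
    then have "z \<in> frontier D" using z \<open>open D\<close> by (simp add: frontier_def interior_open)
    then obtain x' x'' where b: "ball x'' r \<subseteq> - D" "cball x' r \<inter> cball x'' r = {z}"
      using C unfolding C11_at_scale_def by meson
    then have "z \<in> closure (ball x'' r)" using r by auto
    moreover have "ball x'' r \<subseteq> interior (- D)" using b(1) by (rule interior_maximal) simp
    ultimately show ?thesis using closure_mono by blast
  next
    case False
    then have "z \<in> interior (- D)" by (simp add: interior_closure)
    then show ?thesis using closure_subset by blast
  qed
qed

text \<open>
  Take a segment between points of \<open>D\<close> that meets the complement, and translate it
  slightly so that it meets the interior of the complement. This is an open condition on
  the end points.
\<close>

lemma nonconvex_separated_balls:
  fixes D :: "'a::euclidean_space set"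
  assumes D: "open D" "C11_set D" and nc: "\<not> convex D"
  shows "\<exists>x y \<epsilon>. \<epsilon> > 0 \<and> cball x (2 * \<epsilon>) \<subseteq> D \<and> ball y (2 * \<epsilon>) \<subseteq> D \<and>
    (\<forall>a\<in>cball x (2 * \<epsilon>). \<forall>b\<in>ball y (2 * \<epsilon>). closed_segment a b \<inter> - D \<noteq> {})"
proof -
  obtain x0 y0 z0 where p: "x0 \<in> D" "y0 \<in> D" "z0 \<in> closed_segment x0 y0" "z0 \<notin> D"
    using nc unfolding convex_contains_segment by blast
  obtain \<eta>1 \<eta>2 where "\<eta>1 > 0" "ball x0 \<eta>1 \<subseteq> D" "\<eta>2 > 0" "ball y0 \<eta>2 \<subseteq> D"
    using D(1) p(1,2) open_contains_ball by metis
  then obtain \<eta> where \<eta>: "\<eta> > 0" "ball x0 \<eta> \<subseteq> D" "ball y0 \<eta> \<subseteq> D"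
    by (intro that[of "min \<eta>1 \<eta>2"]) auto
  have "z0 \<in> closure (interior (- D))" using C11_Compl_subset_closure_interior[OF D(2)] p(4) by auto
  then obtain z where z: "z \<in> interior (- D)" "dist z z0 < \<eta>"
    using \<eta>(1) by (auto simp: closure_approachable)
  \<comment> \<open>The translation moves the point \<open>z0\<close> of the complement to the interior point \<open>z\<close>.\<close>
  define h where "h = z - z0"
  define x where "x = x0 + h"
  define y where "y = y0 + h"
  have xy: "x \<in> D" "y \<in> D"
    using z(2) \<eta> by (auto simp: x_def y_def h_def dist_norm subset_iff norm_minus_commute)
  obtain u where u: "0 \<le> u" "u \<le> 1" "z0 = (1 - u) *\<^sub>R x0 + u *\<^sub>R y0"
    using p(3) by (auto simp: closed_segment_def)
  have zu: "z = (1 - u) *\<^sub>R x + u *\<^sub>R y"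
  proof -
    have "(1 - u) *\<^sub>R x + u *\<^sub>R y = z0 + h"
      unfolding x_def y_def u(3) by (simp add: algebra_simps)
    then show ?thesis by (simp add: h_def)
  qed
  obtain \<rho>1 where \<rho>1: "\<rho>1 > 0" "ball x \<rho>1 \<subseteq> D"
    using D(1) xy(1) open_contains_ball by blast
  obtain \<rho>2 where \<rho>2: "\<rho>2 > 0" "ball y \<rho>2 \<subseteq> D"
    using D(1) xy(2) open_contains_ball by blast
  obtain \<rho>3 where \<rho>3: "\<rho>3 > 0" "ball z \<rho>3 \<subseteq> - D"
    using z(1) unfolding mem_interior by blast
  from \<rho>1 \<rho>2 \<rho>3 obtain \<rho> where \<rho>: "\<rho> > 0" "ball x \<rho> \<subseteq> D" "ball y \<rho> \<subseteq> D" "ball z \<rho> \<subseteq> - D"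
    by (intro that[of "min \<rho>1 (min \<rho>2 \<rho>3)"]) auto
  show ?thesis
  proof (rule exI[of _ x], rule exI[of _ y], rule exI[of _ "\<rho> / 3"], intro conjI)
    show "\<rho> / 3 > 0" using \<rho> by simp
    have "cball x (2 * (\<rho> / 3)) \<subseteq> ball x \<rho>" "ball y (2 * (\<rho> / 3)) \<subseteq> ball y \<rho>" using \<rho>(1) by auto
    then show "cball x (2 * (\<rho> / 3)) \<subseteq> D" "ball y (2 * (\<rho> / 3)) \<subseteq> D" using \<rho> by auto
    show "\<forall>a\<in>cball x (2 * (\<rho> / 3)). \<forall>b\<in>ball y (2 * (\<rho> / 3)). closed_segment a b \<inter> - D \<noteq> {}"
    proof (intro ballI)
      fix a b assume "a \<in> cball x (2 * (\<rho> / 3))" "b \<in> ball y (2 * (\<rho> / 3))"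
      then have ab: "norm (x - a) < \<rho>" "norm (y - b) < \<rho>" using \<rho>(1) by (auto simp: dist_norm)
      define c where "c = (1 - u) *\<^sub>R a + u *\<^sub>R b"
      have "norm (z - c) = norm ((1 - u) *\<^sub>R (x - a) + u *\<^sub>R (y - b))"
        unfolding zu c_def by (simp add: algebra_simps)
      also have "\<dots> \<le> (1 - u) * norm (x - a) + u * norm (y - b)"
        using u by (intro order_trans[OF norm_triangle_ineq]) simp
      also have "\<dots> < \<rho>"
        using convex_bound_lt[OF ab, of "1 - u" u] u by simp
      finally have "c \<in> - D" using \<rho>(4) by (auto simp: dist_norm)
      moreover have "c \<in> closed_segment a b" unfolding c_def closed_segment_def using u by auto
      ultimately show "closed_segment a b \<inter> - D \<noteq> {}" by blast
    qed
  qed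
qed

context stable_motion
begin

lemma optional_prob_tendsto_0:
  assumes T: "optional T" and pos: "\<And>\<omega>. \<omega> \<in> space M \<Longrightarrow> 0 < T \<omega>"
  shows "(\<lambda>n. prob {\<omega>\<in>space M. T \<omega> < ereal (1 / Suc n)}) \<longlonglongrightarrow> 0"
proof -
  note [measurable] = optional_measurable[OF T]
  let ?A = "\<lambda>n. {\<omega>\<in>space M. T \<omega> < ereal (1 / Suc n)}"
  have "decseq ?A"
    unfolding decseq_Suc_iff
    by (auto elim!: less_le_trans simp: frac_le)
  then have "(\<lambda>n. prob (?A n)) \<longlonglongrightarrow> prob (\<Inter>n. ?A n)"
    by (intro finite_Lim_measure_decseq) auto
  moreover have "(\<Inter>n. ?A n) = {}"
  proof (rule ccontr)
    assume "(\<Inter>n. ?A n) \<noteq> {}"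
    then obtain \<omega> where \<omega>: "\<omega> \<in> space M" "\<And>n. T \<omega> < ereal (1 / Suc n)" by auto
    then obtain t where t: "T \<omega> = ereal t" "t > 0"
      using pos[OF \<omega>(1)] \<omega>(2)[of 0] by (cases "T \<omega>") auto
    then obtain n where "inverse (real (Suc n)) < t" using reals_Archimedean by blast
    then show False using \<omega>(2)[of n] t by (simp add: inverse_eq_divide)
  qed
  ultimately show ?thesis by simp
qed

text \<open>
  When the path leaves the ball around \<open>x\<close>, at time \<open>T\<close>, its left limit is still in the
  closed ball. It cannot land in the larger ball around \<open>y\<close>, since then the segment of the
  jump would leave \<open>D\<close> and the process would be shot down. So it has to be displaced by at
  least \<open>\<epsilon>\<close> after \<open>T\<close>.
\<close>

lemma prob_shot_down_le:
  assumes D: "open D" and \<epsilon>: "\<epsilon> > 0" and xD: "cball x (2 * \<epsilon>) \<subseteq> D" and yD: "ball y (2 * \<epsilon>) \<subseteq> D"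
    and sep: "\<forall>a\<in>cball x (2 * \<epsilon>). \<forall>b\<in>ball y (2 * \<epsilon>). closed_segment a b \<inter> - D \<noteq> {}"
    and t: "0 < t"
  defines "T \<equiv> \<lambda>\<omega>. hit_time (exit_rel {a. 2 * \<epsilon> \<le> dist x a}) (path x \<omega>)"
  shows "optional T" and "\<And>\<omega>. \<omega> \<in> space M \<Longrightarrow> 0 < T \<omega>"
    and "prob {\<omega>\<in>space M. ereal t \<le> hit_time (segment_rel (- D)) (path x \<omega>) \<and> x + Y t \<omega> \<in> ball y \<epsilon>} * (1 - exp (- \<epsilon>\<^sup>2 / 2))
       \<le> t * prob {\<omega>\<in>space M. T \<omega> < ereal t} * gauss_moment TYPE('a) \<alpha>"
proof -
  let ?R = "exit_rel {a. 2 * \<epsilon> \<le> dist x a}"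
  have R: "jump_closed ?R"
    by (intro jump_closed_exit_rel closed_Collect_le continuous_intros)
  have xR: "(x, x) \<notin> ?R" using \<epsilon> by (simp add: exit_rel_def)
  show T: "optional T" unfolding T_def by (rule optional_hit_time[OF R xR])
  show "0 < T \<omega>" if "\<omega> \<in> space M" for \<omega>
    unfolding T_def using hit_time_pos[OF R cadlag_path[OF that]] xR path_0[OF that] by simp
  have disj: False if "a \<in> cball x (2 * \<epsilon>)" "a \<in> ball y (2 * \<epsilon>)" for a
    using bspec[OF bspec[OF sep that(1)] that(2)] xD that(1) by auto
  have xs: "x \<in> D" using xD \<epsilon> by auto
  note [measurable] = optional_measurable[OF T] optional_real_measurable[OF T]
  have [measurable]: "Y t \<in> borel_measurable M" using t by simp
  let ?E = "{\<omega>\<in>space M. ereal t \<le> hit_time (segment_rel (- D)) (path x \<omega>) \<and> x + Y t \<omega> \<in> ball y \<epsilon>}"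
  let ?F = "{\<omega>\<in>space M. T \<omega> < ereal t \<and> \<epsilon> \<le> norm (Y t \<omega> - at_time T \<omega>)}"
  have "prob ?E \<le> prob ?F"
  proof (rule finite_measure_mono_AE)
    show "AE \<omega> in M. \<omega> \<in> ?E \<longrightarrow> \<omega> \<in> ?F"
      using no_fixed_jump[OF t]
    proof (rule AE_mp, intro AE_I2 impI)
      fix \<omega> assume \<omega>: "\<omega> \<in> space M" and nj: "left_lim (\<lambda>t. Y t \<omega>) t = Y t \<omega>" and E: "\<omega> \<in> ?E"
      let ?w = "path x \<omega>"
      note w = cadlag_path[OF \<omega>, of x]
      have \<sigma>: "ereal t \<le> hit_time (segment_rel (- D)) ?w" and wt: "?w t \<in> ball y \<epsilon>"
        using E by (auto simp: path_def)
      have cont: "left_lim ?w t = ?w t"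
        using left_lim_add_const[OF Y_cadlag[OF \<omega>], of t x] nj t unfolding path_def by simp
      have wt2: "?w t \<in> ball y (2 * \<epsilon>)" using wt \<epsilon> by auto
      then have "2 * \<epsilon> \<le> dist x (?w t)" using disj[of "?w t"] by force
      then have "t \<in> jump_times ?R ?w" using t by (simp add: jump_times_def exit_rel_def)
      then have Tt: "T \<omega> \<le> ereal t" unfolding T_def by (rule hit_time_le)
      then have "hit_time ?R ?w < \<infinity>" unfolding T_def by (rule le_less_trans) simp
      then obtain s where s: "hit_time ?R ?w = ereal s" "s \<in> jump_times ?R ?w" "\<And>v. v \<in> jump_times ?R ?w \<Longrightarrow> s \<le> v"
        using hit_time_attained[OF R w] xR path_0[OF \<omega>] by metis
      have s0: "s > 0" using s(2) by (simp add: jump_times_def)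
      have st: "s \<le> t" using Tt s(1) by (simp add: T_def)
      have "dist x (left_lim ?w s) \<le> 2 * \<epsilon>"
      proof (rule tendsto_upperbound)
        show "((\<lambda>v. dist x (?w v)) \<longlongrightarrow> dist x (left_lim ?w s)) (at_left s)"
          by (intro tendsto_intros cadlag_at_left[OF w s0])
        have "dist x (?w v) \<le> 2 * \<epsilon>" if "0 < v" "v < s" for v
        proof (rule ccontr)
          assume "\<not> ?thesis"
          then have "v \<in> jump_times ?R ?w" using that by (simp add: jump_times_def exit_rel_def)
          then show False using s(3)[of v] that by simp
        qed
        then show "\<forall>\<^sub>F v in at_left s. dist x (?w v) \<le> 2 * \<epsilon>"
          unfolding eventually_at_left_field using s0 by (intro exI[of _ 0]) auto
      qed simp
      then have ls: "left_lim ?w s \<in> cball x (2 * \<epsilon>)" by simp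
      have ws: "?w s \<notin> ball y (2 * \<epsilon>)"
      proof
        assume b: "?w s \<in> ball y (2 * \<epsilon>)"
        then have "s \<in> jump_times (segment_rel (- D)) ?w"
          using bspec[OF bspec[OF sep ls] b] s0 by (simp add: jump_times_def segment_rel_def)
        then have "hit_time (segment_rel (- D)) ?w \<le> ereal s" by (rule hit_time_le)
        then have "ereal t \<le> ereal s" using \<sigma> by (rule order_trans[rotated])
        \<comment> \<open>The process is shot down no earlier than \<open>t\<close>, so only a jump at the fixed time \<open>t\<close> remains.\<close>
        then have "s = t" using st by simp
        then show False using disj[OF ls] cont wt2 by simp
      qed
      then have "s \<noteq> t" using wt2 by auto
      then have lt: "s < t" using st by simp
      have "\<epsilon> \<le> norm (?w t - ?w s)"
      proof -
        have "dist y (?w s) \<le> dist y (?w t) + dist (?w t) (?w s)" by (rule dist_triangle)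
        then show ?thesis using ws wt by (simp add: dist_norm)
      qed
      then show "\<omega> \<in> ?F"
        using \<omega> s(1) lt by (simp add: T_def at_time_def path_def)
    qed
    show "?F \<in> events" by measurable
  qed
  moreover have "0 \<le> 1 - exp (- \<epsilon>\<^sup>2 / 2)" by simp
  ultimately have "prob ?E * (1 - exp (- \<epsilon>\<^sup>2 / 2)) \<le> prob ?F * (1 - exp (- \<epsilon>\<^sup>2 / 2))"
    by (rule mult_right_mono)
  also have "\<dots> \<le> t * prob {\<omega>\<in>space M. T \<omega> < ereal t} * gauss_moment TYPE('a) \<alpha>"
    by (rule prob_displacement_after[OF T less_imp_le[OF t] \<epsilon>])
  finally show "prob ?E * (1 - exp (- \<epsilon>\<^sup>2 / 2)) \<le> t * prob {\<omega>\<in>space M. T \<omega> < ereal t} * gauss_moment TYPE('a) \<alpha>" .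
qed

text \<open>
  At its exit the path is in the complement of \<open>D\<close>, at distance at least \<open>2 * \<epsilon>\<close> from
  \<open>y\<close>.
\<close>

lemma prob_return_after_exit_le:
  assumes D: "open D" "- D \<noteq> {}" and x: "x \<in> D" and \<epsilon>: "\<epsilon> > 0" and yD: "ball y (2 * \<epsilon>) \<subseteq> D" and t: "0 < t"
  defines "S \<equiv> \<lambda>\<omega>. hit_time (exit_rel (- D)) (path x \<omega>)"
  shows "prob {\<omega>\<in>space M. S \<omega> < ereal t \<and> x + Y t \<omega> \<in> ball y \<epsilon>} * (1 - exp (- \<epsilon>\<^sup>2 / 2))
       \<le> t * prob {\<omega>\<in>space M. S \<omega> < ereal t} * gauss_moment TYPE('a) \<alpha>"
proof -
  have S: "optional S"
    unfolding S_def by (rule optional_hit_time[OF jump_closed_exit_rel]) (use D x in \<open>auto simp: exit_rel_def\<close>)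
  note [measurable] = optional_measurable[OF S] optional_real_measurable[OF S]
  have [measurable]: "Y t \<in> borel_measurable M" using t by simp
  let ?E = "{\<omega>\<in>space M. S \<omega> < ereal t \<and> x + Y t \<omega> \<in> ball y \<epsilon>}"
  let ?F = "{\<omega>\<in>space M. S \<omega> < ereal t \<and> \<epsilon> \<le> norm (Y t \<omega> - at_time S \<omega>)}"
  have "prob ?E \<le> prob ?F"
  proof (rule finite_measure_mono_AE)
    show "AE \<omega> in M. \<omega> \<in> ?E \<longrightarrow> \<omega> \<in> ?F"
      using AE_exit_time_eq[OF D x]
    proof (rule AE_mp, intro AE_I2 impI)
      fix \<omega> assume \<omega>: "\<omega> \<in> space M" and E: "\<omega> \<in> ?E"
        and ex: "exit_time D (path x \<omega>) = hit_time (exit_rel (- D)) (path x \<omega>) \<and>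
          (hit_time (exit_rel (- D)) (path x \<omega>) < \<infinity> \<longrightarrow>
           path x \<omega> (real_of_ereal (hit_time (exit_rel (- D)) (path x \<omega>))) \<in> - D)"
      have "S \<omega> < \<infinity>" using E by (cases "S \<omega>") auto
      then have "x + at_time S \<omega> \<in> - D" using ex by (simp add: S_def at_time_def path_def)
      then have "2 * \<epsilon> \<le> dist y (x + at_time S \<omega>)" using yD by force
      moreover have "dist y (x + Y t \<omega>) < \<epsilon>" using E by simp
      moreover have "dist y (x + at_time S \<omega>) \<le> dist y (x + Y t \<omega>) + dist (x + Y t \<omega>) (x + at_time S \<omega>)"
        by (rule dist_triangle)
      ultimately have "\<epsilon> \<le> norm (Y t \<omega> - at_time S \<omega>)" by (simp add: dist_norm)
      then show "\<omega> \<in> ?F" using E by simp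
    qed
    show "?F \<in> events" by measurable
  qed
  moreover have "0 \<le> 1 - exp (- \<epsilon>\<^sup>2 / 2)" by simp
  ultimately have "prob ?E * (1 - exp (- \<epsilon>\<^sup>2 / 2)) \<le> prob ?F * (1 - exp (- \<epsilon>\<^sup>2 / 2))"
    by (rule mult_right_mono)
  also have "\<dots> \<le> t * prob {\<omega>\<in>space M. S \<omega> < ereal t} * gauss_moment TYPE('a) \<alpha>"
    by (rule prob_displacement_after[OF S less_imp_le[OF t] \<epsilon>])
  finally show ?thesis .
qed

end

text \<open>
  The lower half of the comparability is integrated over the ball around \<open>y\<close>, divided by
  \<open>t\<close>, and contradicted in the limit \<open>t = 1 / Suc n\<close>, \<open>n\<close> to infinity.
\<close>

lemma not_comparable_if_not_convex:
  fixes X :: "real \<Rightarrow> 'w \<Rightarrow> 'a::euclidean_space" and D :: "'a set"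
  assumes Y: "stable_motion M \<alpha> Y" and XY: "AE \<omega> in M. \<forall>t. X t \<omega> = Y t \<omega>"
    and D: "open D" "- D \<noteq> {}" "C11_set D" and nc: "\<not> convex D"
  shows "\<not> comparable_kernels D (shot_down_heat_kernel D \<alpha> M X) (killed_heat_kernel D \<alpha> M X)"
proof
  interpret stable_motion M \<alpha> Y by fact
  assume "comparable_kernels D (shot_down_heat_kernel D \<alpha> M X) (killed_heat_kernel D \<alpha> M X)"
  then obtain c where c: "c > 0" "\<And>t x y. 0 < t \<Longrightarrow> x \<in> D \<Longrightarrow> y \<in> D \<Longrightarrow>
      inverse c * killed_heat_kernel D \<alpha> M X t x y \<le> shot_down_heat_kernel D \<alpha> M X t x y"
    unfolding comparable_kernels_def by blast
  obtain x y \<epsilon> where \<epsilon>: "\<epsilon> > 0" and xD: "cball x (2 * \<epsilon>) \<subseteq> D" and yD: "ball y (2 * \<epsilon>) \<subseteq> D"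
    and sep: "\<forall>a\<in>cball x (2 * \<epsilon>). \<forall>b\<in>ball y (2 * \<epsilon>). closed_segment a b \<inter> - D \<noteq> {}"
    using nonconvex_separated_balls[OF D(1,3) nc] by blast
  have x: "x \<in> D" using xD \<epsilon> by auto
  have Kc: "closed (- D)" using D by auto
  have xy: "y - x \<noteq> 0"
    using bspec[OF bspec[OF sep, of x], of y] \<epsilon> x by auto
  let ?B = "ball y \<epsilon>"
  have BD: "?B \<subseteq> D" using yD \<epsilon> by auto
  let ?S = "\<lambda>\<omega>. hit_time (exit_rel (- D)) (path x \<omega>)"
  let ?\<sigma> = "\<lambda>\<omega>. hit_time (segment_rel (- D)) (path x \<omega>)"
  let ?T = "\<lambda>\<omega>. hit_time (exit_rel {a. 2 * \<epsilon> \<le> dist x a}) (path x \<omega>)"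
  have S: "optional ?S"
    by (rule optional_hit_time[OF jump_closed_exit_rel[OF Kc]]) (use x in \<open>auto simp: exit_rel_def\<close>)
  have \<sigma>: "optional ?\<sigma>"
    by (rule optional_hit_time[OF jump_closed_segment_rel[OF Kc]]) (use x in \<open>auto simp: segment_rel_def\<close>)
  have S0: "0 < ?S \<omega>" if "\<omega> \<in> space M" for \<omega>
    using hit_time_pos[OF jump_closed_exit_rel[OF Kc] cadlag_path[OF that]] x path_0[OF that] by (simp add: exit_rel_def)
  note T = prob_shot_down_le[OF D(1) \<epsilon> xD yD sep]
  let ?C = "gauss_moment TYPE('a) \<alpha>"
  define e where "e = 1 - exp (- \<epsilon>\<^sup>2 / 2)"
  have e: "e > 0" using \<epsilon> by (simp add: e_def)
  have exitS: "AE \<omega> in M. exit_time D (path x \<omega>) = ?S \<omega>"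
    using AE_exit_time_eq[OF D(1,2) x] by eventually_elim simp
  have shot\<sigma>: "AE \<omega> in M. shot_down_time D (path x \<omega>) = ?\<sigma> \<omega>"
    by (simp add: shot_down_time_eq)
  obtain m where m: "m > 0" "\<forall>\<^sub>F n in sequentially. m / Suc n \<le> prob {\<omega>\<in>space M. Y (1 / Suc n) \<omega> \<in> ball (y - x) \<epsilon>}"
    using prob_ball_lower_bound[OF xy \<epsilon>] by blast
  let ?PS = "\<lambda>n. prob {\<omega>\<in>space M. ?S \<omega> < ereal (1 / Suc n)}"
  let ?PT = "\<lambda>n. prob {\<omega>\<in>space M. ?T \<omega> < ereal (1 / Suc n)}"
  have "\<forall>\<^sub>F n in sequentially. inverse c * (m * e - ?PS n * ?C) \<le> ?PT n * ?C"
    using m(2)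
  proof eventually_elim
    case (elim n)
    define t where "t = 1 / real (Suc n)"
    have t: "t > 0" by (simp add: t_def)
    note [measurable] = optional_measurable[OF S] optional_measurable[OF \<sigma>]
    have [measurable]: "Y t \<in> borel_measurable M" using t by simp
    note k = integral_stopped_kernel[OF XY S exitS t, of ?B]
    note k' = integral_stopped_kernel[OF XY \<sigma> shot\<sigma> t, of ?B]
    have "(LINT z:?B|lborel. inverse c * stopped_kernel (exit_time D) \<alpha> M X t x z)
        \<le> (LINT z:?B|lborel. stopped_kernel (shot_down_time D) \<alpha> M X t x z)"
    proof (rule set_integral_mono)
      show "set_integrable lborel ?B (\<lambda>z. inverse c * stopped_kernel (exit_time D) \<alpha> M X t x z)"
        using k(1) by (intro set_integrable_mult_right) auto
      show "set_integrable lborel ?B (\<lambda>z. stopped_kernel (shot_down_time D) \<alpha> M X t x z)"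
        using k'(1) by auto
      show "inverse c * stopped_kernel (exit_time D) \<alpha> M X t x z \<le> stopped_kernel (shot_down_time D) \<alpha> M X t x z"
        if "z \<in> ?B" for z
        using c(2)[OF t x, of z] that BD by (auto simp: killed_heat_kernel_def shot_down_heat_kernel_def)
    qed
    then have le: "inverse c * prob {\<omega>\<in>space M. ereal t \<le> ?S \<omega> \<and> x + Y t \<omega> \<in> ?B}
       \<le> prob {\<omega>\<in>space M. ereal t \<le> ?\<sigma> \<omega> \<and> x + Y t \<omega> \<in> ?B}"
      using k(2) k'(2) by simp
    have "prob {\<omega>\<in>space M. x + Y t \<omega> \<in> ?B} = prob {\<omega>\<in>space M. ereal t \<le> ?S \<omega> \<and> x + Y t \<omega> \<in> ?B}
        + prob {\<omega>\<in>space M. ?S \<omega> < ereal t \<and> x + Y t \<omega> \<in> ?B}"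
      by (subst finite_measure_Union[symmetric]) (auto intro!: arg_cong[where f=prob])
    moreover have "{\<omega>\<in>space M. x + Y t \<omega> \<in> ?B} = {\<omega>\<in>space M. Y t \<omega> \<in> ball (y - x) \<epsilon>}"
      by (auto simp: dist_norm algebra_simps)
    ultimately have "m * t \<le> prob {\<omega>\<in>space M. ereal t \<le> ?S \<omega> \<and> x + Y t \<omega> \<in> ?B}
        + prob {\<omega>\<in>space M. ?S \<omega> < ereal t \<and> x + Y t \<omega> \<in> ?B}"
      using elim by (simp add: t_def)
    then have "m * t * e \<le> (prob {\<omega>\<in>space M. ereal t \<le> ?S \<omega> \<and> x + Y t \<omega> \<in> ?B}
        + prob {\<omega>\<in>space M. ?S \<omega> < ereal t \<and> x + Y t \<omega> \<in> ?B}) * e"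
      using e by (intro mult_right_mono) auto
    then have "m * t * e - t * ?PS n * ?C \<le> prob {\<omega>\<in>space M. ereal t \<le> ?S \<omega> \<and> x + Y t \<omega> \<in> ?B} * e"
      using prob_return_after_exit_le[OF D(1,2) x \<epsilon> yD t] unfolding e_def[symmetric] t_def[symmetric]
      by (simp add: distrib_right)
    then have "inverse c * (m * t * e - t * ?PS n * ?C) \<le> inverse c * (prob {\<omega>\<in>space M. ereal t \<le> ?S \<omega> \<and> x + Y t \<omega> \<in> ?B} * e)"
      using c(1) by (intro mult_left_mono) auto
    also have "\<dots> \<le> prob {\<omega>\<in>space M. ereal t \<le> ?\<sigma> \<omega> \<and> x + Y t \<omega> \<in> ?B} * e"
      using mult_right_mono[OF le, of e] e by (simp add: mult.assoc)
    also have "\<dots> \<le> t * ?PT n * ?C"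
      using T(3)[OF t] unfolding e_def[symmetric] t_def[symmetric] by blast
    finally have "t * (inverse c * (m * e - ?PS n * ?C)) \<le> t * (?PT n * ?C)"
      by (simp add: algebra_simps)
    then show ?case using t by simp
  qed
  moreover have "(\<lambda>n. inverse c * (m * e - ?PS n * ?C)) \<longlonglongrightarrow> inverse c * (m * e - 0 * ?C)"
    by (intro tendsto_intros optional_prob_tendsto_0 S S0)
  moreover have "(\<lambda>n. ?PT n * ?C) \<longlonglongrightarrow> 0 * ?C"
    by (intro tendsto_intros optional_prob_tendsto_0 T(1,2)[OF zero_less_one])
  ultimately have "inverse c * (m * e - 0 * ?C) \<le> 0 * ?C"
    by (intro tendsto_le[OF sequentially_bot]) auto
  moreover have "inverse c * (m * e) > 0" using c m e by simp
  ultimately show False by simp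
qed

lemma comparable_if_convex:
  fixes X :: "real \<Rightarrow> 'w \<Rightarrow> 'a::euclidean_space" and D :: "'a set"
  assumes Y: "stable_motion M \<alpha> Y" and XY: "AE \<omega> in M. \<forall>t. X t \<omega> = Y t \<omega>"
    and D: "open D" "- D \<noteq> {}" and convex: "convex D"
  shows "comparable_kernels D (shot_down_heat_kernel D \<alpha> M X) (killed_heat_kernel D \<alpha> M X)"
proof -
  interpret stable_motion M \<alpha> Y by fact
  have "shot_down_heat_kernel D \<alpha> M X t x y = killed_heat_kernel D \<alpha> M X t x y" if x: "x \<in> D" for t x y
  proof -
    let ?S = "\<lambda>\<omega>. hit_time (exit_rel (- D)) (path x \<omega>)"
    have S: "optional ?S"
      by (rule optional_hit_time[OF jump_closed_exit_rel]) (use D x in \<open>auto simp: exit_rel_def\<close>)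
    have exitS: "AE \<omega> in M. exit_time D (path x \<omega>) = ?S \<omega>"
      using AE_exit_time_eq[OF D x] by eventually_elim simp
    have shotS: "AE \<omega> in M. shot_down_time D (path x \<omega>) = ?S \<omega>"
      by (simp add: shot_down_time_eq segment_rel_eq_exit_rel[OF convex])
    show ?thesis
      unfolding shot_down_heat_kernel_def killed_heat_kernel_def
      using stopped_kernel_eq[OF XY S exitS] stopped_kernel_eq[OF XY S shotS] by simp
  qed
  then show ?thesis
    unfolding comparable_kernels_def by (intro exI[of _ 1]) auto
qed

theorem theorem2p21:
  fixes \<alpha> :: real
    and M :: "'w measure"
    and X :: "real \<Rightarrow> 'w \<Rightarrow> 'a::euclidean_space"
    and D :: "'a set"
  assumes "0 < \<alpha>" and "\<alpha> < 2"
    and "isotropic_stable_process \<alpha> M X"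
    and "D \<noteq> {}" and "open D" and "bounded D" and "C11_set D"
  shows "comparable_kernels D (shot_down_heat_kernel D \<alpha> M X) (killed_heat_kernel D \<alpha> M X)
         \<longleftrightarrow> convex D"
proof -
  let ?Y = "\<lambda>t \<omega>. X t \<omega> - X 0 \<omega>"
  have Y: "stable_motion M \<alpha> ?Y" by (rule stable_process_motion[OF assms(1-3)])
  have "AE \<omega> in M. X 0 \<omega> = 0"
    using assms(3) by (simp add: isotropic_stable_process_def levy_process_def)
  then have XY: "AE \<omega> in M. \<forall>t. X t \<omega> = ?Y t \<omega>" by eventually_elim simp
  have ne: "- D \<noteq> {}" using assms(6) not_bounded_UNIV by (metis Compl_UNIV_eq double_complement)
  show ?thesis
    using comparable_if_convex[OF Y XY assms(5) ne] not_comparable_if_not_convex[OF Y XY assms(5) ne assms(7)]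
    by blast
qed

end
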